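(* Let $\Delta\subset\mathcal{U}_{I,\ell}(n,\mathfrak{m},z)$ be a chamber. Then $\Delta\cap\mathcal{L}_{I,\ell}(n,\mathfrak{m},z)\neq\emptyset$ if and only if $\Delta\subset\mathcal{L}_{I,\ell}(n,\mathfrak{m},z)$.
   Context: Let $n\ge1$, $\ell\ge3$, $\Gamma_\ell=\langle \gamma_1,\dots,\gamma_\ell : \gamma_1\cdots\gamma_\ell=1\rangle$. Lagrangian representations. A Lagrangian subspace $L\subset\mathbb{C}^n$ has the form $L=g\mathbb{R}^n$, $g\in U(n)$; $\sigma_L=g\sigma_0g^{-1}$, $\sigma_0(z)=\bar z$. A representation $\rho:\Gamma_\ell\to U(n)$ is Lagrangian if there are Lagrangian subspaces $L_1,\dots,L_\ell$ with $\rho(\gamma_s)=\sigma_{L_s}\sigma_{L_{s+1}}$ for all $s$ ($L_{\ell+1}=L_1$). Spectra and strata. For $A\in U(n)$ with eigenvalues $e^{2\pi i\alpha_j}$, $0\le\alpha_1\le\cdots\le\alpha_n<1$, write $\mathrm{spec}(A)=(\alpha_1,\dots,\alpha_n)$, and put $\pi(\rho)=(\alpha^s_j)$ with $\alpha^s=\mathrm{spec}(\rho(\gamma_s))$. The index of $\mathfrak{a}=(\alpha^s_j)$ is $I(\mathfrak{a})=\sum_{s,j}\alpha^s_j$, an integer when $\mathfrak{a}=\pi(\rho)$. Let $\mathfrak{m}=(m^1,\dots,m^\ell)$, each $m^s$ a partition $0=m^s_0<\cdots<m^s_{l_s}=n$, and $z\subset\{1,\dots,\ell\}$. $\mathcal{P}_{I,\ell}(n,\mathfrak{m},z)$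 is the set of $\mathfrak{a}=(\alpha^s_j)$ with $0\le\alpha^s_1\le\cdots\le\alpha^s_n<1$, $I(\mathfrak{a})=I$, such that for each $s$ the distinct entries of $\alpha^s$ are $\hat\alpha^s_1<\cdots<\hat\alpha^s_{l_s}$ with $\alpha^s_i=\hat\alpha^s_j$ for $m^s_{j-1}<i\le m^s_j$, and $\hat\alpha^s_1=0$ iff $s\in z$. $\mathcal{U}_{I,\ell}(n,\mathfrak{m},z)$ (resp. $\mathcal{L}_{I,\ell}(n,\mathfrak{m},z)$) is the set of $\mathfrak{a}\in\mathcal{P}_{I,\ell}(n,\mathfrak{m},z)$ of the form $\pi(\rho)$ for some unitary (resp. Lagrangian) representation $\rho:\Gamma_\ell\to U(n)$. Walls. For $1\le k<n$ and $\wp_{(k)}=(\wp^1_{(k)},\dots,\wp^\ell_{(k)})$ with each $\wp^s_{(k)}\subset\{1,\dots,n\}$ of cardinality $k$, put $I(\mathfrak{a},\wp_{(k)})=\sum_{s=1}^\ell\sum_{j\in\wp^s_{(k)}}\alpha^s_j$. It is known that there is a finite collection $\Phi_{I,\ell}(n)$ of affine functions of the form $\phi(\mathfrak{a})=I(\mathfrak{a},\wp_{(k)})-K$ ($K$ an integer) such that an $\mathfrak{a}$ of index $I$ (with $0\le \alpha^s_1\le\cdots\le\alpha^s_n<1$) equals $\pi(\rho)$ for some unitary representation $\rho$ if and only if $\phi(\mathfrak{a})\le0$ for all $\phi\in\Phi_{I,\ell}(n)$; fix such a collection. The union of outer walls is $\mathcal{W}_{I,\ell}(n,\mathfrak{m},z)=\bigcup_{\phi\in\Phi_{I,\ell}(n)}\{\mathfrak{a}\in\mathcal{P}_{I,\ell}(n,\mathfrak{m},z):\phi(\mathfrak{a})=0\}$.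 A reducible $\rho$ with a reduction $\rho:\Gamma_\ell\to U(k)\times U(n-k)$, $1\le k<n$, determines subsets $\wp^s_{(k)}$ indexing the eigenvalues of $\rho(\gamma_s)$ on the $U(k)$ factor, and an integer $K=I(\pi(\rho),\wp_{(k)})$; $\rho$ is then said to be compatible with $(K,\wp_{(k)})$. Let $\Psi_{I,\ell}(n)$ be the finite collection of functions $\psi(\mathfrak{a})=I(\mathfrak{a},\wp_{(k)})-K$, $K$ a positive integer, such that some reducible $\rho$ compatible with $(K,\wp_{(k)})$ has $\pi(\rho)$ in the interior of $\mathcal{U}_{I,\ell}(n,\mathfrak{m}',z')$ relative to $\mathcal{P}_{I,\ell}(n,\mathfrak{m}',z')$ for some $\mathfrak{m}',z'$. The union of inner walls is $\mathcal{V}_{I,\ell}(n,\mathfrak{m},z)=\bigcup_{\psi\in\Psi_{I,\ell}(n)}\{\mathfrak{a}\in\mathcal{P}_{I,\ell}(n,\mathfrak{m},z):\psi(\mathfrak{a})=0\}$. A chamber is a connected component of $\mathcal{U}_{I,\ell}(n,\mathfrak{m},z)\setminus\{\mathcal{W}_{I,\ell}(n,\mathfrak{m},z)\cup\mathcal{V}_{I,\ell}(n,\mathfrak{m},z)\}$. *)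

theory Defs
  imports "HOL-Analysis.Analysis" "HOL-Algebra.Group"
begin

section \<open>The group $\Gamma_\ell$\<close>

text \<open>
  \<open>\<Gamma>\<^sub>l = \<langle>\<gamma>\<^sub>1, \<dots>, \<gamma>\<^sub>l : \<gamma>\<^sub>1 \<cdots> \<gamma>\<^sub>l = 1\<rangle>\<close> is built as words modulo the congruence generated by free
  cancellation and the relator. The letter \<open>(s, True)\<close> stands for \<open>\<gamma>\<^sub>s\<close> and \<open>(s, False)\<close> for its
  inverse.
\<close>

type_synonym word = "(nat \<times> bool) list"

definition words :: "nat \<Rightarrow> word set" where
  "words l = lists ({1..l} \<times> UNIV)"

definition relator :: "nat \<Rightarrow> word" where
  "relator l = map (\<lambda>s. (s, True)) [1..<Suc l]"

inductive word_eq :: "nat \<Rightarrow> word \<Rightarrow> word \<Rightarrow> bool" for l :: nat where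
  refl: "u \<in> words l \<Longrightarrow> word_eq l u u"
| sym: "word_eq l u v \<Longrightarrow> word_eq l v u"
| trans: "word_eq l u v \<Longrightarrow> word_eq l v w \<Longrightarrow> word_eq l u w"
| cancel: "u \<in> words l \<Longrightarrow> v \<in> words l \<Longrightarrow> s \<in> {1..l} \<Longrightarrow>
    word_eq l (u @ [(s, b), (s, \<not> b)] @ v) (u @ v)"
| relator: "u \<in> words l \<Longrightarrow> v \<in> words l \<Longrightarrow> word_eq l (u @ relator l @ v) (u @ v)"

definition word_class :: "nat \<Rightarrow> word \<Rightarrow> word set" where
  "word_class l u = {v. word_eq l u v}"

definition Gamma :: "nat \<Rightarrow> word set monoid" where
  "Gamma l = \<lparr>carrier = word_class l ` words l,
     mult = (\<lambda>X Y. \<Union>x\<in>X. \<Union>y\<in>Y. word_class l (x @ y)),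
     one = word_class l []\<rparr>"

definition gen :: "nat \<Rightarrow> nat \<Rightarrow> word set" where
  "gen l s = word_class l [(s, True)]"


section \<open>Unitary and Lagrangian representations\<close>

definition conj_transpose :: "complex^'n^'m \<Rightarrow> complex^'m^'n" where
  "conj_transpose A = map_matrix cnj (transpose A)"

definition unitary_matrix :: "complex^'n^'n \<Rightarrow> bool" where
  "unitary_matrix A \<longleftrightarrow> conj_transpose A ** A = mat 1 \<and> A ** conj_transpose A = mat 1"

definition U :: "(complex^'n^'n) monoid" where
  "U = \<lparr>carrier = {A. unitary_matrix A}, mult = (**), one = mat 1\<rparr>"

definition unitary_rep :: "nat \<Rightarrow> (word set \<Rightarrow> complex^'n^'n) \<Rightarrow> bool" where
  "unitary_rep l \<rho> \<longleftrightarrow> \<rho> \<in> hom (Gamma l) U"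

definition real_vectors :: "(complex^'n) set" where
  "real_vectors = {v. \<forall>i. v $ i \<in> \<real>}"

definition lagrangian :: "(complex^'n) set \<Rightarrow> bool" where
  "lagrangian L \<longleftrightarrow> (\<exists>g. unitary_matrix g \<and> L = (*v) g ` real_vectors)"

definition sigma0 :: "complex^'n \<Rightarrow> complex^'n" where
  "sigma0 v = (\<chi> i. cnj (v $ i))"

text \<open>The involution is independent of the choice of \<open>g\<close>, see \<open>sigma_eq\<close> below.\<close>

definition sigma :: "(complex^'n) set \<Rightarrow> complex^'n \<Rightarrow> complex^'n" where
  "sigma L = (let g = (SOME g. unitary_matrix g \<and> L = (*v) g ` real_vectors)
              in (*v) g \<circ> sigma0 \<circ> (*v) (matrix_inv g))"

definition lagrangian_rep :: "nat \<Rightarrow> (word set \<Rightarrow> complex^'n^'n) \<Rightarrow> bool" where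
  "lagrangian_rep l \<rho> \<longleftrightarrow> unitary_rep l \<rho> \<and>
     (\<exists>L :: nat \<Rightarrow> (complex^'n) set.
        (\<forall>s\<in>{1..l}. lagrangian (L s)) \<and> L (Suc l) = L 1 \<and>
        (\<forall>s\<in>{1..l}. (*v) (\<rho> (gen l s)) = sigma (L s) \<circ> sigma (L (Suc s))))"


section \<open>Spectra\<close>

text \<open>
  Multiplicity of \<open>c\<close> as an eigenvalue of \<open>A\<close> on the invariant complex subspace \<open>W\<close>. All matrices
  below are unitary, hence diagonalisable, so that geometric and algebraic multiplicities agree.
\<close>

definition eigen_mult :: "complex^'n^'n \<Rightarrow> (complex^'n) set \<Rightarrow> complex \<Rightarrow> nat" where
  "eigen_mult A W c = vec.dim {v \<in> W. A *v v = c *s v}"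

text \<open>
  A point \<open>(\<alpha>\<^sup>s\<^sub>j)\<close> is a function \<open>a :: nat \<Rightarrow> nat \<Rightarrow> real\<close> with \<open>a s j = \<alpha>\<^sup>s\<^sub>j\<close> for \<open>1 \<le> s \<le> l\<close>,
  \<open>1 \<le> j \<le> n\<close> and \<open>a s j = 0\<close> for all other indices. On the set of such functions the product topology
  of the function type is the Euclidean topology of $\mathbb{R}^{\ell n}$.
\<close>

definition spec :: "complex^'n^'n \<Rightarrow> nat \<Rightarrow> real" where
  "spec A = (THE \<alpha>. (\<forall>j\<in>{1..CARD('n)}. 0 \<le> \<alpha> j \<and> \<alpha> j < 1) \<and>
               mono_on {1..CARD('n)} \<alpha> \<and> (\<forall>j. j \<notin> {1..CARD('n)} \<longrightarrow> \<alpha> j = 0) \<and>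
               (\<forall>c. eigen_mult A UNIV c = card {j \<in> {1..CARD('n)}. cis (2 * pi * \<alpha> j) = c}))"

definition spectra :: "nat \<Rightarrow> (word set \<Rightarrow> complex^'n^'n) \<Rightarrow> nat \<Rightarrow> nat \<Rightarrow> real" where
  "spectra l \<rho> = (\<lambda>s. if s \<in> {1..l} then spec (\<rho> (gen l s)) else (\<lambda>_. 0))"

definition weights :: "nat \<Rightarrow> nat \<Rightarrow> (nat \<Rightarrow> nat \<Rightarrow> real) set" where
  "weights n l = {a. (\<forall>s\<in>{1..l}. mono_on {1..n} (a s) \<and> (\<forall>j\<in>{1..n}. 0 \<le> a s j \<and> a s j < 1)) \<and>
                     (\<forall>s j. s \<notin> {1..l} \<or> j \<notin> {1..n} \<longrightarrow> a s j = 0)}"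

definition index :: "nat \<Rightarrow> nat \<Rightarrow> (nat \<Rightarrow> nat \<Rightarrow> real) \<Rightarrow> real" where
  "index n l a = (\<Sum>s=1..l. \<Sum>j=1..n. a s j)"


section \<open>Strata\<close>

text \<open>A partition \<open>0 = m\<^sub>0 < \<dots> < m\<^sub>r = n\<close> is the list \<open>[m\<^sub>0, \<dots>, m\<^sub>r]\<close>, so \<open>r = length m - 1\<close>.\<close>

definition is_partition :: "nat \<Rightarrow> nat list \<Rightarrow> bool" where
  "is_partition n m \<longleftrightarrow> m \<noteq> [] \<and> hd m = 0 \<and> last m = n \<and> sorted_wrt (<) m"

definition is_stratum :: "nat \<Rightarrow> nat \<Rightarrow> (nat \<Rightarrow> nat list) \<Rightarrow> nat set \<Rightarrow> bool" where
  "is_stratum n l m z \<longleftrightarrow> (\<forall>s\<in>{1..l}. is_partition n (m s)) \<and> z \<subseteq> {1..l}"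

definition P :: "int \<Rightarrow> nat \<Rightarrow> nat \<Rightarrow> (nat \<Rightarrow> nat list) \<Rightarrow> nat set \<Rightarrow> (nat \<Rightarrow> nat \<Rightarrow> real) set" where
  "P I l n m z = {a \<in> weights n l. index n l a = of_int I \<and>
     (\<forall>s\<in>{1..l}. \<exists>\<beta> :: nat \<Rightarrow> real.
        strict_mono_on {1..length (m s) - 1} \<beta> \<and>
        (\<forall>j\<in>{1..length (m s) - 1}. \<forall>i. m s ! (j - 1) < i \<and> i \<le> m s ! j \<longrightarrow> a s i = \<beta> j) \<and>
        (\<beta> 1 = 0 \<longleftrightarrow> s \<in> z))}"

definition unitary_locus ::
  "'n::finite itself \<Rightarrow> int \<Rightarrow> nat \<Rightarrow> (nat \<Rightarrow> nat list) \<Rightarrow> nat set \<Rightarrow> (nat \<Rightarrow> nat \<Rightarrow> real) set" where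
  "unitary_locus N I l m z =
     {a \<in> P I l CARD('n) m z. \<exists>\<rho> :: word set \<Rightarrow> complex^'n^'n. unitary_rep l \<rho> \<and> a = spectra l \<rho>}"

definition lagrangian_locus ::
  "'n::finite itself \<Rightarrow> int \<Rightarrow> nat \<Rightarrow> (nat \<Rightarrow> nat list) \<Rightarrow> nat set \<Rightarrow> (nat \<Rightarrow> nat \<Rightarrow> real) set" where
  "lagrangian_locus N I l m z =
     {a \<in> P I l CARD('n) m z. \<exists>\<rho> :: word set \<Rightarrow> complex^'n^'n. lagrangian_rep l \<rho> \<and> a = spectra l \<rho>}"


section \<open>Walls and chambers\<close>

definition index_sets :: "nat \<Rightarrow> nat \<Rightarrow> nat \<Rightarrow> (nat \<Rightarrow> nat set) set" where
  "index_sets n l k = {p. \<forall>s\<in>{1..l}. p s \<subseteq> {1..n} \<and> card (p s) = k}"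

definition partial_index :: "nat \<Rightarrow> (nat \<Rightarrow> nat set) \<Rightarrow> (nat \<Rightarrow> nat \<Rightarrow> real) \<Rightarrow> real" where
  "partial_index l p a = (\<Sum>s=1..l. \<Sum>j\<in>p s. a s j)"

definition wall_fun :: "nat \<Rightarrow> (nat \<Rightarrow> nat set) \<Rightarrow> int \<Rightarrow> (nat \<Rightarrow> nat \<Rightarrow> real) \<Rightarrow> real" where
  "wall_fun l p K = (\<lambda>a. partial_index l p a - of_int K)"

text \<open>\<open>\<Phi>\<close> is an admissible choice of the finite collection of inequalities cutting out the spectra of
  unitary representations of index \<open>I\<close>.\<close>

definition outer_wall_funs ::
  "'n::finite itself \<Rightarrow> int \<Rightarrow> nat \<Rightarrow> ((nat \<Rightarrow> nat \<Rightarrow> real) \<Rightarrow> real) set \<Rightarrow> bool" where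
  "outer_wall_funs N I l \<Phi> \<longleftrightarrow> finite \<Phi> \<and>
     (\<forall>\<phi>\<in>\<Phi>. \<exists>k p K. 1 \<le> k \<and> k < CARD('n) \<and> p \<in> index_sets CARD('n) l k \<and> \<phi> = wall_fun l p K) \<and>
     (\<forall>a\<in>weights CARD('n) l. index CARD('n) l a = of_int I \<longrightarrow>
        ((\<exists>\<rho> :: word set \<Rightarrow> complex^'n^'n. unitary_rep l \<rho> \<and> a = spectra l \<rho>) \<longleftrightarrow> (\<forall>\<phi>\<in>\<Phi>. \<phi> a \<le> 0)))"

definition outer_walls ::
  "int \<Rightarrow> nat \<Rightarrow> nat \<Rightarrow> (nat \<Rightarrow> nat list) \<Rightarrow> nat set \<Rightarrow> ((nat \<Rightarrow> nat \<Rightarrow> real) \<Rightarrow> real) set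
     \<Rightarrow> (nat \<Rightarrow> nat \<Rightarrow> real) set" where
  "outer_walls I l n m z \<Phi> = (\<Union>\<phi>\<in>\<Phi>. {a \<in> P I l n m z. \<phi> a = 0})"

text \<open>
  A reduction to \<open>U(k) \<times> U(n-k)\<close> is an orthogonal splitting of $\mathbb{C}^n$ into invariant complex
  subspaces of dimensions \<open>k\<close> and \<open>n - k\<close>. The library's \<open>W\<^sup>\<bottom>\<close> uses the real inner product, the real
  part of the Hermitian one; for a complex subspace \<open>W\<close> the two orthogonal complements coincide.
\<close>

definition reduction :: "nat \<Rightarrow> (word set \<Rightarrow> complex^'n^'n) \<Rightarrow> nat \<Rightarrow> (complex^'n) set \<Rightarrow> bool" where
  "reduction l \<rho> k W \<longleftrightarrow> 1 \<le> k \<and> k < CARD('n) \<and> vec.subspace W \<and> vec.dim W = k \<and>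
     (\<forall>x\<in>carrier (Gamma l). (*v) (\<rho> x) ` W \<subseteq> W \<and> (*v) (\<rho> x) ` (W\<^sup>\<bottom>) \<subseteq> W\<^sup>\<bottom>)"

text \<open>
  If an eigenvalue of \<open>\<rho>(\<gamma>\<^sub>s)\<close> is repeated, several sets \<open>p s\<close> index the eigenvalues on \<open>W\<close>; \<open>\<rho>\<close> is
  compatible with each of them.
\<close>

definition compatible ::
  "nat \<Rightarrow> (word set \<Rightarrow> complex^'n^'n) \<Rightarrow> nat \<Rightarrow> int \<Rightarrow> (nat \<Rightarrow> nat set) \<Rightarrow> bool" where
  "compatible l \<rho> k K p \<longleftrightarrow> p \<in> index_sets CARD('n) l k \<and>
     (\<exists>W. reduction l \<rho> k W \<and>
        (\<forall>s\<in>{1..l}. \<forall>c. eigen_mult (\<rho> (gen l s)) W c =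
           card {j \<in> p s. cis (2 * pi * spectra l \<rho> s j) = c})) \<and>
     of_int K = partial_index l p (spectra l \<rho>)"

definition inner_wall_funs ::
  "'n::finite itself \<Rightarrow> int \<Rightarrow> nat \<Rightarrow> ((nat \<Rightarrow> nat \<Rightarrow> real) \<Rightarrow> real) set" where
  "inner_wall_funs N I l = {wall_fun l p K | p K. 0 < K \<and>
     (\<exists>k m' z'. \<exists>\<rho> :: word set \<Rightarrow> complex^'n^'n.
        is_stratum CARD('n) l m' z' \<and> unitary_rep l \<rho> \<and> compatible l \<rho> k K p \<and>
        spectra l \<rho> \<in> top_of_set (P I l CARD('n) m' z') interior_of unitary_locus N I l m' z')}"

definition inner_walls ::
  "'n::finite itself \<Rightarrow> int \<Rightarrow> nat \<Rightarrow> (nat \<Rightarrow> nat list) \<Rightarrow> nat set \<Rightarrow> (nat \<Rightarrow> nat \<Rightarrow> real) set" where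
  "inner_walls N I l m z = (\<Union>\<psi>\<in>inner_wall_funs N I l. {a \<in> P I l CARD('n) m z. \<psi> a = 0})"

definition chambers ::
  "'n::finite itself \<Rightarrow> int \<Rightarrow> nat \<Rightarrow> (nat \<Rightarrow> nat list) \<Rightarrow> nat set
     \<Rightarrow> ((nat \<Rightarrow> nat \<Rightarrow> real) \<Rightarrow> real) set \<Rightarrow> (nat \<Rightarrow> nat \<Rightarrow> real) set set" where
  "chambers N I l m z \<Phi> = components
     (unitary_locus N I l m z - (outer_walls I l CARD('n) m z \<Phi> \<union> inner_walls N I l m z))"


section \<open>Basic facts confirming the encodings\<close>

lemma words_append_iff [simp]: "u @ v \<in> words l \<longleftrightarrow> u \<in> words l \<and> v \<in> words l"
  by (auto simp: words_def)

lemma relator_words [simp]: "relator l \<in> words l"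
  by (auto simp: words_def relator_def)

lemma Nil_words [simp]: "[] \<in> words l"
  by (simp add: words_def)

lemma word_eq_words: "word_eq l u v \<Longrightarrow> u \<in> words l \<and> v \<in> words l"
proof (induction rule: word_eq.induct)
  case (cancel u v s b)
  then show ?case by (auto simp: words_def)
qed auto

lemma word_eq_ctxt: "word_eq l u v \<Longrightarrow> x \<in> words l \<Longrightarrow> y \<in> words l \<Longrightarrow> word_eq l (x @ u @ y) (x @ v @ y)"
proof (induction rule: word_eq.induct)
  case (cancel u v s b)
  then show ?case using word_eq.cancel[of "x @ u" l "v @ y" s b] by simp
next
  case (relator u v)
  then show ?case using word_eq.relator[of "x @ u" l "v @ y"] by simp
next
  case (sym u v)
  then show ?case by (blast intro: word_eq.sym)
next
  case (trans u v w)
  then show ?case by (blast intro: word_eq.trans)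
qed (simp add: word_eq.refl)

lemma word_class_eq_iff:
  "u \<in> words l \<Longrightarrow> v \<in> words l \<Longrightarrow> word_class l u = word_class l v \<longleftrightarrow> word_eq l u v"
  unfolding word_class_def set_eq_iff mem_Collect_eq
  by (meson word_eq.refl word_eq.sym word_eq.trans)

lemma word_eq_append:
  assumes "word_eq l u u'" "word_eq l v v'" shows "word_eq l (u @ v) (u' @ v')"
proof -
  have "word_eq l (u @ v) (u' @ v)" "word_eq l (u' @ v) (u' @ v')"
    using word_eq_ctxt[OF assms(1), of "[]" v] word_eq_ctxt[OF assms(2), of u' "[]"]
      word_eq_words[OF assms(1)] word_eq_words[OF assms(2)] by simp_all
  then show ?thesis by (rule word_eq.trans)
qed

lemma Gamma_mult:
  assumes "u \<in> words l" "v \<in> words l"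
  shows "word_class l u \<otimes>\<^bsub>Gamma l\<^esub> word_class l v = word_class l (u @ v)"
proof -
  have "word_class l (x @ y) = word_class l (u @ v)"
    if "x \<in> word_class l u" "y \<in> word_class l v" for x y
    using that word_eq_append[of l u x v y] word_eq_words assms
    by (subst word_class_eq_iff) (auto simp: word_class_def intro: word_eq.sym)
  moreover have "u \<in> word_class l u" "v \<in> word_class l v"
    using assms by (auto simp: word_class_def intro: word_eq.refl)
  ultimately have "(\<Union>x\<in>word_class l u. \<Union>y\<in>word_class l v. word_class l (x @ y)) =
      word_class l (u @ v)" by blast
  then show ?thesis by (simp add: Gamma_def)
qed

lemma word_inverse:
  assumes "u \<in> words l"
  shows "\<exists>v\<in>words l. word_eq l (v @ u) []"
  using assms
proof (induction u)
  case Nil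
  then show ?case by (auto intro!: bexI[of _ "[]"] word_eq.refl)
next
  case (Cons a u)
  obtain s b where a: "a = (s, b)" by (cases a)
  from Cons obtain v where v: "v \<in> words l" "word_eq l (v @ u) []" and u: "u \<in> words l"
    and s: "s \<in> {1..l}" by (auto simp: words_def a)
  have "word_eq l (v @ [(s, \<not> b), (s, \<not> \<not> b)] @ u) (v @ u)"
    using v u s by (intro word_eq.cancel)
  then have "word_eq l (v @ [(s, \<not> b), (s, \<not> \<not> b)] @ u) []"
    using v(2) by (rule word_eq.trans)
  then have "word_eq l ((v @ [(s, \<not> b)]) @ a # u) []"
    by (simp add: a)
  moreover have "v @ [(s, \<not> b)] \<in> words l" using v(1) s by (auto simp: words_def)
  ultimately show ?case by blast
qed

lemma group_Gamma: "group (Gamma l)"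
proof (rule groupI)
  fix x assume "x \<in> carrier (Gamma l)"
  then obtain u where u: "u \<in> words l" "x = word_class l u" by (auto simp: Gamma_def)
  then obtain v where v: "v \<in> words l" "word_eq l (v @ u) []" using word_inverse by blast
  then have "word_class l v \<otimes>\<^bsub>Gamma l\<^esub> x = \<one>\<^bsub>Gamma l\<^esub>"
    using u word_class_eq_iff[of "v @ u" l "[]"] by (simp add: Gamma_mult) (simp add: Gamma_def)
  then show "\<exists>y\<in>carrier (Gamma l). y \<otimes>\<^bsub>Gamma l\<^esub> x = \<one>\<^bsub>Gamma l\<^esub>"
    using v by (auto simp: Gamma_def)
  show "\<one>\<^bsub>Gamma l\<^esub> \<otimes>\<^bsub>Gamma l\<^esub> x = x"
    using Gamma_mult[of "[]" l u] u by (simp add: Gamma_def)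
next
  fix x y assume "x \<in> carrier (Gamma l)" "y \<in> carrier (Gamma l)"
  then obtain u v where "u \<in> words l" "v \<in> words l" "x = word_class l u" "y = word_class l v"
    by (auto simp: Gamma_def)
  then show "x \<otimes>\<^bsub>Gamma l\<^esub> y \<in> carrier (Gamma l)"
    by (simp add: Gamma_mult) (simp add: Gamma_def)
next
  show "\<one>\<^bsub>Gamma l\<^esub> \<in> carrier (Gamma l)" by (simp add: Gamma_def)
next
  fix x y z assume "x \<in> carrier (Gamma l)" "y \<in> carrier (Gamma l)" "z \<in> carrier (Gamma l)"
  then obtain u v w where "u \<in> words l" "v \<in> words l" "w \<in> words l"
    "x = word_class l u" "y = word_class l v" "z = word_class l w"
    by (auto simp: Gamma_def)
  then show "x \<otimes>\<^bsub>Gamma l\<^esub> y \<otimes>\<^bsub>Gamma l\<^esub> z = x \<otimes>\<^bsub>Gamma l\<^esub> (y \<otimes>\<^bsub>Gamma l\<^esub> z)"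
    by (simp add: Gamma_mult)
qed

lemma Gamma_relation: "word_class l (relator l) = \<one>\<^bsub>Gamma l\<^esub>"
  using word_eq.relator[of "[]" l "[]"] word_class_eq_iff[of "relator l" l "[]"]
  by (simp add: Gamma_def)

text \<open>Hence a representation of \<open>\<Gamma>\<^sub>l\<close> is the same as an \<open>l\<close>-tuple of unitary matrices with product \<open>1\<close>.\<close>

lemma (in group) Gamma_lift:
  assumes A: "\<And>s. s \<in> {1..l} \<Longrightarrow> A s \<in> carrier G"
    and rel: "foldr (\<lambda>s x. A s \<otimes> x) [1..<Suc l] \<one> = \<one>"
  shows "\<exists>h \<in> hom (Gamma l) G. \<forall>s\<in>{1..l}. h (gen l s) = A s"
proof -
  define E where "E w = foldr (\<lambda>p x. (if snd p then A (fst p) else inv (A (fst p))) \<otimes> x) w \<one>"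
    for w :: word
  have let_closed: "(if b then A s else inv (A s)) \<in> carrier G" if "s \<in> {1..l}" for s b
    using A[OF that] by simp
  have E_Nil: "E [] = \<one>" by (simp add: E_def)
  have E_Cons: "E ((s, b) # w) = (if b then A s else inv (A s)) \<otimes> E w" for s b w
    by (simp add: E_def)
  have E_closed: "w \<in> words l \<Longrightarrow> E w \<in> carrier G" for w
  proof (induction w)
    case (Cons p w)
    then show ?case using let_closed by (cases p) (simp add: words_def E_Cons)
  qed (simp add: E_Nil)
  have E_app: "u \<in> words l \<Longrightarrow> v \<in> words l \<Longrightarrow> E (u @ v) = E u \<otimes> E v" for u v
  proof (induction u)
    case Nil
    then show ?case using E_closed by (simp add: E_Nil)
  next
    case (Cons p u)
    obtain s b where p: "p = (s, b)" by (cases p)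
    have "s \<in> {1..l}" "u \<in> words l" using Cons.prems by (auto simp: words_def p)
    then have "E (u @ v) = E u \<otimes> E v" "(if b then A s else inv (A s)) \<in> carrier G"
        "E u \<in> carrier G" "E v \<in> carrier G"
      using Cons let_closed E_closed by auto
    then show ?case
      unfolding p append_Cons E_Cons by (simp only: m_assoc)
  qed
  have "E (relator l) = foldr (\<lambda>s x. A s \<otimes> x) [1..<Suc l] \<one>"
    by (simp only: E_def relator_def foldr_map o_def fst_conv snd_conv if_True)
  then have E_rel: "E (relator l) = \<one>" using rel by simp
  have E_eq: "word_eq l u v \<Longrightarrow> E u = E v" for u v
  proof (induction rule: word_eq.induct)
    case (cancel u v s b)
    have w: "[(s, b), (s, \<not> b)] \<in> words l" using cancel by (simp add: words_def)
    have "E [(s, b), (s, \<not> b)] = \<one>" using A[of s] cancel by (cases b) (simp_all add: E_Cons E_Nil)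
    then have "E ([(s, b), (s, \<not> b)] @ v) = E v"
      using E_app[OF w, of v] cancel E_closed[of v] by simp
    moreover have "[(s, b), (s, \<not> b)] @ v \<in> words l" using w cancel by (simp only: words_append_iff)
    ultimately show ?case using cancel E_app by (simp only:)
  next
    case (relator u v)
    then show ?case using E_app E_closed E_rel by simp
  qed auto
  define h where "h X = E (SOME w. w \<in> X)" for X
  have h: "h (word_class l u) = E u" if "u \<in> words l" for u
  proof -
    have "u \<in> word_class l u" using that by (simp add: word_class_def word_eq.refl)
    then have "(SOME w. w \<in> word_class l u) \<in> word_class l u" by (rule someI)
    then show ?thesis using E_eq by (simp add: word_class_def h_def)
  qed
  have "h \<in> hom (Gamma l) G"
  proof (rule homI)
    fix x assume "x \<in> carrier (Gamma l)"
    then show "h x \<in> carrier G" by (auto simp: Gamma_def h E_closed)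
  next
    fix x y assume "x \<in> carrier (Gamma l)" "y \<in> carrier (Gamma l)"
    then obtain u v where "u \<in> words l" "v \<in> words l" "x = word_class l u" "y = word_class l v"
      by (auto simp: Gamma_def)
    then show "h (x \<otimes>\<^bsub>Gamma l\<^esub> y) = h x \<otimes> h y" by (simp add: Gamma_mult h E_app)
  qed
  moreover have "h (gen l s) = A s" if "s \<in> {1..l}" for s
    using that A[OF that] by (simp add: gen_def h words_def E_Cons E_Nil)
  ultimately show ?thesis by blast
qed

lemma unitary_matrix_inv:
  assumes "unitary_matrix g" shows "matrix_inv g = conj_transpose g"
proof -
  have "g ** matrix_inv g = mat 1"
    using assms someI_ex[of "\<lambda>h. g ** h = mat 1 \<and> h ** g = mat 1"]
    unfolding unitary_matrix_def matrix_inv_def by blast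
  then show ?thesis
    using assms matrix_mul_assoc[of "conj_transpose g" g "matrix_inv g"]
    by (simp add: unitary_matrix_def)
qed

lemma conj_transpose_mult: "conj_transpose (A ** B) = conj_transpose B ** conj_transpose A"
  by (simp add: conj_transpose_def vec_eq_iff matrix_matrix_mult_def transpose_def mult.commute)

lemma unitary_matrix_mult:
  assumes "unitary_matrix A" "unitary_matrix B" shows "unitary_matrix (A ** B)"
proof -
  have "conj_transpose B ** conj_transpose A ** (A ** B) =
      conj_transpose B ** (conj_transpose A ** A) ** B"
    by (simp only: matrix_mul_assoc)
  moreover have "A ** B ** (conj_transpose B ** conj_transpose A) =
      A ** (B ** conj_transpose B) ** conj_transpose A"
    by (simp only: matrix_mul_assoc)
  ultimately show ?thesis
    using assms by (simp add: unitary_matrix_def conj_transpose_mult)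
qed

lemma unitary_matrix_conj_transpose: "unitary_matrix A \<Longrightarrow> unitary_matrix (conj_transpose A)"
proof -
  have "conj_transpose (conj_transpose A) = A"
    by (simp add: conj_transpose_def vec_eq_iff transpose_def)
  then show "unitary_matrix A \<Longrightarrow> ?thesis" by (simp add: unitary_matrix_def)
qed

lemma group_U: "group (U :: (complex^'n^'n) monoid)"
proof (rule groupI)
  fix A :: "complex^'n^'n" assume "A \<in> carrier U"
  then show "\<exists>B\<in>carrier U. B \<otimes>\<^bsub>U\<^esub> A = \<one>\<^bsub>U\<^esub>"
    by (intro bexI[of _ "conj_transpose A"])
      (auto simp: U_def unitary_matrix_conj_transpose, simp add: unitary_matrix_def)
next
  show "\<one>\<^bsub>U\<^esub> \<in> carrier (U :: (complex^'n^'n) monoid)"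
  proof -
    have "conj_transpose (mat 1) = (mat 1 :: complex^'n^'n)"
      by (simp add: conj_transpose_def vec_eq_iff transpose_def mat_def)
    then show ?thesis by (simp add: U_def unitary_matrix_def)
  qed
qed (auto simp: U_def unitary_matrix_mult matrix_mul_assoc)

lemma sigma_eq:
  fixes g :: "complex^'n^'n"
  assumes g: "unitary_matrix g" and L: "L = (*v) g ` real_vectors"
  shows "sigma L = (*v) g \<circ> sigma0 \<circ> (*v) (matrix_inv g)"
proof -
  define h where "h = (SOME h. unitary_matrix h \<and> L = (*v) h ` real_vectors)"
  have h: "unitary_matrix h" "L = (*v) h ` real_vectors"
    using someI[of "\<lambda>h. unitary_matrix h \<and> L = (*v) h ` real_vectors" g] g L by (auto simp: h_def)
  define q where "q = conj_transpose g ** h"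
  have q: "q *v v \<in> real_vectors" if "v \<in> real_vectors" for v
  proof -
    have "h *v v \<in> L" using that h by blast
    then obtain w where w: "h *v v = g *v w" "w \<in> real_vectors" using L by blast
    have "q *v v = conj_transpose g *v (g *v w)" by (simp add: q_def w flip: matrix_vector_mul_assoc)
    then show ?thesis using w g by (simp add: matrix_vector_mul_assoc unitary_matrix_def)
  qed
  have qr: "q $ i $ j \<in> \<real>" for i j
  proof -
    have "axis j 1 \<in> (real_vectors :: (complex^'n) set)" by (auto simp: real_vectors_def axis_def)
    from q[OF this] have "(q *v axis j 1) $ i \<in> \<real>" by (simp add: real_vectors_def)
    then show ?thesis 
      by (simp add: matrix_vector_mult_def axis_def if_distrib cong: if_cong)
  qed
  have s: "sigma0 (q *v v) = q *v sigma0 v" for v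
    using qr by (simp add: sigma0_def vec_eq_iff matrix_vector_mult_def Reals_cnj_iff)
  have hq: "h = g ** q"
    using g unfolding q_def unitary_matrix_def by (simp add: matrix_mul_assoc)
  have gq: "q ** conj_transpose h = conj_transpose g"
    using h(1) unfolding q_def unitary_matrix_def by (simp flip: matrix_mul_assoc)
  have "h *v sigma0 (conj_transpose h *v v) = g *v sigma0 (conj_transpose g *v v)" for v
  proof -
    have "h *v sigma0 (conj_transpose h *v v) = g *v (q *v sigma0 (conj_transpose h *v v))"
      by (simp add: hq[symmetric] matrix_vector_mul_assoc)
    also have "\<dots> = g *v sigma0 (conj_transpose g *v v)"
      by (simp add: s[symmetric] matrix_vector_mul_assoc gq)
    finally show ?thesis .
  qed
  then show ?thesis
    unfolding sigma_def Let_def h_def[symmetric]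
    by (simp add: fun_eq_iff unitary_matrix_inv g h)
qed

end

theory Submission
  imports Defs
begin

text \<open>
  Let \<open>g\<^sub>s \<in> U(n)\<close> define the Lagrangian subspaces \<open>L\<^sub>s\<close> of a Lagrangian representation. The symmetric
  unitary matrix \<open>g\<^sub>s\<^sup>* \<rho>(\<gamma>\<^sub>s) g\<^sub>s\<close> can be diagonalised by a real orthogonal matrix, whence
  \<open>g\<^sub>s\<^sub>+\<^sub>1 = g\<^sub>s B\<^sub>s E\<^sub>s C\<^sub>s\<close> with \<open>B\<^sub>s, C\<^sub>s\<close> real orthogonal and \<open>E\<^sub>s\<close> diagonal with entries \<open>exp (- \<pi> i \<alpha>\<^sup>s\<^sub>j)\<close>.
  So \<open>\<alpha>\<close> belongs to the Lagrangian locus iff the chain \<open>E\<^sub>1 Q\<^sub>1 \<cdots> E\<^sub>l Q\<^sub>l\<close> is the identity for some real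
  orthogonal \<open>Q\<^sub>1, \<dots>, Q\<^sub>l\<close>. By compactness the locus is closed.

  For openness, let \<open>a\<^sub>k\<close> tend to a point \<open>b\<close> of the locus and let \<open>G\<^sub>k\<close> be a chain for \<open>a\<^sub>k\<close> with maximal
  real part of the trace; then \<open>G\<^sub>k\<close> tends to the identity. Stationarity says that the Hermitian matrix
  \<open>-i (G\<^sub>k - G\<^sub>k\<^sup>*)\<close> becomes real when conjugated by any partial chain. If its traceless part vanishes
  then \<open>G\<^sub>k\<close> is a scalar, and by its determinant a root of unity, hence \<open>G\<^sub>k = 1\<close> for large \<open>k\<close>. Otherwise
  the normalised traceless parts accumulate at a nonscalar Hermitian \<open>H\<close> that is real along a closed
  chain for \<open>b\<close>. Such an \<open>H\<close> commutes with the corresponding representation, and its eigenspaces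
  are reductions that put \<open>b\<close> on an inner wall.
\<close>

section \<open>Unitary and real orthogonal matrices\<close>

text \<open>Constant diagonals \<open>dg (\<lambda>_. c)\<close> also serve as complex scalars, so
  that scaling by \<open>c\<close> is a matrix product and obeys the rules for
  \<open>**\<close>.\<close>

definition dg :: "('n \<Rightarrow> complex) \<Rightarrow> complex^'n^'n" where
  "dg d = (\<chi> i j. if i = j then d i else 0)"

definition realmat :: "complex^'n^'m \<Rightarrow> bool" where
  "realmat A \<longleftrightarrow> (\<forall>i j. Im (A $ i $ j) = 0)"

definition real_orth :: "complex^'n^'n \<Rightarrow> bool" where
  "real_orth Q \<longleftrightarrow> unitary_matrix Q \<and> realmat Q"

lemma dg_nth [simp]: "dg d $ i $ j = (if i = j then d i else 0)"
  by (simp add: dg_def)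

lemma conj_transpose_nth [simp]: "conj_transpose A $ i $ j = cnj (A $ j $ i)"
  by (simp add: conj_transpose_def transpose_def)

lemma conj_transpose_conj_transpose [simp]: "conj_transpose (conj_transpose A) = A"
  by (simp add: vec_eq_iff)

lemma conj_transpose_mat_1 [simp]: "conj_transpose (mat 1 :: complex^'n^'n) = mat 1"
  by (simp add: vec_eq_iff mat_def)

lemma mult_dg_nth [simp]: "(A ** dg d) $ i $ j = A $ i $ j * d j"
  by (simp add: matrix_matrix_mult_def if_distrib cong: if_cong)

lemma dg_mult_nth [simp]: "(dg d ** A) $ i $ j = d i * A $ i $ j"
  by (simp add: matrix_matrix_mult_def if_distrib if_distribR cong: if_cong)

lemma dg_mult_dg [simp]: "dg d ** dg e = dg (\<lambda>i. d i * e i)"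
  by (simp add: vec_eq_iff)

lemma dg_mult_dg_mult [simp]: "dg d ** (dg e ** A) = dg (\<lambda>i. d i * e i) ** A"
  by (simp add: matrix_mul_assoc)

lemma conj_transpose_dg [simp]: "conj_transpose (dg d) = dg (\<lambda>i. cnj (d i))"
  by (simp add: vec_eq_iff)

lemma transpose_dg [simp]: "transpose (dg d) = dg d"
  by (simp add: vec_eq_iff transpose_def)

lemma dg_1: "dg (\<lambda>i. 1) = mat 1"
  by (simp add: vec_eq_iff mat_def)

lemma det_dg [simp]: "det (dg d :: complex^'n^'n) = (\<Prod>i\<in>UNIV. d i)"
  by (subst det_diagonal) auto

lemma dg_mult_vec_nth [simp]: "(dg d *v v) $ i = d i * v $ i"
  by (simp add: matrix_vector_mult_def if_distrib if_distribR cong: if_cong)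

lemma unitary_left [simp]: "unitary_matrix A \<Longrightarrow> conj_transpose A ** A = mat 1"
  and unitary_right [simp]: "unitary_matrix A \<Longrightarrow> A ** conj_transpose A = mat 1"
  by (auto simp: unitary_matrix_def)

lemma unitary_cancel_left [simp]:
  "unitary_matrix A \<Longrightarrow> conj_transpose A ** (A ** B) = B"
  "unitary_matrix A \<Longrightarrow> A ** (conj_transpose A ** B) = B"
  by (simp_all add: matrix_mul_assoc)

lemma unitary_cancel_vec [simp]:
  "unitary_matrix A \<Longrightarrow> conj_transpose A *v (A *v v) = v"
  "unitary_matrix A \<Longrightarrow> A *v (conj_transpose A *v v) = v"
  by (simp_all add: matrix_vector_mul_assoc)

lemma unitary_mat_1 [simp]: "unitary_matrix (mat 1 :: complex^'n^'n)"
  unfolding unitary_matrix_def by simp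

lemma unitary_dg:
  assumes "\<And>i. cmod (d i) = 1"
  shows "unitary_matrix (dg d)"
proof -
  have "d i * cnj (d i) = 1" for i
    using assms[of i] by (simp flip: complex_norm_square)
  moreover from this have "cnj (d i) * d i = 1" for i
    by (simp only: mult.commute)
  ultimately show ?thesis
    unfolding unitary_matrix_def by (simp add: dg_1)
qed

lemma det_unitary_cong:
  fixes V :: "complex^'n^'n"
  assumes "unitary_matrix V"
  shows "det (V ** A ** conj_transpose V) = det A"
proof -
  have "det V * det (conj_transpose V) = 1"
    using assms by (simp flip: det_mul)
  then show ?thesis by (simp add: det_mul)
qed

section \<open>Real matrices and the real orthogonal group\<close>

lemma realmat_mult: "realmat A \<Longrightarrow> realmat B \<Longrightarrow> realmat (A ** B)"
  by (simp add: realmat_def matrix_matrix_mult_def)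

lemma realmat_conj_transpose: "realmat A \<Longrightarrow> realmat (conj_transpose A)"
  by (simp add: realmat_def)

lemma realmat_mat_1 [simp]: "realmat (mat 1)"
  by (simp add: realmat_def mat_def)

lemma real_orthD [simp]: "real_orth Q \<Longrightarrow> unitary_matrix Q" "real_orth Q \<Longrightarrow> realmat Q"
  unfolding real_orth_def by simp_all

lemma real_orth_mult: "real_orth A \<Longrightarrow> real_orth B \<Longrightarrow> real_orth (A ** B)"
  unfolding real_orth_def by (simp add: unitary_matrix_mult realmat_mult)

lemma real_orth_conj_transpose: "real_orth A \<Longrightarrow> real_orth (conj_transpose A)"
  unfolding real_orth_def by (simp add: unitary_matrix_conj_transpose realmat_conj_transpose)

lemma real_orth_mat_1 [simp]: "real_orth (mat 1)"
  unfolding real_orth_def by simp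

lemma realmat_transpose: "realmat A \<Longrightarrow> transpose A = conj_transpose A"
  by (simp add: realmat_def vec_eq_iff transpose_def complex_eq_iff)

lemma det_real_orth:
  fixes Q :: "complex^'n^'n"
  assumes "real_orth Q"
  shows "det Q * det Q = 1"
proof -
  have "det Q * det (transpose Q) = det (Q ** conj_transpose Q)"
    using assms by (simp add: realmat_transpose det_mul del: unitary_right det_transpose)
  then show ?thesis using assms by simp
qed

text \<open>The columns of a unitary matrix are unit vectors.\<close>

lemma unitary_entry_bound:
  fixes A :: "complex^'n^'n"
  assumes "unitary_matrix A"
  shows "cmod (A $ i $ j) \<le> 1"
proof -
  have "(conj_transpose A ** A) $ j $ j = 1" using assms by (simp add: mat_def)
  then have "(\<Sum>k\<in>UNIV. A $ k $ j * cnj (A $ k $ j)) = 1"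
    by (simp add: matrix_matrix_mult_def mult.commute)
  then have "(\<Sum>k\<in>UNIV. complex_of_real ((cmod (A $ k $ j))\<^sup>2)) = 1"
    by (simp only: complex_norm_square)
  then have "(\<Sum>k\<in>UNIV. (cmod (A $ k $ j))\<^sup>2) = 1"
    by (metis of_real_sum of_real_eq_1_iff)
  moreover have "(cmod (A $ i $ j))\<^sup>2 \<le> (\<Sum>k\<in>UNIV. (cmod (A $ k $ j))\<^sup>2)"
    by (rule member_le_sum) auto
  ultimately show ?thesis by (simp add: power_le_one_iff)
qed

section \<open>Continuity of the matrix operations and compactness of the real orthogonal
  group\<close>

lemma continuous_on_matrix_mult [continuous_intros]:
  fixes f :: "'a::topological_space \<Rightarrow> complex^'n^'m" and g :: "'a \<Rightarrow> complex^'k^'n"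
  assumes "continuous_on S f" "continuous_on S g"
  shows "continuous_on S (\<lambda>x. f x ** g x)"
  unfolding matrix_matrix_mult_def
  by (intro continuous_on_vec_lambda continuous_intros assms)

lemma continuous_on_conj_transpose [continuous_intros]:
  fixes f :: "'a::topological_space \<Rightarrow> complex^'n^'m"
  assumes "continuous_on S f"
  shows "continuous_on S (\<lambda>x. conj_transpose (f x))"
  unfolding conj_transpose_def map_matrix_def transpose_def
  by (simp, intro continuous_on_vec_lambda continuous_intros assms)

lemma continuous_on_dg [continuous_intros]:
  assumes "\<And>i. continuous_on S (\<lambda>x. f x i)"
  shows "continuous_on S (\<lambda>x. dg (f x) :: complex^'n^'n)"
  unfolding dg_def
proof (intro continuous_on_vec_lambda)
  fix i j show "continuous_on S (\<lambda>x. if i = j then f x i else 0)"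
    using assms[of i] by (cases "i = j") auto
qed

lemma continuous_on_trace [continuous_intros]:
  fixes f :: "'a::topological_space \<Rightarrow> complex^'n^'n"
  assumes "continuous_on S f"
  shows "continuous_on S (\<lambda>x. trace (f x))"
  unfolding trace_def by (intro continuous_intros assms)

lemma compact_real_orth: "compact {Q :: complex^'n^'n. real_orth Q}"
  unfolding compact_eq_bounded_closed
proof
  show "bounded {Q :: complex^'n^'n. real_orth Q}"
  proof (rule boundedI)
    fix Q :: "complex^'n^'n" assume "Q \<in> {Q. real_orth Q}"
    then have "cmod (Q $ i $ j) \<le> 1" for i j by (simp add: unitary_entry_bound)
    then have "norm (Q $ i) \<le> real CARD('n)" for i
      using sum_bounded_above[of UNIV "\<lambda>j. cmod (Q $ i $ j)" 1]
        L2_set_le_sum[of UNIV "\<lambda>j. cmod (Q $ i $ j)"]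
      by (simp add: norm_vec_def)
    then have "norm Q \<le> real CARD('n) * real CARD('n)"
      using sum_bounded_above[of UNIV "\<lambda>i. norm (Q $ i)" "real CARD('n)"]
        L2_set_le_sum[of UNIV "\<lambda>i. norm (Q $ i)"]
      by (simp add: norm_vec_def)
    then show "norm Q \<le> real CARD('n) * real CARD('n)" .
  qed
  have "{Q :: complex^'n^'n. real_orth Q} = {Q. conj_transpose Q ** Q = mat 1} \<inter>
      {Q. Q ** conj_transpose Q = mat 1} \<inter> (\<Inter>i. \<Inter>j. {Q. Im (Q $ i $ j) = 0})"
    unfolding real_orth_def unitary_matrix_def realmat_def by blast
  then show "closed {Q :: complex^'n^'n. real_orth Q}"
    by (auto intro!: closed_Int closed_INT closed_Collect_eq continuous_intros)
qed

section \<open>Givens rotations and simultaneous diagonalisation\<close>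

lemma matrix_add_mult_distrib:
  fixes A B :: "complex^'n^'m"
  shows "(A + B) ** C = A ** C + B ** C"
  by (simp add: vec_eq_iff matrix_matrix_mult_def algebra_simps sum.distrib)

text \<open>The rotation by the angle \<open>t\<close> in the coordinate plane of \<open>p\<close>
  and \<open>q\<close>. The entries of the rotated columns are sums of indicator terms, so that
  matrix products split into sums with a single nonzero term.\<close>

definition givens :: "'n \<Rightarrow> 'n \<Rightarrow> real \<Rightarrow> complex^'n^'n" where
  "givens p q t = (\<chi> i j.
     if j = p then (if i = p then of_real (cos t) else 0) + (if i = q then of_real (sin t) else 0)
     else if j = q then (if i = q then of_real (cos t) else 0) - (if i = p then of_real (sin t) else 0)
     else if i = j then 1 else 0)"

lemma mult_givens_nth:
  fixes A :: "complex^'n^'m"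
  assumes "p \<noteq> q"
  shows "(A ** givens p q t) $ i $ j =
    (if j = p then A $ i $ p * of_real (cos t) + A $ i $ q * of_real (sin t)
     else if j = q then A $ i $ q * of_real (cos t) - A $ i $ p * of_real (sin t)
     else A $ i $ j)"
  using assms
  by (simp add: matrix_matrix_mult_def givens_def algebra_simps sum.distrib sum_subtractf
      if_distrib[of "\<lambda>x. _ * x"] cong: if_cong)

lemma givens_mult_nth:
  fixes A :: "complex^'n^'n"
  assumes "p \<noteq> q"
  shows "(conj_transpose (givens p q t) ** A) $ i $ j =
    (if i = p then A $ p $ j * of_real (cos t) + A $ q $ j * of_real (sin t)
     else if i = q then A $ q $ j * of_real (cos t) - A $ p $ j * of_real (sin t)
     else A $ i $ j)"
proof -
  have "conj_transpose (givens p q t) ** A = conj_transpose (conj_transpose A ** givens p q t)"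
    by (simp add: conj_transpose_mult)
  then show ?thesis using assms by (simp add: mult_givens_nth)
qed

lemma real_orth_givens:
  assumes "p \<noteq> q"
  shows "real_orth (givens p q t :: complex^'n^'n)"
proof -
  have cs: "complex_of_real (cos t) * of_real (cos t) + of_real (sin t) * of_real (sin t) = 1"
    "complex_of_real (sin t) * of_real (sin t) + of_real (cos t) * of_real (cos t) = 1"
    using sin_cos_squared_add[of t]
    by (simp_all flip: of_real_mult of_real_add add: power2_eq_square add.commute)
  have "conj_transpose (givens p q t) ** (givens p q t) = (mat 1 :: complex^'n^'n)"
    using assms cs by (simp add: vec_eq_iff givens_mult_nth mat_def) (auto simp: givens_def)
  then have "unitary_matrix (givens p q t :: complex^'n^'n)"
    unfolding unitary_matrix_def using matrix_left_right_inverse by blast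
  moreover have "realmat (givens p q t :: complex^'n^'n)"
    by (simp add: realmat_def givens_def)
  ultimately show ?thesis unfolding real_orth_def by blast
qed

text \<open>On the plane of \<open>p\<close> and \<open>q\<close> the matrix \<open>dg x\<close> is
  a scalar, and off this plane the rotation is the identity.\<close>

lemma dg_givens_commute:
  assumes "x p = x q"
  shows "dg x ** givens p q t = givens p q t ** (dg x :: complex^'n^'n)"
proof -
  have "x i = x j \<or> givens p q t $ i $ j = 0" for i j
  proof (cases "i = j")
    case False
    have "x i = x j" if "i \<in> {p, q}" "j \<in> {p, q}"
      using that assms by (metis empty_iff insert_iff)
    moreover have "givens p q t $ i $ j = 0" if "\<not> (i \<in> {p, q} \<and> j \<in> {p, q})"
      using that False by (auto simp: givens_def)
    ultimately show ?thesis by blast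
  qed simp
  then have "x i * givens p q t $ i $ j = givens p q t $ i $ j * x j" for i j
    by (metis mult.commute mult_zero_left mult_zero_right)
  then show ?thesis by (simp add: vec_eq_iff)
qed

text \<open>The sinusoid attains its amplitude, the square root of
  \<open>A\<^sup>2 + B\<^sup>2\<close>, which exceeds \<open>A\<close> unless \<open>B = 0\<close>.
  This replaces differentiation at a maximum.\<close>

lemma sinusoid_max_at_0:
  fixes A B :: real
  assumes "\<And>t. A * cos t + B * sin t \<le> A"
  shows "B = 0"
proof (rule ccontr)
  assume B: "B \<noteq> 0"
  define r where "r = sqrt (A\<^sup>2 + B\<^sup>2)"
  have r: "r > 0" "r * r = A\<^sup>2 + B\<^sup>2" using B by (auto simp: r_def sum_power2_gt_zero_iff)
  have "(A / r)\<^sup>2 + (B / r)\<^sup>2 = 1"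
    using r by (simp add: power_divide flip: add_divide_distrib) (simp add: power2_eq_square)
  then obtain t where "A / r = cos t" "B / r = sin t" using sincos_total_2pi by metis
  then have "A * (A / r) + B * (B / r) \<le> A" using assms[of t] by simp
  then have "r * r \<le> A * r" using r by (simp add: field_simps power2_eq_square)
  then have "r \<le> A" using r(1) by (rule mult_right_le_imp_le)
  then have "r * r \<le> A * A" using r by (intro mult_mono) auto
  then have "B * B \<le> 0" using r by (simp add: power2_eq_square)
  then show False using B by (auto simp: mult_le_0_iff)
qed

lemma sum_two:
  fixes f :: "'n::finite \<Rightarrow> 'a::comm_monoid_add"
  assumes "p \<noteq> q"
  shows "sum f UNIV = f p + f q + sum f (UNIV - {p, q})"
proof -
  have "sum f ({p, q} \<union> (UNIV - {p, q})) = sum f {p, q} + sum f (UNIV - {p, q})"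
    by (rule sum.union_disjoint) auto
  moreover have "{p, q} \<union> (UNIV - {p, q}) = UNIV" by auto
  ultimately have "sum f UNIV = sum f {p, q} + sum f (UNIV - {p, q})" by (simp only:)
  then show ?thesis using assms by simp
qed

text \<open>Matrices are indexed by a finite type, spectra by the numbers from 1 to its cardinality.
  A fixed arbitrary enumeration translates between the two.\<close>

definition idx :: "'n::finite \<Rightarrow> nat" where
  "idx = (SOME f. bij_betw f UNIV {1..CARD('n)})"

lemma bij_idx: "bij_betw (idx :: 'n::finite \<Rightarrow> nat) UNIV {1..CARD('n)}"
proof -
  have "\<exists>f. bij_betw f (UNIV :: 'n set) {1..CARD('n)}"
    by (rule finite_same_card_bij) auto
  then show ?thesis unfolding idx_def by (rule someI_ex)
qed

lemma idx_eq_iff [simp]: "idx (i :: 'n::finite) = idx j \<longleftrightarrow> i = j"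
  using bij_idx[where 'n='n] by (auto simp: bij_betw_def inj_on_def)

lemma idx_range: "idx (i :: 'n::finite) \<in> {1..CARD('n)}"
  using bij_idx[where 'n='n] by (auto simp: bij_betw_def)

text \<open>
  The diagonalising \<open>Q\<close> maximises \<open>\<Sum>\<^sub>i w\<^sub>i (Q\<^sup>* Y Q)\<^sub>i\<^sub>i\<close> with distinct weights \<open>w\<^sub>i\<close> over the real orthogonal
  matrices commuting with \<open>dg x\<close>: the Givens rotations of the planes on which \<open>x\<close> is constant show
  that the off-diagonal entries vanish there, and the commutation that they vanish elsewhere.
\<close>

lemma diagonalise_commuting_real_symmetric:
  fixes Y :: "complex^'n^'n"
  assumes Y: "realmat Y" "conj_transpose Y = Y" and comm: "dg x ** Y = Y ** dg x"
  obtains Q y where "real_orth Q" "dg x ** Q = Q ** dg x"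
    "conj_transpose Q ** Y ** Q = dg (\<lambda>i. complex_of_real (y i))"
proof -
  define K where "K = {Q :: complex^'n^'n. real_orth Q} \<inter> {Q. dg x ** Q = Q ** dg x}"
  define F where "F Q = (\<Sum>i\<in>UNIV. real (idx i) * Re ((conj_transpose Q ** Y ** Q) $ i $ i))"
    for Q :: "complex^'n^'n"
  have "compact K" unfolding K_def
    by (intro compact_Int_closed compact_real_orth closed_Collect_eq continuous_intros)
  moreover have "mat 1 \<in> K" by (simp add: K_def)
  moreover have "continuous_on K F"
    unfolding F_def by (intro continuous_intros)
  ultimately obtain Q where Q: "Q \<in> K" and max: "\<And>Q'. Q' \<in> K \<Longrightarrow> F Q' \<le> F Q"
    using continuous_attains_sup[of K F] by blast
  have ro: "real_orth Q" and cQ: "dg x ** Q = Q ** dg x" using Q by (auto simp: K_def)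
  define M where "M = conj_transpose Q ** Y ** Q"
  have rM: "realmat M" unfolding M_def using ro Y
    by (intro realmat_mult realmat_conj_transpose) auto
  have hM: "conj_transpose M = M" unfolding M_def
    by (simp add: conj_transpose_mult Y matrix_mul_assoc)
  have sym: "M $ i $ j = M $ j $ i" for i j
    using rM arg_cong[OF hM, of "\<lambda>A. A $ i $ j"] by (simp add: realmat_def complex_eq_iff)
  have cQ': "conj_transpose Q ** dg x = dg x ** conj_transpose Q"
  proof -
    have "conj_transpose Q ** (dg x ** Q) ** conj_transpose Q =
        conj_transpose Q ** (Q ** dg x) ** conj_transpose Q" by (simp only: cQ)
    then show ?thesis using ro by (simp flip: matrix_mul_assoc)
  qed
  have cM: "dg x ** M = M ** dg x"
  proof -
    have "dg x ** M = conj_transpose Q ** (dg x ** Y) ** Q"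
      by (simp only: M_def matrix_mul_assoc cQ'[symmetric])
    also have "\<dots> = M ** dg x"
      by (simp only: comm M_def matrix_mul_assoc[symmetric] cQ)
    finally show ?thesis .
  qed
  have "M $ p $ q = 0" if "p \<noteq> q" for p q
  proof (cases "x p = x q")
    case False
    have "x p * M $ p $ q = M $ p $ q * x q"
      using arg_cong[OF cM, of "\<lambda>A. A $ p $ q"] by simp
    then show ?thesis using False by (simp add: mult.commute)
  next
    case True
    define a b c where "a = Re (M $ p $ p)" and "b = Re (M $ q $ q)" and "c = Re (M $ p $ q)"
    \<comment> \<open>With equal weights at \<open>p\<close> and \<open>q\<close> the rotation would
      leave \<open>F\<close> unchanged. A nonzero \<open>w\<close> makes the coefficient of
      \<open>sin u\<close> detect the off-diagonal entry \<open>c\<close>.\<close>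
    define w where "w = real (idx p) - real (idx q)"
    have w: "w \<noteq> 0" using that by (simp add: w_def)
    have "w * (a - b) / 2 * cos u + w * c * sin u \<le> w * (a - b) / 2" for u
    proof -
      \<comment> \<open>The diagonal entries of the rotated matrix are quadratic in
        \<open>cos t\<close> and \<open>sin t\<close>, hence a constant plus a sinusoid in the
        double angle \<open>u\<close>.\<close>
      define t where "t = u / 2"
      define G :: "complex^'n^'n" where "G = givens p q t"
      have "dg x ** (Q ** G) = (Q ** G) ** dg x"
        unfolding G_def by (simp only: matrix_mul_assoc cQ) (simp only: matrix_mul_assoc[symmetric] dg_givens_commute[OF True])
      then have "Q ** G \<in> K"
        unfolding K_def G_def using ro real_orth_givens[OF that] by (simp add: real_orth_mult)
      then have le: "F (Q ** G) \<le> F Q" by (rule max)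
      have N: "conj_transpose (Q ** G) ** Y ** (Q ** G) = conj_transpose G ** (M ** G)"
        by (simp add: M_def conj_transpose_mult matrix_mul_assoc)
      have rest: "(conj_transpose G ** (M ** G)) $ i $ i = M $ i $ i" if "i \<noteq> p" "i \<noteq> q" for i
        using that \<open>p \<noteq> q\<close> by (simp add: G_def givens_mult_nth mult_givens_nth)
      have pp: "Re ((conj_transpose G ** (M ** G)) $ p $ p) =
          a * (cos t)\<^sup>2 + 2 * c * cos t * sin t + b * (sin t)\<^sup>2"
        using \<open>p \<noteq> q\<close> sym[of q p]
        by (simp add: G_def givens_mult_nth mult_givens_nth a_def b_def c_def algebra_simps power2_eq_square)
      have qq: "Re ((conj_transpose G ** (M ** G)) $ q $ q) =
          b * (cos t)\<^sup>2 - 2 * c * cos t * sin t + a * (sin t)\<^sup>2"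
        using \<open>p \<noteq> q\<close> sym[of q p]
        by (simp add: G_def givens_mult_nth mult_givens_nth a_def b_def c_def algebra_simps power2_eq_square)
      have "F (Q ** G) - F Q =
         real (idx p) * (a * (cos t)\<^sup>2 + 2 * c * cos t * sin t + b * (sin t)\<^sup>2 - a) +
         real (idx q) * (b * (cos t)\<^sup>2 - 2 * c * cos t * sin t + a * (sin t)\<^sup>2 - b)"
        unfolding F_def N M_def[symmetric] sum_two[OF \<open>p \<noteq> q\<close>] pp qq
        by (simp add: rest a_def b_def algebra_simps)
      also have "\<dots> = w * (a - b) / 2 * cos u + w * c * sin u - w * (a - b) / 2"
      proof -
        have u: "cos u = 1 - 2 * (sin t)\<^sup>2" "sin u = 2 * sin t * cos t"
          using cos_double_sin[of t] sin_double[of t] by (simp_all add: t_def)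
        have c2: "(cos t)\<^sup>2 = 1 - (sin t)\<^sup>2" by (rule cos_squared_eq)
        show ?thesis unfolding u c2 w_def by (simp add: field_simps)
      qed
      finally show ?thesis using le by simp
    qed
    then have "w * c = 0" by (rule sinusoid_max_at_0)
    then have "c = 0" using w by simp
    then show ?thesis using rM by (simp add: c_def complex_eq_iff realmat_def)
  qed
  then have "M = dg (\<lambda>i. complex_of_real (Re (M $ i $ i)))"
    using rM by (auto simp: vec_eq_iff complex_eq_iff realmat_def)
  then show ?thesis using that[OF ro cQ] by (simp add: M_def)
qed

text \<open>The real and imaginary parts \<open>X\<close> and \<open>Y\<close> of \<open>T\<close>
  are real symmetric, and they commute because \<open>T\<close> is normal. \<open>X\<close> is
  diagonalised first, then \<open>Y\<close> by a real orthogonal matrix that commutes with the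
  diagonal form of \<open>X\<close>.\<close>

lemma diagonalise_symmetric_unitary:
  fixes T :: "complex^'n^'n"
  assumes T: "unitary_matrix T" "transpose T = T"
  obtains Q d where "real_orth Q" "T = Q ** dg d ** conj_transpose Q" "\<And>i. cmod (d i) = 1"
proof -
  define X Y :: "complex^'n^'n" where "X = (\<chi> i j. of_real (Re (T $ i $ j)))"
    and "Y = (\<chi> i j. of_real (Im (T $ i $ j)))"
  have sym: "T $ i $ j = T $ j $ i" for i j
    using arg_cong[OF T(2), of "\<lambda>A. A $ i $ j"] by (simp add: transpose_def)
  have X: "realmat X" "conj_transpose X = X" and Y: "realmat Y" "conj_transpose Y = Y"
    using sym by (simp_all add: X_def Y_def realmat_def vec_eq_iff)
  have T': "conj_transpose T $ i $ j = cnj (T $ i $ j)" for i j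
    using sym[of i j] by simp
  have XY: "X ** Y = Y ** X"
  proof -
    have "T ** conj_transpose T = conj_transpose T ** T" using T by simp
    then have "(\<Sum>k\<in>UNIV. T $ i $ k * cnj (T $ k $ j)) = (\<Sum>k\<in>UNIV. cnj (T $ i $ k) * T $ k $ j)" for i j
      unfolding vec_eq_iff matrix_matrix_mult_def by (simp add: T' del: conj_transpose_nth)
    \<comment> \<open>In the imaginary parts the left side is an entry of
      \<open>Y ** X - X ** Y\<close> and the right side its negative.\<close>
    from arg_cong[OF this, of Im]
    have "(\<Sum>k\<in>UNIV. Im (T $ i $ k) * Re (T $ k $ j) - Re (T $ i $ k) * Im (T $ k $ j)) =
       (\<Sum>k\<in>UNIV. Re (T $ i $ k) * Im (T $ k $ j) - Im (T $ i $ k) * Re (T $ k $ j))" for i j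
      by (simp add: algebra_simps)
    then show ?thesis
      by (simp add: vec_eq_iff matrix_matrix_mult_def X_def Y_def sum_subtractf
          flip: of_real_mult of_real_sum)
  qed
  \<comment> \<open>For the constant diagonal 1 the commutation condition is void, so this is the
    spectral theorem for \<open>X\<close>.\<close>
  obtain Q1 x where Q1: "real_orth Q1" "conj_transpose Q1 ** X ** Q1 = dg (\<lambda>i. complex_of_real (x i))"
    using diagonalise_commuting_real_symmetric[OF X, of "\<lambda>_. 1"] by (auto simp: dg_1)
  define Y1 where "Y1 = conj_transpose Q1 ** Y ** Q1"
  have Y1: "realmat Y1" "conj_transpose Y1 = Y1" unfolding Y1_def
    using Q1 Y by (auto intro!: realmat_mult realmat_conj_transpose simp: conj_transpose_mult matrix_mul_assoc)
  have "dg (\<lambda>i. complex_of_real (x i)) ** Y1 = conj_transpose Q1 ** (X ** Y) ** Q1"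
    unfolding Y1_def Q1(2)[symmetric] using Q1(1) by (simp flip: matrix_mul_assoc)
  also have "\<dots> = Y1 ** dg (\<lambda>i. complex_of_real (x i))"
    unfolding XY unfolding Y1_def Q1(2)[symmetric] using Q1(1) by (simp flip: matrix_mul_assoc)
  finally obtain Q2 y where Q2: "real_orth Q2"
      "dg (\<lambda>i. complex_of_real (x i)) ** Q2 = Q2 ** dg (\<lambda>i. complex_of_real (x i))"
      "conj_transpose Q2 ** Y1 ** Q2 = dg (\<lambda>i. complex_of_real (y i))"
    using diagonalise_commuting_real_symmetric[OF Y1] by metis
  define Q where "Q = Q1 ** Q2"
  have ro: "real_orth Q" unfolding Q_def using Q1 Q2 by (simp add: real_orth_mult)
  have qx: "conj_transpose Q ** X ** Q = dg (\<lambda>i. complex_of_real (x i))"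
  proof -
    have "conj_transpose Q ** X ** Q = conj_transpose Q2 ** (conj_transpose Q1 ** X ** Q1) ** Q2"
      by (simp add: Q_def conj_transpose_mult matrix_mul_assoc)
    also have "\<dots> = conj_transpose Q2 ** (dg (\<lambda>i. complex_of_real (x i)) ** Q2)"
      unfolding Q1(2) by (simp add: matrix_mul_assoc)
    also have "\<dots> = dg (\<lambda>i. complex_of_real (x i))" unfolding Q2(2) using Q2(1) by simp
    finally show ?thesis .
  qed
  have qy: "conj_transpose Q ** Y ** Q = dg (\<lambda>i. complex_of_real (y i))"
    using Q2(3) by (simp add: Q_def Y1_def conj_transpose_mult matrix_mul_assoc)
  have TXY: "T = X + dg (\<lambda>_. \<i>) ** Y"
    by (simp add: vec_eq_iff X_def Y_def complex_eq_iff)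
  have com: "A ** dg (\<lambda>_. \<i>) = dg (\<lambda>_. \<i>) ** A" for A :: "complex^'n^'n"
    by (simp add: vec_eq_iff)
  define d where "d i = complex_of_real (x i) + \<i> * of_real (y i)" for i
  have "conj_transpose Q ** T ** Q = conj_transpose Q ** X ** Q + dg (\<lambda>_. \<i>) ** (conj_transpose Q ** Y ** Q)"
  proof -
    have "conj_transpose Q ** T ** Q = conj_transpose Q ** X ** Q + conj_transpose Q ** dg (\<lambda>_. \<i>) ** Y ** Q"
      unfolding TXY by (simp only: matrix_add_ldistrib matrix_add_mult_distrib matrix_mul_assoc)
    then show ?thesis by (simp only: com matrix_mul_assoc)
  qed
  also have "\<dots> = dg d" unfolding qx qy by (simp add: vec_eq_iff d_def)
  finally have dT: "conj_transpose Q ** T ** Q = dg d" .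
  have "Q ** (conj_transpose Q ** T ** Q) ** conj_transpose Q = T"
    using ro by (simp flip: matrix_mul_assoc)
  then have T2: "T = Q ** dg d ** conj_transpose Q" unfolding dT by simp
  have "unitary_matrix (dg d)" unfolding dT[symmetric] using ro T(1)
    by (intro unitary_matrix_mult unitary_matrix_conj_transpose) auto
  then have "conj_transpose (dg d) ** dg d = mat 1" by (rule unitary_left)
  from arg_cong[OF this, of "\<lambda>A. A $ i $ i" for i]
  have "cnj (d i) * d i = 1" for i by (simp add: mat_def)
  then have "cmod (d i) = 1" for i
    by (metis complex_mod_sqrt_Re_mult_cnj mult.commute one_complex.sel(1) real_sqrt_one)
  then show ?thesis using that ro T2 by blast
qed

section \<open>Spectra of diagonalised unitary matrices\<close>

lemma sum_idx: "(\<Sum>i\<in>UNIV. f (idx (i::'n::finite))) = (\<Sum>j=1..CARD('n). f j)"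
  using sum.reindex_bij_betw[OF bij_idx[where 'n='n]] .

lemma card_idx:
  "card {j \<in> idx ` (S :: 'n::finite set). R j} = card {i \<in> S. R (idx i)}"
proof -
  have "{j \<in> idx ` S. R j} = idx ` {i \<in> S. R (idx i)}" by auto
  then show ?thesis by (simp add: card_image inj_on_def)
qed

lemma range_idx: "range (idx :: 'n::finite \<Rightarrow> nat) = {1..CARD('n)}"
  using bij_idx[where 'n='n] by (simp add: bij_betw_def)

lemma diag_eigenvector_iff:
  fixes V :: "complex^'n^'n"
  assumes V: "unitary_matrix V"
  shows "(V ** dg d ** conj_transpose V) *v v = c *s v \<longleftrightarrow>
    (\<forall>i. d i * (conj_transpose V *v v) $ i = c * (conj_transpose V *v v) $ i)"
proof -
  let ?A = "V ** dg d ** conj_transpose V"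
  have "?A *v v = c *s v \<longleftrightarrow> conj_transpose V *v (?A *v v) = conj_transpose V *v (c *s v)" (is "?l \<longleftrightarrow> ?r")
  proof
    assume ?r
    then have "V *v (conj_transpose V *v (?A *v v)) = V *v (conj_transpose V *v (c *s v))" by (simp only:)
    then show ?l by (simp only: unitary_cancel_vec(2)[OF V])
  qed (simp only:)
  also have "conj_transpose V *v (?A *v v) = dg d *v (conj_transpose V *v v)"
    by (simp only: matrix_vector_mul_assoc[symmetric] unitary_cancel_vec(1)[OF V])
  also have "conj_transpose V *v (c *s v) = c *s (conj_transpose V *v v)"
    by (simp only: vec.scale)
  finally show ?thesis by (simp add: vec_eq_iff)
qed

text \<open>In the coordinates given by the columns of \<open>V\<close>, the subspace and the
  eigenspace are both cut out by vanishing coordinates, and the dimension counts the free ones. The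
  set \<open>S\<close> makes the count available for the invariant subspaces in
  \<open>compatible\<close>.\<close>

lemma eigen_mult_diag:
  fixes V :: "complex^'n^'n"
  assumes V: "unitary_matrix V"
  shows "eigen_mult (V ** dg d ** conj_transpose V) {v. \<forall>i. i \<notin> S \<longrightarrow> (conj_transpose V *v v) $ i = 0} c
    = card {i \<in> S. d i = c}"
proof -
  let ?A = "V ** dg d ** conj_transpose V"
  let ?X = "{x :: complex^'n. \<forall>i. i \<notin> {i \<in> S. d i = c} \<longrightarrow> x $ i = 0}"
  have "?A *v v = c *s v \<longleftrightarrow> (\<forall>i. d i * (conj_transpose V *v v) $ i = c * (conj_transpose V *v v) $ i)" for v
    by (rule diag_eigenvector_iff[OF V])
  then have "{v \<in> {v. \<forall>i. i \<notin> S \<longrightarrow> (conj_transpose V *v v) $ i = 0}. ?A *v v = c *s v} =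
      {v. conj_transpose V *v v \<in> ?X}"
    by (simp only: mem_Collect_eq) (auto simp del: matrix_vector_mul_assoc)
  also have "\<dots> = (*v) V ` ?X"
  proof
    show "{v. conj_transpose V *v v \<in> ?X} \<subseteq> (*v) V ` ?X"
    proof
      fix v assume "v \<in> {v. conj_transpose V *v v \<in> ?X}"
      then have "V *v (conj_transpose V *v v) \<in> (*v) V ` ?X" by blast
      then show "v \<in> (*v) V ` ?X" by (simp only: unitary_cancel_vec(2)[OF V])
    qed
    show "(*v) V ` ?X \<subseteq> {v. conj_transpose V *v v \<in> ?X}"
      using unitary_cancel_vec(1)[OF V] by auto
  qed
  finally have "eigen_mult ?A {v. \<forall>i. i \<notin> S \<longrightarrow> (conj_transpose V *v v) $ i = 0} c = vec.dim ((*v) V ` ?X)"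
    by (simp only: eigen_mult_def)
  also have "\<dots> = vec.dim ?X"
  proof (rule vec.dim_image_eq)
    show "inj_on ((*v) V) (vec.span ?X)"
      by (rule inj_on_inverseI[of _ "(*v) (conj_transpose V)"]) (rule unitary_cancel_vec(1)[OF V])
  qed (rule matrix_vector_mul_linear_gen)
  also have "\<dots> = card {i \<in> S. d i = c}" by (rule dim_substandard_cart)
  finally show ?thesis .
qed

lemma eigen_mult_diag_UNIV:
  fixes V :: "complex^'n^'n"
  assumes "unitary_matrix V"
  shows "eigen_mult (V ** dg d ** conj_transpose V) UNIV c = card {i. d i = c}"
  using eigen_mult_diag[OF assms, of d UNIV c] by simp

lemma cis_2pi_inj:
  assumes "0 \<le> x" "x < 1" "0 \<le> y" "y < 1" "cis (2 * pi * x) = cis (2 * pi * y)"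
  shows "x = y"
proof -
  have "cos (2 * pi * x) = cos (2 * pi * y)" "sin (2 * pi * x) = sin (2 * pi * y)"
    using arg_cong[OF assms(5), of Re] arg_cong[OF assms(5), of Im] by simp_all
  then obtain k :: int where "2 * pi * x = 2 * pi * y + 2 * pi * of_int k"
    using sin_cos_eq_iff by metis
  then have "2 * pi * x = 2 * pi * (y + of_int k)" by (simp only: distrib_left)
  then have "x = y + of_int k" by simp
  then have "\<bar>real_of_int k\<bar> < 1" using assms by linarith
  then have "k = 0" by linarith
  then show ?thesis using \<open>x = y + of_int k\<close> by simp
qed

text \<open>The property under the definite description in \<open>spec\<close>, named so that
  existence and uniqueness can be treated separately.\<close>

definition is_spec :: "complex^'n^'n \<Rightarrow> (nat \<Rightarrow> real) \<Rightarrow> bool" where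
  "is_spec A \<alpha> \<longleftrightarrow> (\<forall>j\<in>{1..CARD('n)}. 0 \<le> \<alpha> j \<and> \<alpha> j < 1) \<and>
     mono_on {1..CARD('n)} \<alpha> \<and> (\<forall>j. j \<notin> {1..CARD('n)} \<longrightarrow> \<alpha> j = 0) \<and>
     (\<forall>c. eigen_mult A UNIV c = card {j \<in> {1..CARD('n)}. cis (2 * pi * \<alpha> j) = c})"

lemma count_mset_upt:
  "count (mset (map f [1..<Suc n])) x = card {j \<in> {1..n}. f j = x}"
proof -
  have "count (mset (map f [1..<Suc n])) x = length (filter (\<lambda>j. f j = x) [1..<Suc n])"
    by (induction n) auto
  also have "\<dots> = card (set (filter (\<lambda>j. f j = x) [1..<Suc n]))"
    by (rule distinct_card[symmetric]) simp
  also have "set (filter (\<lambda>j. f j = x) [1..<Suc n]) = {j \<in> {1..n}. f j = x}" by auto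
  finally show ?thesis .
qed

lemma sorted_map_upt:
  fixes f :: "nat \<Rightarrow> real"
  assumes "mono_on {1..n} f"
  shows "sorted (map f [1..<Suc n])"
  using assms by (auto simp: sorted_iff_nth_mono mono_on_def simp del: upt_Suc)

text \<open>Distinct numbers in the interval from 0 (included) to 1 (excluded) give distinct points
  of the unit circle. So the eigenvalue multiplicities determine how often each value occurs, and a
  sorted list is determined by its multiset.\<close>

lemma is_spec_unique:
  fixes A :: "complex^'n^'n"
  assumes "is_spec A \<alpha>" "is_spec A \<beta>"
  shows "\<alpha> = \<beta>"
proof -
  let ?n = "CARD('n)"
  have "card {j \<in> {1..?n}. \<alpha> j = x} = card {j \<in> {1..?n}. \<beta> j = x}" for x
  proof (cases "0 \<le> x \<and> x < 1")
    case True
    have *: "card {j \<in> {1..?n}. \<gamma> j = x} = eigen_mult A UNIV (cis (2 * pi * x))" if "is_spec A \<gamma>" for \<gamma>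
    proof -
      have "\<gamma> j = x \<longleftrightarrow> cis (2 * pi * \<gamma> j) = cis (2 * pi * x)" if "j \<in> {1..?n}" for j
        using cis_2pi_inj[of "\<gamma> j" x] \<open>is_spec A \<gamma>\<close> that True by (auto simp: is_spec_def)
      then have "{j \<in> {1..?n}. \<gamma> j = x} = {j \<in> {1..?n}. cis (2 * pi * \<gamma> j) = cis (2 * pi * x)}" by blast
      moreover have "eigen_mult A UNIV (cis (2 * pi * x)) =
          card {j \<in> {1..?n}. cis (2 * pi * \<gamma> j) = cis (2 * pi * x)}"
        using that unfolding is_spec_def by blast
      ultimately show ?thesis by (simp only:)
    qed
    show ?thesis by (simp only: *[OF assms(1)] *[OF assms(2)])
  next
    case False
    then have *: "{j \<in> {1..?n}. \<gamma> j = x} = {}" if "is_spec A \<gamma>" for \<gamma>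
      using that by (auto simp: is_spec_def)
    show ?thesis by (simp only: *[OF assms(1)] *[OF assms(2)])
  qed
  then have "mset (map \<alpha> [1..<Suc ?n]) = mset (map \<beta> [1..<Suc ?n])"
    by (intro multiset_eqI) (simp only: count_mset_upt)
  moreover have "sorted (map \<alpha> [1..<Suc ?n])" "sorted (map \<beta> [1..<Suc ?n])"
    using assms by (intro sorted_map_upt; simp add: is_spec_def)+
  ultimately have "sort (map \<beta> [1..<Suc ?n]) = map \<alpha> [1..<Suc ?n]" "sort (map \<beta> [1..<Suc ?n]) = map \<beta> [1..<Suc ?n]"
    by (auto intro: properties_for_sort simp del: upt_Suc)
  then have "map \<alpha> [1..<Suc ?n] = map \<beta> [1..<Suc ?n]" by (simp only:)
  then have "\<forall>j\<in>set [1..<Suc ?n]. \<alpha> j = \<beta> j" by (simp only: map_eq_conv)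
  then have "\<forall>j\<in>{1..?n}. \<alpha> j = \<beta> j" by (simp del: upt_Suc)
  moreover have "\<alpha> j = \<beta> j" if "j \<notin> {1..?n}" for j
  proof -
    have "\<alpha> j = 0" "\<beta> j = 0" using assms that unfolding is_spec_def by blast+
    then show ?thesis by simp
  qed
  ultimately show ?thesis by blast
qed

lemma spec_eqI: "is_spec A \<alpha> \<Longrightarrow> spec A = \<alpha>"
  unfolding spec_def is_spec_def[symmetric]
  by (rule the_equality) (auto intro: is_spec_unique)

text \<open>For existence, the normalised arguments of the diagonal entries are listed and
  sorted.\<close>

lemma is_spec_spec:
  fixes V :: "complex^'n^'n"
  assumes V: "unitary_matrix V" and d: "\<And>i. cmod (d i) = 1"
  shows "is_spec (V ** dg d ** conj_transpose V) (spec (V ** dg d ** conj_transpose V))"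
proof -
  let ?n = "CARD('n)"
  have "\<exists>t. 0 \<le> t \<and> t < 1 \<and> cis (2 * pi * t) = d i" for i
  proof -
    have "(Re (d i))\<^sup>2 + (Im (d i))\<^sup>2 = 1" using d[of i] by (simp add: cmod_def)
    then obtain u where u: "0 \<le> u" "u < 2 * pi" "Re (d i) = cos u" "Im (d i) = sin u"
      by (rule sincos_total_2pi)
    then show ?thesis by (intro exI[of _ "u / (2 * pi)"]) (auto simp: complex_eq_iff)
  qed
  then obtain \<theta> where \<theta>: "\<And>i. 0 \<le> \<theta> i \<and> \<theta> i < 1 \<and> cis (2 * pi * \<theta> i) = d i" by metis
  define f where "f j = \<theta> (inv_into UNIV idx j)" for j
  have f: "f (idx i) = \<theta> i" for i
    by (simp add: f_def inv_f_f inj_on_def)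
  define L where "L = sort (map f [1..<Suc ?n])"
  have len: "length L = ?n" by (simp add: L_def del: upt_Suc)
  define \<alpha> where "\<alpha> j = (if j \<in> {1..?n} then L ! (j - 1) else 0)" for j
  have La: "map \<alpha> [1..<Suc ?n] = L"
    using len by (intro nth_equalityI) (auto simp: \<alpha>_def simp del: upt_Suc)
  have setL: "set L = f ` {1..?n}" unfolding L_def by (auto simp del: upt_Suc)
  have "0 \<le> \<alpha> j \<and> \<alpha> j < 1" if "j \<in> {1..?n}" for j
  proof -
    have "\<alpha> j \<in> set L" using that len by (auto simp: \<alpha>_def)
    then show ?thesis using \<theta> by (auto simp: setL f_def)
  qed
  moreover have "mono_on {1..?n} \<alpha>"
  proof (rule mono_onI)
    fix r s assume "r \<in> {1..?n}" "s \<in> {1..?n}" "r \<le> s"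
    moreover have "sorted L" by (simp add: L_def del: upt_Suc)
    ultimately show "\<alpha> r \<le> \<alpha> s" using len by (auto simp: \<alpha>_def intro!: sorted_nth_mono)
  qed
  moreover have "eigen_mult (V ** dg d ** conj_transpose V) UNIV c =
      card {j \<in> {1..?n}. cis (2 * pi * \<alpha> j) = c}" for c
  proof -
    have "mset (map \<alpha> [1..<Suc ?n]) = mset (map f [1..<Suc ?n])"
      unfolding La by (simp add: L_def del: upt_Suc)
    then have "mset (map (\<lambda>j. cis (2 * pi * \<alpha> j)) [1..<Suc ?n]) = mset (map (\<lambda>j. cis (2 * pi * f j)) [1..<Suc ?n])"
      using mset_map[of "\<lambda>t. cis (2 * pi * t)" "map \<alpha> [1..<Suc ?n]"]
        mset_map[of "\<lambda>t. cis (2 * pi * t)" "map f [1..<Suc ?n]"] by (simp only: map_map o_def)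
    then have "card {j \<in> {1..?n}. cis (2 * pi * \<alpha> j) = c} = card {j \<in> {1..?n}. cis (2 * pi * f j) = c}"
      by (metis count_mset_upt)
    also have "\<dots> = card {i :: 'n. cis (2 * pi * f (idx i)) = c}"
      using card_idx[of "UNIV :: 'n set" "\<lambda>j. cis (2 * pi * f j) = c"] by (simp add: range_idx)
    also have "\<dots> = card {i. d i = c}" using \<theta> by (simp add: f)
    finally show ?thesis using eigen_mult_diag_UNIV[OF V] by simp
  qed
  ultimately have "is_spec (V ** dg d ** conj_transpose V) \<alpha>"
    unfolding is_spec_def by (auto simp: \<alpha>_def)
  then show ?thesis using spec_eqI by metis
qed

lemma is_spec_diag:
  fixes V :: "complex^'n^'n"
  assumes V: "unitary_matrix V"
    and \<alpha>: "\<forall>j\<in>{1..CARD('n)}. 0 \<le> \<alpha> j \<and> \<alpha> j < 1" "mono_on {1..CARD('n)} \<alpha>"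
      "\<forall>j. j \<notin> {1..CARD('n)} \<longrightarrow> \<alpha> j = 0"
  shows "is_spec (V ** dg (\<lambda>i. cis (2 * pi * \<alpha> (idx i))) ** conj_transpose V) \<alpha>"
  unfolding is_spec_def eigen_mult_diag_UNIV[OF V]
  using \<alpha> card_idx[of "UNIV :: 'n set" "\<lambda>j. cis (2 * pi * \<alpha> j) = c" for c] by (simp add: range_idx)

text \<open>Bijections between the fibres of \<open>g\<close> and \<open>f\<close> over each value
  glue to a permutation.\<close>

lemma permutation_of_equal_counts:
  fixes f g :: "'n::finite \<Rightarrow> 'b"
  assumes "\<And>c. card {i. f i = c} = card {i. g i = c}"
  obtains \<pi> where "bij \<pi>" "\<And>i. f (\<pi> i) = g i"
proof -
  have "\<exists>h. bij_betw h {i. g i = c} {i. f i = c}" for c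
    using assms by (intro finite_same_card_bij) auto
  then obtain h where h: "\<And>c. bij_betw (h c) {i. g i = c} {i. f i = c}" by metis
  define \<pi> where "\<pi> i = h (g i) i" for i
  have fp: "f (\<pi> i) = g i" for i
    using bij_betwE[OF h, of "g i"] by (auto simp: \<pi>_def)
  have "inj \<pi>"
  proof (rule injI)
    fix i j assume e: "\<pi> i = \<pi> j"
    then have "g i = g j" using fp by metis
    then show "i = j" using e bij_betw_imp_inj_on[OF h[of "g i"]] by (auto simp: \<pi>_def inj_on_def)
  qed
  then have "bij \<pi>" by (simp add: bij_def finite_UNIV_inj_surj)
  then show ?thesis using fp that by blast
qed

text \<open>The diagonal found for \<open>T\<close> is a rearrangement of \<open>e\<close>, and
  permutation matrices are real orthogonal. The hypothesis \<open>count\<close> ranges over all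
  unitary diagonalisations because it is not known in advance which one is obtained.\<close>

lemma diagonalise_symmetric_unitary_as:
  fixes T :: "complex^'n^'n"
  assumes T: "unitary_matrix T" "transpose T = T"
    and count: "\<And>V d. unitary_matrix V \<Longrightarrow> (\<And>i. cmod (d i) = 1) \<Longrightarrow> T = V ** dg d ** conj_transpose V
      \<Longrightarrow> (\<And>c. card {i. d i = c} = card {i. e i = c})"
  obtains Q where "real_orth Q" "T = Q ** dg e ** conj_transpose Q"
proof -
  obtain Q d where Q: "real_orth Q" "T = Q ** dg d ** conj_transpose Q" "\<And>i. cmod (d i) = 1"
    using diagonalise_symmetric_unitary[OF T] by blast
  obtain \<pi> where \<pi>: "bij \<pi>" "\<And>i. d (\<pi> i) = e i"
    using permutation_of_equal_counts[of d e, OF count[OF real_orthD(1)[OF Q(1)] Q(3) Q(2)]] by blast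
  define R :: "complex^'n^'n" where "R = (\<chi> i j. if i = \<pi> j then 1 else 0)"
  have inj: "\<pi> i = \<pi> j \<longleftrightarrow> i = j" for i j using \<pi>(1) by (auto simp: bij_def inj_def)
  have "conj_transpose R ** R = mat 1"
  proof -
    have "(conj_transpose R ** R) $ i $ j = (\<Sum>k\<in>UNIV. if k = \<pi> i then (if \<pi> i = \<pi> j then 1 else 0) else 0)" for i j
      by (simp only: matrix_matrix_mult_def vec_lambda_beta, intro sum.cong) (auto simp: R_def)
    then show ?thesis by (simp add: vec_eq_iff mat_def inj)
  qed
  then have "unitary_matrix R"
    unfolding unitary_matrix_def using matrix_left_right_inverse by blast
  then have R: "real_orth R" unfolding real_orth_def by (simp add: realmat_def R_def)
  have "dg d ** R = R ** dg e" by (simp add: vec_eq_iff R_def \<pi>(2))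
  then have "dg d = R ** dg e ** conj_transpose R"
  proof -
    have "dg d = (dg d ** R) ** conj_transpose R"
      using R by (simp flip: matrix_mul_assoc)
    then show ?thesis by (simp only: \<open>dg d ** R = R ** dg e\<close>)
  qed
  then have "T = (Q ** R) ** dg e ** conj_transpose (Q ** R)"
    unfolding Q(2) by (simp only: conj_transpose_mult matrix_mul_assoc)
  then show ?thesis using that real_orth_mult[OF Q(1) R] by blast
qed

section \<open>Lagrangian representations and closed chains\<close>

definition cnjm :: "complex^'n^'m \<Rightarrow> complex^'n^'m" where
  "cnjm A = (\<chi> i j. cnj (A $ i $ j))"

lemma cnjm_nth [simp]: "cnjm A $ i $ j = cnj (A $ i $ j)"
  by (simp add: cnjm_def)

lemma cnjm_mult: "cnjm (A ** B) = cnjm A ** cnjm B"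
  by (simp add: vec_eq_iff matrix_matrix_mult_def)

lemma cnjm_conj_transpose: "cnjm (conj_transpose A) = transpose A"
  by (simp add: vec_eq_iff transpose_def)

lemma transpose_cnjm: "transpose (cnjm A) = conj_transpose A"
  by (simp add: vec_eq_iff transpose_def)

lemma transpose_conj_transpose: "transpose (conj_transpose A) = cnjm A"
  by (simp add: vec_eq_iff transpose_def)

lemma cnjm_transpose: "cnjm (transpose A) = conj_transpose A"
  by (simp add: vec_eq_iff transpose_def)

lemma cnjm_dg: "cnjm (dg d) = dg (\<lambda>i. cnj (d i))"
  by (simp add: vec_eq_iff)

lemma realmat_cnjm: "realmat A \<Longrightarrow> cnjm A = A"
  by (simp add: vec_eq_iff realmat_def complex_eq_iff)

lemma unitary_transpose_cnjm:
  fixes g :: "complex^'n^'n"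
  assumes "unitary_matrix g"
  shows "transpose g ** cnjm g = mat 1" "cnjm g ** transpose g = mat 1"
proof -
  have "cnjm (mat 1 :: complex^'n^'n) = mat 1" by (simp add: vec_eq_iff mat_def)
  then show "transpose g ** cnjm g = mat 1" "cnjm g ** transpose g = mat 1"
    using cnjm_mult[of "conj_transpose g" g] cnjm_mult[of g "conj_transpose g"] assms
    by (simp_all add: cnjm_conj_transpose)
qed

lemma unitary_cnjm: "unitary_matrix g \<Longrightarrow> unitary_matrix (cnjm g)"
  unfolding unitary_matrix_def[of "cnjm g"]
  using unitary_transpose_cnjm[of g] by (simp add: transpose_cnjm vec_eq_iff)
    (simp add: matrix_matrix_mult_def transpose_def)

lemma unitary_transpose:
  assumes "unitary_matrix g"
  shows "unitary_matrix (transpose g)"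
proof -
  have "transpose g = conj_transpose (cnjm g)" by (simp add: vec_eq_iff transpose_def)
  then show ?thesis using unitary_matrix_conj_transpose[OF unitary_cnjm[OF assms]] by (simp only:)
qed

lemma sigma0_mult: "sigma0 (A *v v) = cnjm A *v sigma0 v"
  by (simp add: vec_eq_iff sigma0_def matrix_vector_mult_def)

text \<open>Moving one \<open>sigma0\<close> past the matrices between the two involutions
  conjugates them entrywise. The two copies of \<open>sigma0\<close> then cancel, and a linear map
  remains.\<close>

lemma sigma_comp_sigma:
  fixes g g' :: "complex^'n^'n"
  assumes "unitary_matrix g" "unitary_matrix g'"
  shows "sigma ((*v) g ` real_vectors) \<circ> sigma ((*v) g' ` real_vectors) =
    (*v) (g ** transpose g ** cnjm g' ** conj_transpose g')"
proof -
  have "sigma0 (sigma0 v) = v" for v :: "complex^'n"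
    by (simp add: sigma0_def vec_eq_iff)
  then show ?thesis
    by (simp only: sigma_eq[OF assms(1) HOL.refl] sigma_eq[OF assms(2) HOL.refl] fun_eq_iff o_def
        unitary_matrix_inv[OF assms(1)] unitary_matrix_inv[OF assms(2)]
        sigma0_mult cnjm_conj_transpose cnjm_transpose matrix_vector_mul_assoc[symmetric] simp_thms)
qed

text \<open>An inverse square root of the diagonal matrix of eigenvalues. The angles are halved
  because composing two Lagrangian involutions doubles the angles between the subspaces.\<close>

definition phase :: "(nat \<Rightarrow> real) \<Rightarrow> complex^'n^'n" where
  "phase \<alpha> = dg (\<lambda>i. cis (- pi * \<alpha> (idx i)))"

text \<open>If \<open>real_vectors\<close> is the Lagrangian subspace with index 1, the chain of
  length \<open>s\<close> maps it to the one with index \<open>Suc s\<close>. The factors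
  \<open>Q\<close> are changes of real orthonormal frame between consecutive steps.\<close>

primrec chain :: "(nat \<Rightarrow> complex^'n^'n) \<Rightarrow> (nat \<Rightarrow> nat \<Rightarrow> real) \<Rightarrow> nat \<Rightarrow> complex^'n^'n" where
  "chain Q a 0 = mat 1"
| "chain Q a (Suc s) = chain Q a s ** phase (a (Suc s)) ** Q (Suc s)"

lemma unitary_phase [simp]: "unitary_matrix (phase \<alpha>)"
  unfolding phase_def by (rule unitary_dg) simp

lemma unitary_chain:
  assumes "\<And>s. s \<in> {1..l} \<Longrightarrow> real_orth (Q s)" "t \<le> l"
  shows "unitary_matrix (chain Q a t)"
  using assms(2)
proof (induction t)
  case (Suc t)
  then have "real_orth (Q (Suc t))" by (intro assms(1)) simp
  then show ?case using Suc by (auto intro!: unitary_matrix_mult)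
qed simp

lemma phase_power:
  "phase \<alpha> ** dg (\<lambda>i. cis (2 * pi * \<alpha> (idx i))) ** phase \<alpha> = (mat 1 :: complex^'n^'n)"
  unfolding phase_def by (simp add: cis_mult dg_1)

text \<open>In the frame \<open>g\<close> the product of the two involutions is the symmetric
  unitary matrix \<open>T = transpose h ** h\<close>. Diagonalising \<open>T\<close> by a real
  orthogonal \<open>Q\<close> and taking out half of the angles turns \<open>h\<close> into a real
  orthogonal \<open>k\<close>; then \<open>C\<close> is the inverse of \<open>k\<close>.\<close>

lemma lagrangian_step:
  fixes g g' :: "complex^'n^'n"
  assumes g: "unitary_matrix g" "unitary_matrix g'"
    and \<alpha>: "spec (g ** transpose g ** cnjm g' ** conj_transpose g') = \<alpha>"
  obtains B C where "real_orth B" "real_orth C" "g' = g ** B ** phase \<alpha> ** C"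
proof -
  define A where "A = g ** transpose g ** cnjm g' ** conj_transpose g'"
  define h where "h = conj_transpose g' ** g"
  define T where "T = transpose h ** h"
  have uh: "unitary_matrix h" unfolding h_def
    using g by (intro unitary_matrix_mult unitary_matrix_conj_transpose)
  have th: "transpose h = transpose g ** cnjm g'"
    by (simp only: h_def matrix_transpose_mul transpose_conj_transpose)
  have uT: "unitary_matrix T" unfolding T_def
    using uh by (intro unitary_matrix_mult unitary_transpose)
  have sT: "transpose T = T" unfolding T_def by (simp only: matrix_transpose_mul transpose_transpose)
  have "g ** T ** conj_transpose g = g ** transpose g ** cnjm g' ** conj_transpose g' ** (g ** conj_transpose g)"
    unfolding T_def th unfolding h_def by (simp only: matrix_mul_assoc)
  then have AT: "A = g ** T ** conj_transpose g" using g by (simp add: A_def)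
  define e where "e i = cis (2 * pi * \<alpha> (idx (i :: 'n)))" for i
  obtain Q where Q: "real_orth Q" "T = Q ** dg e ** conj_transpose Q"
  proof (rule diagonalise_symmetric_unitary_as[OF uT sT])
    fix V d c assume V: "unitary_matrix V" "\<And>i. cmod (d i) = 1" "T = V ** dg d ** conj_transpose V"
    have AV: "A = (g ** V) ** dg d ** conj_transpose (g ** V)"
      unfolding AT V(3) by (simp only: conj_transpose_mult matrix_mul_assoc)
    have uV: "unitary_matrix (g ** V)" using g V by (intro unitary_matrix_mult)
    have "is_spec A \<alpha>" using is_spec_spec[of "g ** V" d, OF uV V(2)] \<alpha> unfolding AV[symmetric] by (simp add: A_def)
    then have "eigen_mult A UNIV c = card {j \<in> {1..CARD('n)}. cis (2 * pi * \<alpha> j) = c}"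
      unfolding is_spec_def by blast
    also have "\<dots> = card {i. e i = c}"
      using card_idx[of "UNIV :: 'n set" "\<lambda>j. cis (2 * pi * \<alpha> j) = c"] by (simp add: range_idx e_def)
    finally show "card {i. d i = c} = card {i. e i = c}"
      using eigen_mult_diag_UNIV[OF uV, of d c] by (simp add: AV[symmetric])
  qed blast
  define k where "k = h ** Q ** phase \<alpha>"
  have uk: "unitary_matrix k" unfolding k_def using uh Q(1) by (intro unitary_matrix_mult) auto
  have "transpose k ** k = transpose (phase \<alpha>) ** transpose Q ** (transpose h ** h) ** Q ** phase \<alpha>"
    unfolding k_def by (simp only: matrix_transpose_mul matrix_mul_assoc)
  also have "\<dots> = transpose (phase \<alpha>) ** (conj_transpose Q ** Q) ** dg e ** (conj_transpose Q ** Q) ** phase \<alpha>"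
    unfolding T_def[symmetric] Q(2) using realmat_transpose[OF real_orthD(2)[OF Q(1)]]
    by (simp only: matrix_mul_assoc)
  also have "\<dots> = phase \<alpha> ** dg e ** phase \<alpha>"
    using Q(1) by (simp add: phase_def)
  also have "\<dots> = mat 1" unfolding e_def by (rule phase_power)
  finally have tk: "transpose k ** k = mat 1" .
  \<comment> \<open>A unitary matrix whose transpose is its inverse agrees with its entrywise
    conjugate, so it is real.\<close>
  have "transpose k = transpose k ** k ** conj_transpose k"
    using uk by (simp flip: matrix_mul_assoc)
  then have "transpose k = conj_transpose k" unfolding tk by simp
  then have "transpose k $ j $ i = conj_transpose k $ j $ i" for i j by (simp only:)
  then have "realmat k" by (simp add: realmat_def transpose_def complex_eq_iff)
  then have k: "real_orth k" using uk unfolding real_orth_def by blast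
  have "g ** Q ** phase \<alpha> ** conj_transpose k = g' ** (conj_transpose g' ** g ** Q ** phase \<alpha>) ** conj_transpose k"
    using g by (simp flip: matrix_mul_assoc)
  also have "\<dots> = g'" unfolding h_def[symmetric] k_def[symmetric] using uk by (simp flip: matrix_mul_assoc)
  finally show ?thesis using that[OF Q(1) real_orth_conj_transpose[OF k]] by simp
qed

text \<open>Consecutive frames differ by real orthogonal factors around a phase. Merging the right
  factor of each step with the left factor of the next one yields the chain, and it closes because
  the frames return to the first one.\<close>

lemma lagrangian_rep_closed_chain:
  fixes \<rho> :: "word set \<Rightarrow> complex^'n^'n"
  assumes \<rho>: "lagrangian_rep l \<rho>" and l: "l \<ge> 1"
  shows "\<exists>Q :: nat \<Rightarrow> complex^'n^'n. (\<forall>s\<in>{1..l}. real_orth (Q s)) \<and> chain Q (spectra l \<rho>) l = mat 1"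
proof -
  define a where "a = spectra l \<rho>"
  obtain L where L: "\<And>s. s \<in> {1..l} \<Longrightarrow> lagrangian (L s)" "L (Suc l) = L 1"
      "\<And>s. s \<in> {1..l} \<Longrightarrow> (*v) (\<rho> (gen l s)) = sigma (L s) \<circ> sigma (L (Suc s))"
    using \<rho> unfolding lagrangian_rep_def by blast
  \<comment> \<open>The frame is chosen as a function of the set \<open>L s\<close> alone, so that
    \<open>L (Suc l) = L 1\<close> forces equal frames.\<close>
  define g where "g s = (SOME g. unitary_matrix g \<and> L s = (*v) g ` real_vectors)" for s
  have g1: "unitary_matrix (g s) \<and> L s = (*v) (g s) ` real_vectors" if "s \<in> {1..l}" for s
    unfolding g_def using L(1)[OF that] unfolding lagrangian_def by (rule someI_ex)
  have gl: "g (Suc l) = g 1" by (simp add: g_def L(2))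
  have g: "unitary_matrix (g s) \<and> L s = (*v) (g s) ` real_vectors" if "s \<in> {1..Suc l}" for s
  proof (cases "s = Suc l")
    case True
    have "unitary_matrix (g 1) \<and> L 1 = (*v) (g 1) ` real_vectors" using l by (intro g1) simp
    then show ?thesis unfolding True gl L(2) .
  qed (use that g1 in auto)
  have "\<exists>B C. real_orth B \<and> real_orth C \<and> g (Suc s) = g s ** B ** phase (a s) ** C"
    if s: "s \<in> {1..l}" for s
  proof -
    have gs: "unitary_matrix (g s)" "unitary_matrix (g (Suc s))" using g[of s] g[of "Suc s"] s by auto
    have Ls: "L s = (*v) (g s) ` real_vectors" "L (Suc s) = (*v) (g (Suc s)) ` real_vectors"
      using g[of s] g[of "Suc s"] s by auto
    have "(*v) (\<rho> (gen l s)) = (*v) (g s ** transpose (g s) ** cnjm (g (Suc s)) ** conj_transpose (g (Suc s)))"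
      unfolding L(3)[OF s] unfolding Ls by (rule sigma_comp_sigma[OF gs])
    then have "\<rho> (gen l s) = g s ** transpose (g s) ** cnjm (g (Suc s)) ** conj_transpose (g (Suc s))"
      by (intro iffD2[OF matrix_eq] allI) (rule fun_cong)
    then have "spec (g s ** transpose (g s) ** cnjm (g (Suc s)) ** conj_transpose (g (Suc s))) = a s"
      using s by (simp add: a_def spectra_def)
    from lagrangian_step[OF gs this] show ?thesis by blast
  qed
  then have "\<forall>s\<in>{1..l}. \<exists>B C. real_orth B \<and> real_orth C \<and> g (Suc s) = g s ** B ** phase (a s) ** C"
    by (rule ballI)
  from bchoice[OF this] obtain B where
    "\<forall>s\<in>{1..l}. \<exists>C. real_orth (B s) \<and> real_orth C \<and> g (Suc s) = g s ** B s ** phase (a s) ** C" by blast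
  from bchoice[OF this] obtain C where
    BC: "\<And>s. s \<in> {1..l} \<Longrightarrow> real_orth (B s) \<and> real_orth (C s) \<and> g (Suc s) = g s ** B s ** phase (a s) ** C s"
    by blast
  \<comment> \<open>\<open>B\<close> is only controlled on \<open>{1..l}\<close>, and the last step
    has to join up with the first one.\<close>
  define B' where "B' s = (if s = Suc l then B 1 else B s)" for s
  have B': "real_orth (B' s)" if "s \<in> {1..Suc l}" for s
  proof -
    have "real_orth (B s)" if "s \<in> {1..l}" for s using BC[OF that] by blast
    then show ?thesis using that l by (auto simp: B'_def)
  qed
  define Q where "Q s = C s ** B' (Suc s)" for s
  have ro: "real_orth (Q s)" if "s \<in> {1..l}" for s
    unfolding Q_def using BC[OF that] B'[of "Suc s"] that by (intro real_orth_mult) auto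
  have ch: "g (Suc t) ** B' (Suc t) = g 1 ** B' 1 ** chain Q a t" if "t \<le> l" for t
    using that
  proof (induction t)
    case (Suc t)
    have "B (Suc t) = B' (Suc t)" using Suc.prems by (simp add: B'_def)
    then have "g (Suc (Suc t)) ** B' (Suc (Suc t)) =
        g (Suc t) ** B' (Suc t) ** phase (a (Suc t)) ** C (Suc t) ** B' (Suc (Suc t))"
      using BC[of "Suc t"] Suc.prems by simp
    then show ?case using Suc by (simp add: Q_def matrix_mul_assoc)
  qed simp
  have u: "unitary_matrix (g 1 ** B' 1)"
    using g[of 1] B'[of 1] l by (intro unitary_matrix_mult) auto
  have "g 1 ** B' 1 = g 1 ** B' 1 ** chain Q a l"
  proof -
    have "B' (Suc l) = B' 1" by (simp add: B'_def)
    then show ?thesis using ch[OF le_refl] by (simp only: gl)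
  qed
  then have "conj_transpose (g 1 ** B' 1) ** (g 1 ** B' 1) =
      conj_transpose (g 1 ** B' 1) ** (g 1 ** B' 1 ** chain Q a l)" by (rule arg_cong)
  then have "chain Q a l = mat 1" by (simp only: unitary_left[OF u] unitary_cancel_left(1)[OF u])
  with ro have "(\<forall>s\<in>{1..l}. real_orth (Q s)) \<and> chain Q a l = mat 1" by (intro conjI ballI)
  then show ?thesis unfolding a_def by (rule exI[of _ Q])
qed

section \<open>From closed chains back to Lagrangian representations\<close>

definition holonomy :: "(nat \<Rightarrow> complex^'n^'n) \<Rightarrow> (nat \<Rightarrow> nat \<Rightarrow> real) \<Rightarrow> nat \<Rightarrow> complex^'n^'n" where
  "holonomy Q a s = chain Q a (s - 1) ** dg (\<lambda>i. cis (2 * pi * a s (idx i))) ** conj_transpose (chain Q a (s - 1))"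

lemma unitary_holonomy:
  assumes "\<And>s. s \<in> {1..l} \<Longrightarrow> real_orth (Q s)" "s \<in> {1..l}"
  shows "unitary_matrix (holonomy Q a s)"
  unfolding holonomy_def using unitary_chain[OF assms(1), where t="s - 1" and a=a] assms(2)
  by (intro unitary_matrix_mult unitary_matrix_conj_transpose unitary_dg) auto

text \<open>The real orthogonal factor cancels, and two conjugated half-angle phases combine to the
  full angle. This exhibits the holonomy as the matrix in \<open>sigma_comp_sigma\<close> for two
  consecutive partial chains.\<close>

lemma holonomy_eq:
  fixes Q :: "nat \<Rightarrow> complex^'n^'n"
  assumes Q: "\<And>s. s \<in> {1..l} \<Longrightarrow> real_orth (Q s)" and s: "Suc s \<le> l"
  shows "holonomy Q a (Suc s) = chain Q a s ** transpose (chain Q a s) **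
    cnjm (chain Q a (Suc s)) ** conj_transpose (chain Q a (Suc s))"
proof -
  define c where "c = chain Q a s"
  define E :: "complex^'n^'n" where "E = phase (a (Suc s))"
  define R where "R = Q (Suc s)"
  have u: "unitary_matrix c" unfolding c_def using unitary_chain[OF Q, where t=s and a=a] s by auto
  have R: "real_orth R" using Q s by (simp add: R_def)
  have "c ** transpose c ** cnjm (c ** E ** R) ** conj_transpose (c ** E ** R) =
     c ** (transpose c ** cnjm c) ** cnjm E ** (R ** conj_transpose R) ** conj_transpose E ** conj_transpose c"
    by (simp only: cnjm_mult conj_transpose_mult matrix_mul_assoc realmat_cnjm[OF real_orthD(2)[OF R]])
  also have "\<dots> = c ** (cnjm E ** conj_transpose E) ** conj_transpose c"
    using R by (simp add: unitary_transpose_cnjm[OF u] matrix_mul_assoc)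
  also have "cnjm E ** conj_transpose E = dg (\<lambda>i. cis (2 * pi * a (Suc s) (idx i)))"
    by (simp add: E_def phase_def cnjm_dg cis_cnj cis_mult algebra_simps)
  finally show ?thesis by (simp add: holonomy_def c_def E_def R_def)
qed

text \<open>For a partial chain \<open>c\<close> the matrix
  \<open>cnjm c ** conj_transpose c\<close> is inverse to \<open>c ** transpose c\<close>, so the
  product telescopes. The induction needs an arbitrary \<open>X\<close>, since splitting off the
  last factor of the fold moves it into the accumulator.\<close>

lemma foldr_holonomy:
  fixes Q :: "nat \<Rightarrow> complex^'n^'n"
  assumes Q: "\<And>s. s \<in> {1..l} \<Longrightarrow> real_orth (Q s)" and t: "t \<le> l"
  shows "foldr (\<lambda>s x. holonomy Q a s ** x) [1..<Suc t] X =
    cnjm (chain Q a t) ** conj_transpose (chain Q a t) ** X"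
  using t
proof (induction t arbitrary: X)
  case 0
  have "cnjm (mat 1 :: complex^'n^'n) = mat 1" by (simp add: vec_eq_iff mat_def)
  then show ?case by simp
next
  case (Suc t)
  define c where "c = chain Q a t"
  define c' where "c' = chain Q a (Suc t)"
  have u: "unitary_matrix c" unfolding c_def using unitary_chain[OF Q, where t=t and a=a] Suc.prems by auto
  have "foldr (\<lambda>s x. holonomy Q a s ** x) [1..<Suc (Suc t)] X =
     foldr (\<lambda>s x. holonomy Q a s ** x) [1..<Suc t] (holonomy Q a (Suc t) ** X)"
    by (subst upt_Suc) (simp del: upt_Suc)
  also have "\<dots> = cnjm c ** conj_transpose c ** (holonomy Q a (Suc t) ** X)"
    unfolding c_def using Suc.prems by (intro Suc.IH) simp
  also have "holonomy Q a (Suc t) = c ** transpose c ** cnjm c' ** conj_transpose c'"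
    unfolding c_def c'_def using Q Suc.prems by (rule holonomy_eq)
  also have "cnjm c ** conj_transpose c ** (c ** transpose c ** cnjm c' ** conj_transpose c' ** X) =
     cnjm c ** (conj_transpose c ** c) ** transpose c ** cnjm c' ** conj_transpose c' ** X"
    by (simp only: matrix_mul_assoc)
  also have "\<dots> = cnjm c' ** conj_transpose c' ** X"
    using u by (simp add: unitary_transpose_cnjm[OF u])
  finally show ?case by (simp only: c'_def)
qed

text \<open>The holonomies serve as images of the generators, and the subspace with index
  \<open>s\<close> is framed by the chain of length \<open>s - 1\<close>. Closedness of the chain
  yields both the relation of the group and \<open>L (Suc l) = L 1\<close>.\<close>

lemma rep_of_closed_chain:
  fixes Q :: "nat \<Rightarrow> complex^'n^'n"
  assumes Q: "\<And>s. s \<in> {1..l} \<Longrightarrow> real_orth (Q s)" and a: "a \<in> weights CARD('n) l"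
    and closed: "chain Q a l = mat 1" and l: "l \<ge> 1"
  shows "\<exists>\<rho>. lagrangian_rep l \<rho> \<and> spectra l \<rho> = a \<and> (\<forall>s\<in>{1..l}. \<rho> (gen l s) = holonomy Q a s)"
proof -
  interpret G: group "U :: (complex^'n^'n) monoid" by (rule group_U)
  have U: "mult (U :: (complex^'n^'n) monoid) = (**)" "one (U :: (complex^'n^'n) monoid) = mat 1"
    "carrier (U :: (complex^'n^'n) monoid) = {A. unitary_matrix A}"
    by (simp_all add: U_def)
  have "cnjm (mat 1 :: complex^'n^'n) = mat 1" by (simp add: vec_eq_iff mat_def)
  then have "foldr (\<lambda>s x. holonomy Q a s ** x) [1..<Suc l] (mat 1) = mat 1"
    using foldr_holonomy[OF Q le_refl, where X = "mat 1" and a = a] closed by (simp del: upt_Suc)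
  then have "\<exists>h \<in> hom (Gamma l) U. \<forall>s\<in>{1..l}. h (gen l s) = holonomy Q a s"
    using unitary_holonomy[OF Q] by (intro G.Gamma_lift) (auto simp: U simp del: upt_Suc)
  then obtain \<rho> where \<rho>: "\<rho> \<in> hom (Gamma l) U" "\<And>s. s \<in> {1..l} \<Longrightarrow> \<rho> (gen l s) = holonomy Q a s"
    by blast
  have u: "unitary_matrix (chain Q a t)" if "t \<le> l" for t using unitary_chain[OF Q that] by auto
  have "spec (holonomy Q a s) = a s" if "s \<in> {1..l}" for s
    unfolding holonomy_def
    using u[of "s - 1"] that a by (intro spec_eqI is_spec_diag) (auto simp: weights_def)
  then have spec: "spectra l \<rho> = a"
    using a \<rho>(2) by (auto simp: spectra_def fun_eq_iff weights_def)
  define L where "L s = (*v) (chain Q a (s - 1)) ` (real_vectors :: (complex^'n) set)" for s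
  have "lagrangian (L s)" if "s \<in> {1..l}" for s
    unfolding L_def lagrangian_def using u[of "s - 1"] that by (intro exI[of _ "chain Q a (s - 1)"]) auto
  moreover have "L (Suc l) = L 1" by (simp add: L_def closed)
  moreover have "(*v) (\<rho> (gen l s)) = sigma (L s) \<circ> sigma (L (Suc s))" if s: "s \<in> {1..l}" for s
  proof -
    obtain t where t: "s = Suc t" "Suc t \<le> l" using s by (cases s) auto
    have "sigma (L s) \<circ> sigma (L (Suc s)) = (*v) (chain Q a t ** transpose (chain Q a t) **
        cnjm (chain Q a (Suc t)) ** conj_transpose (chain Q a (Suc t)))"
      unfolding L_def t(1) diff_Suc_1 using u[of t] u[of "Suc t"] t(2)
      by (intro sigma_comp_sigma) auto
    also have "\<dots> = (*v) (holonomy Q a (Suc t))" by (simp only: holonomy_eq[OF Q t(2)])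
    finally show ?thesis using \<rho>(2)[OF s] t(1) by simp
  qed
  ultimately have "lagrangian_rep l \<rho>"
    unfolding lagrangian_rep_def unitary_rep_def using \<rho>(1) by blast
  then show ?thesis using spec \<rho>(2) by (intro exI[of _ \<rho>] conjI ballI)
qed

text \<open>Membership becomes the solvability of a matrix equation that depends continuously on
  \<open>a\<close>, with unknowns in a compact group.\<close>

lemma lagrangian_locus_iff:
  assumes "l \<ge> 1"
  shows "a \<in> lagrangian_locus TYPE('n::finite) I l m z \<longleftrightarrow> a \<in> P I l CARD('n) m z \<and>
    (\<exists>Q :: nat \<Rightarrow> complex^'n^'n. (\<forall>s\<in>{1..l}. real_orth (Q s)) \<and> chain Q a l = mat 1)"
proof
  assume "a \<in> lagrangian_locus TYPE('n) I l m z"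
  then obtain \<rho> :: "word set \<Rightarrow> complex^'n^'n" where
    aP: "a \<in> P I l CARD('n) m z" and "lagrangian_rep l \<rho>" and a: "a = spectra l \<rho>"
    unfolding lagrangian_locus_def by blast
  from lagrangian_rep_closed_chain[OF this(2) assms] obtain Q :: "nat \<Rightarrow> complex^'n^'n" where
    Q: "\<And>s. s \<in> {1..l} \<Longrightarrow> real_orth (Q s)" "chain Q (spectra l \<rho>) l = mat 1" by blast
  have "chain Q a l = mat 1" unfolding a by (rule Q(2))
  with Q(1) have "(\<forall>s\<in>{1..l}. real_orth (Q s)) \<and> chain Q a l = mat 1" by (intro conjI ballI)
  then show "a \<in> P I l CARD('n) m z \<and>
      (\<exists>Q :: nat \<Rightarrow> complex^'n^'n. (\<forall>s\<in>{1..l}. real_orth (Q s)) \<and> chain Q a l = mat 1)"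
    using aP by blast
next
  assume r: "a \<in> P I l CARD('n) m z \<and>
      (\<exists>Q :: nat \<Rightarrow> complex^'n^'n. (\<forall>s\<in>{1..l}. real_orth (Q s)) \<and> chain Q a l = mat 1)"
  then obtain Q :: "nat \<Rightarrow> complex^'n^'n" where Q: "\<And>s. s \<in> {1..l} \<Longrightarrow> real_orth (Q s)" "chain Q a l = mat 1"
    by blast
  have "a \<in> weights CARD('n) l" using r by (auto simp: P_def)
  from rep_of_closed_chain[OF Q(1) this Q(2) assms]
  obtain \<rho> :: "word set \<Rightarrow> complex^'n^'n" where "lagrangian_rep l \<rho>" "spectra l \<rho> = a" by blast
  then show "a \<in> lagrangian_locus TYPE('n) I l m z"
    unfolding lagrangian_locus_def using r by auto
qed

section \<open>Symmetries of closed chains force inner walls\<close>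

lemma inner_mult_vec:
  fixes A :: "complex^'n^'n"
  shows "inner y (A *v v) = inner (conj_transpose A *v y) v"
proof -
  have ip: "inner x y = Re (\<Sum>i\<in>UNIV. cnj (x $ i) * y $ i)" for x y :: "complex^'n"
    by (simp add: inner_vec_def inner_complex_def)
  have "(\<Sum>i\<in>UNIV. cnj (y $ i) * (A *v v) $ i) = (\<Sum>i\<in>UNIV. \<Sum>j\<in>UNIV. cnj (y $ i) * A $ i $ j * v $ j)"
    by (simp add: matrix_vector_mult_def sum_distrib_left mult.assoc)
  also have "\<dots> = (\<Sum>j\<in>UNIV. \<Sum>i\<in>UNIV. cnj (y $ i) * A $ i $ j * v $ j)" by (rule sum.swap)
  also have "\<dots> = (\<Sum>j\<in>UNIV. cnj ((conj_transpose A *v y) $ j) * v $ j)"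
    by (simp add: matrix_vector_mult_def sum_distrib_right sum_distrib_left mult_ac)
  finally show ?thesis unfolding ip by (simp only:)
qed

text \<open>The adjoint of \<open>A\<close> commutes with \<open>H\<close> as well and so preserves
  \<open>W\<close>. Hence \<open>A\<close>, moved across the inner product, preserves the
  complement.\<close>

lemma eigenspace_invariant:
  fixes A H :: "complex^'n^'n" and c :: complex
  assumes u: "unitary_matrix A" and comm: "A ** H = H ** A"
  defines "W \<equiv> {v. H *v v = c *s v}"
  shows "(*v) A ` W \<subseteq> W" "(*v) A ` (W\<^sup>\<bottom>) \<subseteq> W\<^sup>\<bottom>"
proof -
  have inv: "B *v v \<in> W" if "B ** H = H ** B" "v \<in> W" for B v
  proof -
    have "H *v (B *v v) = B *v (H *v v)"
      using that(1) by (simp only: matrix_vector_mul_assoc)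
    also have "\<dots> = c *s (B *v v)" using that(2) by (simp add: W_def vec.scale)
    finally show ?thesis by (simp add: W_def)
  qed
  show "(*v) A ` W \<subseteq> W" using inv[OF comm] by blast
  have "conj_transpose A ** (A ** H) ** conj_transpose A = conj_transpose A ** (H ** A) ** conj_transpose A"
    by (simp only: comm)
  then have comm': "conj_transpose A ** H = H ** conj_transpose A"
    using u by (simp flip: matrix_mul_assoc)
  have "orthogonal y (A *v v)" if "v \<in> W\<^sup>\<bottom>" "y \<in> W" for v y
    using that inv[OF comm' that(2)]
    unfolding orthogonal_def inner_mult_vec by (simp add: orthogonal_comp_def orthogonal_def)
  then show "(*v) A ` (W\<^sup>\<bottom>) \<subseteq> W\<^sup>\<bottom>" by (auto simp: orthogonal_comp_def)
qed

text \<open>A \<open>reduction\<close> asks for invariance under the whole group, whereas the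
  symmetry is only known on the generators. It passes to their inverses and then to all
  words.\<close>

lemma rep_commutes:
  fixes \<rho> :: "word set \<Rightarrow> complex^'n^'n"
  assumes \<rho>: "unitary_rep l \<rho>" and comm: "\<And>s. s \<in> {1..l} \<Longrightarrow> \<rho> (gen l s) ** H = H ** \<rho> (gen l s)"
    and x: "x \<in> carrier (Gamma l)"
  shows "unitary_matrix (\<rho> x) \<and> \<rho> x ** H = H ** \<rho> x"
proof -
  have hom: "\<rho> \<in> hom (Gamma l) U" using \<rho> by (simp add: unitary_rep_def)
  have U: "mult (U :: (complex^'n^'n) monoid) = (**)" "one (U :: (complex^'n^'n) monoid) = mat 1"
    "carrier (U :: (complex^'n^'n) monoid) = {A. unitary_matrix A}"
    by (simp_all add: U_def)
  have car: "word_class l w \<in> carrier (Gamma l)" if "w \<in> words l" for w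
    using that by (simp add: Gamma_def)
  have uni: "unitary_matrix (\<rho> x)" if "x \<in> carrier (Gamma l)" for x
    using hom_in_carrier[OF hom that] by (simp only: U mem_Collect_eq)
  have mult: "\<rho> (word_class l (u @ v)) = \<rho> (word_class l u) ** \<rho> (word_class l v)"
    if "u \<in> words l" "v \<in> words l" for u v
    using hom_mult[OF hom car[OF that(1)] car[OF that(2)]] by (simp only: U Gamma_mult[OF that])
  have one: "\<rho> (word_class l []) = mat 1"
    using hom_one[OF hom group_Gamma group_U] by (simp add: U Gamma_def)
  have let_comm: "\<rho> (word_class l [(s, b)]) ** H = H ** \<rho> (word_class l [(s, b)])" if s: "s \<in> {1..l}" for s b
  proof (cases b)
    case True
    then show ?thesis using comm[OF s] by (simp add: gen_def)
  next
    case False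
    have w: "[(s, False)] \<in> words l" "[(s, True)] \<in> words l" using s by (auto simp: words_def)
    define A B where "A = \<rho> (word_class l [(s, True)])" and "B = \<rho> (word_class l [(s, False)])"
    have "word_eq l ([] @ [(s, False), (s, \<not> False)] @ []) ([] @ [])"
      using s by (intro word_eq.cancel) auto
    then have "word_class l ([(s, False)] @ [(s, True)]) = word_class l []"
      using w by (subst word_class_eq_iff) (auto simp: words_def)
    then have BA: "B ** A = mat 1" using mult[OF w] one by (simp only: A_def B_def)
    have uA: "unitary_matrix A" unfolding A_def using uni car w by blast
    have "B = B ** A ** conj_transpose A" using uA by (simp flip: matrix_mul_assoc)
    then have AB: "A ** B = mat 1" unfolding BA using uA by simp
    have cA: "A ** H = H ** A" using comm[OF s] by (simp only: A_def gen_def)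
    have "B ** H = B ** H ** (A ** B)" by (simp add: AB)
    also have "\<dots> = B ** (A ** H) ** B" unfolding cA by (simp only: matrix_mul_assoc)
    also have "\<dots> = H ** B" by (simp add: matrix_mul_assoc BA)
    finally show ?thesis using False by (simp add: B_def)
  qed
  obtain w where w: "w \<in> words l" "x = word_class l w" using x by (auto simp: Gamma_def)
  have "\<rho> (word_class l w) ** H = H ** \<rho> (word_class l w)" using w(1)
  proof (induction w)
    case Nil
    then show ?case by (simp add: one)
  next
    case (Cons p w)
    obtain s b where p: "p = (s, b)" by (cases p)
    have sb: "[(s, b)] \<in> words l" "w \<in> words l" "s \<in> {1..l}" using Cons.prems by (auto simp: words_def p)
    define A B where "A = \<rho> (word_class l [(s, b)])" and "B = \<rho> (word_class l w)"
    have e: "\<rho> (word_class l (p # w)) = A ** B"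
      using mult[OF sb(1,2)] by (simp add: p A_def B_def)
    have cA: "A ** H = H ** A" unfolding A_def by (rule let_comm[OF sb(3)])
    have cB: "B ** H = H ** B" unfolding B_def by (rule Cons.IH[OF sb(2)])
    have "A ** B ** H = A ** H ** B" by (simp only: cB flip: matrix_mul_assoc)
    then show ?case unfolding e by (simp only: cA matrix_mul_assoc)
  qed
  then show ?thesis using uni[OF x] w(2) by simp
qed

text \<open>Seen from the frame before step \<open>s\<close>, \<open>H\<close> is a real symmetric
  \<open>M\<close>, and conjugating by the phase keeps it real. This multiplies the entry at
  \<open>p\<close> and \<open>q\<close> by \<open>cis (pi * u)\<close> with \<open>u\<close> the
  difference of two weights, of absolute value below 1. So the entry vanishes or the weights agree:
  \<open>M\<close> commutes with the diagonal of eigenvalues, and both are diagonalised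
  together.\<close>

lemma diagonalise_symmetry:
  fixes H :: "complex^'n^'n"
  assumes Q: "\<And>s. s \<in> {1..l} \<Longrightarrow> real_orth (Q s)" and a: "a \<in> weights CARD('n) l"
    and s: "s \<in> {1..l}" and H: "conj_transpose H = H"
    and real: "\<And>t. t \<le> l \<Longrightarrow> realmat (conj_transpose (chain Q a t) ** H ** chain Q a t)"
  shows "\<exists>V h. unitary_matrix V \<and> H = V ** dg (\<lambda>i. complex_of_real (h i)) ** conj_transpose V \<and>
    holonomy Q a s = V ** dg (\<lambda>i. cis (2 * pi * a s (idx i))) ** conj_transpose V"
proof -
  obtain t where t: "s = Suc t" "Suc t \<le> l" using s by (cases s) auto
  define c where "c = chain Q a t"
  define E :: "complex^'n^'n" where "E = phase (a s)"
  define R where "R = Q s"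
  define M where "M = conj_transpose c ** H ** c"
  have uc: "unitary_matrix c" unfolding c_def using unitary_chain[OF Q, where t = t and a = a] t(2) by auto
  have R: "real_orth R" using Q s by (simp add: R_def)
  have M: "realmat M" "conj_transpose M = M"
    using real[of t] t(2) by (simp_all add: M_def c_def conj_transpose_mult H matrix_mul_assoc)
  have cs: "chain Q a s = c ** E ** R" by (simp add: t(1) c_def E_def R_def)
  have "realmat (conj_transpose (c ** E ** R) ** H ** (c ** E ** R))"
    using real[of s] s unfolding cs by simp
  then have rR: "realmat (conj_transpose R ** (conj_transpose E ** M ** E) ** R)"
    by (simp only: M_def conj_transpose_mult matrix_mul_assoc)
  \<comment> \<open>Conjugation by the real matrix \<open>R\<close> preserves reality and strips off
    the last factor of the chain.\<close>
  have "realmat (R ** (conj_transpose R ** (conj_transpose E ** M ** E) ** R) ** conj_transpose R)"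
    by (intro realmat_mult[OF realmat_mult[OF _ rR]] realmat_conj_transpose real_orthD(2)[OF R])
  also have "R ** (conj_transpose R ** (conj_transpose E ** M ** E) ** R) ** conj_transpose R = conj_transpose E ** M ** E"
    using R by (simp flip: matrix_mul_assoc)
  finally have rE: "realmat (conj_transpose E ** M ** E)" .
  define x where "x i = cis (2 * pi * a s (idx i))" for i :: 'n
  have "x p * M $ p $ q = M $ p $ q * x q" for p q
  proof (cases "M $ p $ q = 0")
    case False
    define u where "u = a s (idx p) - a s (idx q)"
    have "(conj_transpose E ** M ** E) $ p $ q = cis (pi * u) * M $ p $ q"
      by (simp add: E_def phase_def u_def cis_cnj algebra_simps cis_mult flip: mult.assoc)
    then have "Im (cis (pi * u) * M $ p $ q) = 0" using rE unfolding realmat_def by metis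
    moreover have "Im (M $ p $ q) = 0" using M(1) by (simp add: realmat_def)
    ultimately have "sin (pi * u) * Re (M $ p $ q) = 0" by simp
    moreover have "Re (M $ p $ q) \<noteq> 0" using False \<open>Im (M $ p $ q) = 0\<close> by (simp add: complex_eq_iff)
    ultimately have "sin (pi * u) = 0" by simp
    then obtain k :: int where "pi * u = of_int k * pi" using sin_zero_iff_int2 by blast
    then have "u = of_int k" by simp
    moreover have "\<bar>u\<bar> < 1"
    proof -
      have "0 \<le> a s (idx r) \<and> a s (idx r) < 1" for r :: 'n
        using a s idx_range[of r] unfolding weights_def by blast
      from this[of p] this[of q] show ?thesis unfolding u_def by linarith
    qed
    ultimately have "k = 0" by linarith
    then have "u = 0" using \<open>u = of_int k\<close> by simp
    then have "a s (idx p) = a s (idx q)" by (simp add: u_def)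
    then have "x p = x q" by (simp add: x_def)
    then show ?thesis by simp
  qed simp
  then have "dg x ** M = M ** dg x" by (simp add: vec_eq_iff)
  then obtain B h where B: "real_orth B" "dg x ** B = B ** dg x"
      "conj_transpose B ** M ** B = dg (\<lambda>i. complex_of_real (h i))"
    using diagonalise_commuting_real_symmetric[OF M] by blast
  define V where "V = c ** B"
  have uV: "unitary_matrix V" unfolding V_def using uc B(1) by (intro unitary_matrix_mult) auto
  have "V ** dg (\<lambda>i. complex_of_real (h i)) ** conj_transpose V =
      (c ** (B ** conj_transpose B) ** conj_transpose c) ** H ** (c ** (B ** conj_transpose B) ** conj_transpose c)"
    unfolding V_def B(3)[symmetric] M_def by (simp only: conj_transpose_mult matrix_mul_assoc)
  also have "\<dots> = H" using uc B(1) by simp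
  finally have HV: "H = V ** dg (\<lambda>i. complex_of_real (h i)) ** conj_transpose V" by simp
  have "V ** dg x ** conj_transpose V = c ** (B ** dg x) ** conj_transpose B ** conj_transpose c"
    unfolding V_def by (simp only: conj_transpose_mult matrix_mul_assoc)
  also have "\<dots> = c ** dg x ** (B ** conj_transpose B) ** conj_transpose c"
    unfolding B(2)[symmetric] by (simp only: matrix_mul_assoc)
  also have "\<dots> = holonomy Q a s" using B(1) by (simp add: holonomy_def t(1) c_def x_def[abs_def])
  finally have "holonomy Q a s = V ** dg x ** conj_transpose V" by simp
  then show ?thesis using uV HV unfolding x_def[abs_def] by blast
qed

text \<open>A function of a diagonalised matrix does not depend on the diagonalisation, because the
  transition matrix \<open>W\<close> vanishes wherever \<open>d i\<close> and \<open>d' j\<close>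
  differ. For an indicator function it shows that all generators see the same spectral projection of
  \<open>H\<close>.\<close>

lemma diag_indicator_eq:
  fixes V V' :: "complex^'n^'n"
  assumes u: "unitary_matrix V" "unitary_matrix V'"
    and eq: "V ** dg d ** conj_transpose V = V' ** dg d' ** conj_transpose V'"
  shows "V ** dg (\<lambda>i. f (d i)) ** conj_transpose V = V' ** dg (\<lambda>i. f (d' i)) ** conj_transpose V'"
proof -
  define W where "W = conj_transpose V ** V'"
  have "conj_transpose V ** (V ** dg d ** conj_transpose V) ** V' =
      conj_transpose V ** (V' ** dg d' ** conj_transpose V') ** V'" by (simp only: eq)
  then have "dg d ** W = W ** dg d'" using u by (simp add: W_def flip: matrix_mul_assoc)
  then have "d i * W $ i $ j = W $ i $ j * d' j" for i j
    by (simp add: vec_eq_iff)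
  then have "d i = d' j \<or> W $ i $ j = 0" for i j by (metis mult.commute mult_cancel_left)
  then have "f (d i) * W $ i $ j = W $ i $ j * f (d' j)" for i j by (metis mult.commute mult_zero_left mult_zero_right)
  then have W: "dg (\<lambda>i. f (d i)) ** W = W ** dg (\<lambda>i. f (d' i))" by (simp add: vec_eq_iff)
  have "V ** dg (\<lambda>i. f (d i)) ** conj_transpose V = V ** (dg (\<lambda>i. f (d i)) ** W) ** conj_transpose V'"
    using u by (simp add: W_def flip: matrix_mul_assoc)
  also have "\<dots> = V' ** dg (\<lambda>i. f (d' i)) ** conj_transpose V'"
    unfolding W using u by (simp add: W_def flip: matrix_mul_assoc)
  finally show ?thesis .
qed

text \<open>
  Let \<open>p\<close> be a projection. On matrices commuting with \<open>p\<close>, the map \<open>A \<mapsto> A ** p + (mat 1 - p)\<close> is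
  multiplicative, and its determinant is that of \<open>A\<close> on the range of \<open>p\<close>.
\<close>

lemma restrict_mult:
  fixes p :: "complex^'n^'n"
  assumes p: "p ** p = p" and B: "B ** p = p ** B"
  shows "(A ** B) ** p + (mat 1 - p) = (A ** p + (mat 1 - p)) ** (B ** p + (mat 1 - p))"
proof -
  define N where "N = mat 1 - p"
  have NA: "N ** A = A - p ** A" for A
    by (simp add: N_def vec_eq_iff matrix_matrix_mult_def left_diff_distrib sum_subtractf mat_def if_distrib[of "\<lambda>x. x * _"] cong: if_cong)
  have AN: "A ** N = A - A ** p" for A
    by (simp add: N_def vec_eq_iff matrix_matrix_mult_def right_diff_distrib sum_subtractf mat_def if_distrib[of "\<lambda>x. _ * x"] cong: if_cong)
  have "(A ** p + N) ** (B ** p + N) = A ** p ** B ** p + A ** p ** N + N ** (B ** p) + N ** N"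
    by (simp only: matrix_add_ldistrib matrix_add_mult_distrib matrix_mul_assoc add.assoc) (simp add: algebra_simps)
  moreover have "A ** p ** B ** p = A ** B ** p"
  proof -
    have "A ** p ** B ** p = A ** (p ** B) ** p" by (simp only: matrix_mul_assoc)
    also have "\<dots> = A ** B ** (p ** p)" unfolding B[symmetric] by (simp only: matrix_mul_assoc)
    finally show ?thesis by (simp only: p)
  qed
  moreover have "A ** p ** N = 0"
    unfolding AN by (simp add: p flip: matrix_mul_assoc)
  moreover have "N ** (B ** p) = 0"
  proof -
    have "p ** (B ** p) = B ** p" by (simp only: B matrix_mul_assoc p)
    then show ?thesis unfolding NA by simp
  qed
  moreover have "N ** N = N"
  proof -
    have "p ** N = 0" unfolding AN by (simp add: p)
    then show ?thesis by (simp add: NA)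
  qed
  ultimately show ?thesis by (simp add: N_def)
qed

text \<open>Each \<open>A s\<close> is diagonal together with \<open>p\<close> in the basis
  \<open>V s\<close>, so its determinant on the range of \<open>p\<close> is a product over
  \<open>S s\<close>. These determinants multiply by \<open>restrict_mult\<close> although the bases
  vary with \<open>s\<close>.\<close>

lemma det_restrict_foldr:
  fixes A :: "nat \<Rightarrow> complex^'n^'n" and p :: "complex^'n^'n"
  assumes V: "\<And>s. s \<in> set xs \<Longrightarrow> unitary_matrix (V s)"
    and A: "\<And>s. s \<in> set xs \<Longrightarrow> A s = V s ** dg (d s) ** conj_transpose (V s)"
    and p: "\<And>s. s \<in> set xs \<Longrightarrow> p = V s ** dg (\<lambda>i. if i \<in> S s then 1 else 0) ** conj_transpose (V s)"
    and pp: "p ** p = p"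
  shows "foldr (\<lambda>s x. A s ** x) xs (mat 1) ** p = p ** foldr (\<lambda>s x. A s ** x) xs (mat 1) \<and>
    det (foldr (\<lambda>s x. A s ** x) xs (mat 1) ** p + (mat 1 - p)) = (\<Prod>s\<leftarrow>xs. \<Prod>i\<in>S s. d s i)"
  using V A p
proof (induction xs)
  case Nil
  have "p + (mat 1 - p) = mat 1" by (simp add: algebra_simps)
  then show ?case by simp
next
  case (Cons s xs)
  define X where "X = foldr (\<lambda>s x. A s ** x) xs (mat 1)"
  define B where "B = V s"
  define e where "e i = (if i \<in> S s then 1 else 0 :: complex)" for i
  have u: "unitary_matrix B" using Cons.prems(1)[of s] by (simp add: B_def)
  have As: "A s = B ** dg (d s) ** conj_transpose B" using Cons.prems(2)[of s] by (simp add: B_def)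
  have ps: "p = B ** dg e ** conj_transpose B" using Cons.prems(3)[of s] by (simp add: B_def e_def[abs_def])
  have IH: "X ** p = p ** X" "det (X ** p + (mat 1 - p)) = (\<Prod>s\<leftarrow>xs. \<Prod>i\<in>S s. d s i)"
    using Cons.IH[OF Cons.prems] unfolding X_def by (auto simp only: list.set intro: insertI2)
  have Ap: "A s ** p = B ** dg (\<lambda>i. d s i * e i) ** conj_transpose B"
    unfolding As ps using u by (simp flip: matrix_mul_assoc)
  have pA: "p ** A s = B ** dg (\<lambda>i. d s i * e i) ** conj_transpose B"
    unfolding As ps using u by (simp add: mult.commute flip: matrix_mul_assoc)
  have "p + B ** dg (\<lambda>i. 1 - e i) ** conj_transpose B = B ** (dg e + dg (\<lambda>i. 1 - e i)) ** conj_transpose B"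
    unfolding ps by (simp only: matrix_add_ldistrib matrix_add_mult_distrib)
  also have "dg e + dg (\<lambda>i. 1 - e i) = mat 1" by (simp add: vec_eq_iff mat_def)
  finally have "p + B ** dg (\<lambda>i. 1 - e i) ** conj_transpose B = mat 1" using u by simp
  then have N: "mat 1 - p = B ** dg (\<lambda>i. 1 - e i) ** conj_transpose B" by (simp add: algebra_simps)
  have "A s ** p + (mat 1 - p) = B ** (dg (\<lambda>i. d s i * e i) + dg (\<lambda>i. 1 - e i)) ** conj_transpose B"
    unfolding Ap N by (simp only: matrix_add_ldistrib matrix_add_mult_distrib)
  also have "dg (\<lambda>i. d s i * e i) + dg (\<lambda>i. 1 - e i) = dg (\<lambda>i. if i \<in> S s then d s i else 1)"
    by (simp add: vec_eq_iff e_def)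
  finally have "det (A s ** p + (mat 1 - p)) = (\<Prod>i\<in>UNIV. if i \<in> S s then d s i else 1)"
    by (simp only: det_unitary_cong[OF u] det_dg)
  also have "\<dots> = (\<Prod>i\<in>S s. d s i)" by (simp add: prod.If_cases)
  finally have dA: "det (A s ** p + (mat 1 - p)) = (\<Prod>i\<in>S s. d s i)" .
  have "A s ** X ** p = A s ** p ** X" by (simp only: IH(1) flip: matrix_mul_assoc)
  also have "\<dots> = p ** (A s ** X)" unfolding Ap pA[symmetric] by (simp only: matrix_mul_assoc)
  finally have "A s ** X ** p = p ** (A s ** X)" .
  moreover have "det (A s ** X ** p + (mat 1 - p)) = (\<Prod>i\<in>S s. d s i) * (\<Prod>s\<leftarrow>xs. \<Prod>i\<in>S s. d s i)"
    unfolding restrict_mult[OF pp IH(1)] det_mul dA IH(2) ..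
  ultimately show ?case unfolding X_def by simp
qed

section \<open>Integrality of the partial index and the resulting inner wall\<close>

lemma prod_cis: "(\<Prod>i\<in>S. cis (f i)) = cis (\<Sum>i\<in>S. f i)"
  by (induction S rule: infinite_finite_induct) (simp_all add: cis_mult)

lemma prod_list_cis: "(\<Prod>i\<leftarrow>xs. cis (f i)) = cis (\<Sum>i\<leftarrow>xs. f i)"
  by (induction xs) (simp_all add: cis_mult)

lemma cis_2pi_eq_1:
  assumes "cis (2 * pi * x) = 1"
  shows "\<exists>K :: int. x = of_int K"
proof -
  have "cos (2 * pi * x) = 1" using arg_cong[OF assms, of Re] by simp
  then obtain K :: int where "2 * pi * x = of_int K * 2 * pi" using cos_one_2pi_int by blast
  then have "x = of_int K" by simp
  then show ?thesis ..
qed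

text \<open>An eigenspace \<open>W\<close> of \<open>H\<close> is invariant under the representation
  of the closed chain, and it is proper because \<open>H\<close> is not a scalar. The sets
  \<open>p s\<close> index the eigenvalues on \<open>W\<close>; it remains to see that their partial
  index is a positive integer.\<close>

lemma inner_wall_of_symmetry:
  fixes H :: "complex^'n^'n" and Q :: "nat \<Rightarrow> complex^'n^'n"
  assumes l: "l \<ge> 1" and stratum: "is_stratum CARD('n) l m z" and I: "I \<noteq> 0"
    and aP: "a \<in> P I l CARD('n) m z"
    and interior: "a \<in> top_of_set (P I l CARD('n) m z) interior_of unitary_locus TYPE('n) I l m z"
    and Q: "\<And>s. s \<in> {1..l} \<Longrightarrow> real_orth (Q s)" and closed: "chain Q a l = mat 1"
    and H: "conj_transpose H = H"
    and real: "\<And>t. t \<le> l \<Longrightarrow> realmat (conj_transpose (chain Q a t) ** H ** chain Q a t)"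
    and nonscalar: "\<And>c. H \<noteq> dg (\<lambda>_. c)"
  shows "a \<in> inner_walls TYPE('n) I l m z"
proof -
  have aw: "a \<in> weights CARD('n) l" and ind: "index CARD('n) l a = of_int I"
    using aP by (auto simp: P_def)
  have nonneg: "0 \<le> a s (idx i)" if "s \<in> {1..l}" for s and i :: 'n
    using aw that idx_range[of i] unfolding weights_def by blast
  have "\<forall>s\<in>{1..l}. \<exists>V h. unitary_matrix V \<and> H = V ** dg (\<lambda>i. complex_of_real (h i)) ** conj_transpose V \<and>
      holonomy Q a s = V ** dg (\<lambda>i. cis (2 * pi * a s (idx i))) ** conj_transpose V"
    using diagonalise_symmetry[OF Q aw _ H real] by blast
  from bchoice[OF this] obtain V where "\<forall>s\<in>{1..l}. \<exists>h. unitary_matrix (V s) \<and>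
      H = V s ** dg (\<lambda>i. complex_of_real (h i)) ** conj_transpose (V s) \<and>
      holonomy Q a s = V s ** dg (\<lambda>i. cis (2 * pi * a s (idx i))) ** conj_transpose (V s)" ..
  from bchoice[OF this] obtain h where Vh: "\<forall>s\<in>{1..l}. unitary_matrix (V s) \<and>
      H = V s ** dg (\<lambda>i. complex_of_real (h s i)) ** conj_transpose (V s) \<and>
      holonomy Q a s = V s ** dg (\<lambda>i. cis (2 * pi * a s (idx i))) ** conj_transpose (V s)" ..
  have V: "unitary_matrix (V s)" and HV: "V s ** dg (\<lambda>i. complex_of_real (h s i)) ** conj_transpose (V s) = H"
    and hol: "holonomy Q a s = V s ** dg (\<lambda>i. cis (2 * pi * a s (idx i))) ** conj_transpose (V s)"
    if "s \<in> {1..l}" for s using bspec[OF Vh that] by (blast, metis, blast)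
  \<comment> \<open>Positivity of \<open>K\<close> requires a nonzero weight among the indexed ones.
    As \<open>I \<noteq> 0\<close> there is a nonzero weight, and \<open>lam\<close> is chosen below
    so that \<open>W\<close> contains its eigenvector.\<close>
  have "\<exists>s\<in>{1..l}. \<exists>j\<in>{1..CARD('n)}. a s j \<noteq> 0"
  proof (rule ccontr)
    assume "\<not> ?thesis"
    then have "index CARD('n) l a = 0" by (simp add: index_def)
    then show False using ind I by simp
  qed
  then obtain s0 i0 where s0: "s0 \<in> {1..l}" "a s0 (idx (i0 :: 'n)) \<noteq> 0"
    unfolding range_idx[where 'n='n, symmetric] by blast
  define lam where "lam = complex_of_real (h s0 i0)"
  define S where "S s = {i. complex_of_real (h s i) = lam}" for s
  define W where "W = {v. H *v v = lam *s v}"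
  define k where "k = vec.dim W"
  have W: "W = {v. \<forall>i. i \<notin> S s \<longrightarrow> (conj_transpose (V s) *v v) $ i = 0}" if s: "s \<in> {1..l}" for s
    unfolding W_def HV[OF s, symmetric] diag_eigenvector_iff[OF V[OF s]] S_def by auto
  have cardS: "card (S s) = k" if s: "s \<in> {1..l}" for s
    using eigen_mult_diag_UNIV[OF V[OF s], of "\<lambda>i. complex_of_real (h s i)" lam]
    unfolding HV[OF s] by (simp add: eigen_mult_def k_def W_def S_def)
  have "i0 \<in> S s0" by (simp add: S_def lam_def)
  then have k1: "1 \<le> k" using cardS[OF s0(1)] by (metis One_nat_def Suc_leI card_gt_0_iff empty_iff finite)
  have "S s0 \<noteq> UNIV"
  proof
    assume "S s0 = UNIV"
    then have "(\<lambda>i. complex_of_real (h s0 i)) = (\<lambda>_. lam)" by (auto simp: S_def)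
    then have "H = V s0 ** dg (\<lambda>_. lam) ** conj_transpose (V s0)" using HV[OF s0(1)] by simp
    also have "\<dots> = dg (\<lambda>_. lam) ** (V s0 ** conj_transpose (V s0))"
    proof -
      have "V s0 ** dg (\<lambda>_. lam) = dg (\<lambda>_. lam) ** V s0" by (simp add: vec_eq_iff)
      then show ?thesis by (simp only: matrix_mul_assoc)
    qed
    also have "\<dots> = dg (\<lambda>_. lam)" using V[OF s0(1)] by simp
    finally show False using nonscalar by blast
  qed
  then have kn: "k < CARD('n)" using cardS[OF s0(1)] psubset_card_mono[of UNIV "S s0"] by auto
  define p where "p s = idx ` S s" for s
  have pI: "p \<in> index_sets CARD('n) l k"
    unfolding index_sets_def p_def using idx_range[where 'n='n] cardS by (auto simp: card_image inj_on_def)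
  have pind: "partial_index l p a = (\<Sum>s=1..l. \<Sum>i\<in>S s. a s (idx i))"
    unfolding partial_index_def p_def by (simp add: sum.reindex inj_on_def)
  obtain \<rho> :: "word set \<Rightarrow> complex^'n^'n" where \<rho>: "lagrangian_rep l \<rho>" "spectra l \<rho> = a"
      "\<forall>s\<in>{1..l}. \<rho> (gen l s) = holonomy Q a s"
    using rep_of_closed_chain[OF Q aw closed l] by blast
  have urep: "unitary_rep l \<rho>" using \<rho>(1) by (simp add: lagrangian_rep_def)
  have commute: "\<rho> (gen l s) ** H = H ** \<rho> (gen l s)" if s: "s \<in> {1..l}" for s
  proof -
    have "\<rho> (gen l s) = V s ** dg (\<lambda>i. cis (2 * pi * a s (idx i))) ** conj_transpose (V s)"
      using \<rho>(3) hol[OF s] s by simp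
    then show ?thesis unfolding HV[OF s, symmetric]
      using V[OF s] by (simp add: mult.commute flip: matrix_mul_assoc)
  qed
  have red: "reduction l \<rho> k W"
    unfolding reduction_def
  proof (intro conjI ballI)
    show "vec.subspace W" unfolding W_def
      by (auto simp: vec.subspace_def vec.add vec.scale vector_add_ldistrib vector_smult_assoc mult.commute matrix_vector_right_distrib)
    fix x assume "x \<in> carrier (Gamma l)"
    then have "unitary_matrix (\<rho> x)" "\<rho> x ** H = H ** \<rho> x"
      using rep_commutes[OF urep commute] by blast+
    then show "(*v) (\<rho> x) ` W \<subseteq> W" "(*v) (\<rho> x) ` (W\<^sup>\<bottom>) \<subseteq> W\<^sup>\<bottom>"
      unfolding W_def by (rule eigenspace_invariant)+
  qed (use k1 kn k_def in auto)
  have em: "eigen_mult (\<rho> (gen l s)) W c = card {j \<in> p s. cis (2 * pi * spectra l \<rho> s j) = c}"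
    if s: "s \<in> {1..l}" for s c
  proof -
    have "eigen_mult (\<rho> (gen l s)) W c = card {i \<in> S s. cis (2 * pi * a s (idx i)) = c}"
      using \<rho>(3) s unfolding W[OF s] by (simp add: hol[OF s] eigen_mult_diag[OF V[OF s]])
    also have "\<dots> = card {j \<in> p s. cis (2 * pi * a s j) = c}" unfolding p_def by (rule card_idx[symmetric])
    finally show ?thesis by (simp add: \<rho>(2))
  qed
  \<comment> \<open>The generators have product 1, hence determinant 1 on \<open>W\<close>. That
    determinant is also the product of all eigenvalues on \<open>W\<close>, whose argument is the
    partial index times \<open>2 * pi\<close>.\<close>
  have "\<exists>K :: int. partial_index l p a = of_int K"
  proof (rule cis_2pi_eq_1)
    define pr where "pr = V s0 ** dg (\<lambda>i. if i \<in> S s0 then 1 else 0) ** conj_transpose (V s0)"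
    have pr: "pr = V s ** dg (\<lambda>i. if i \<in> S s then 1 else 0) ** conj_transpose (V s)" if s: "s \<in> {1..l}" for s
      using diag_indicator_eq[OF V[OF s0(1)] V[OF s], of "\<lambda>i. complex_of_real (h s0 i)" "\<lambda>i. complex_of_real (h s i)"
          "\<lambda>x. if x = lam then 1 else 0"]
      unfolding pr_def by (simp add: HV[OF s] HV[OF s0(1)] S_def)
    have "pr ** pr = V s0 ** dg (\<lambda>i. (if i \<in> S s0 then 1 else 0) * (if i \<in> S s0 then 1 else 0)) ** conj_transpose (V s0)"
      unfolding pr_def using V[OF s0(1)] by (simp flip: matrix_mul_assoc)
    also have "(\<lambda>i. (if i \<in> S s0 then 1 else 0) * (if i \<in> S s0 then 1 else 0)) = (\<lambda>i. if i \<in> S s0 then 1 else 0 :: complex)"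
      by auto
    finally have pp: "pr ** pr = pr" by (simp only: pr_def)
    have "cnjm (mat 1 :: complex^'n^'n) = mat 1" by (simp add: vec_eq_iff mat_def)
    then have f1: "foldr (\<lambda>s x. holonomy Q a s ** x) [1..<Suc l] (mat 1) = mat 1"
      using foldr_holonomy[OF Q le_refl, where X = "mat 1" and a = a] closed by (simp del: upt_Suc)
    have "det (foldr (\<lambda>s x. holonomy Q a s ** x) [1..<Suc l] (mat 1) ** pr + (mat 1 - pr)) =
        (\<Prod>s\<leftarrow>[1..<Suc l]. \<Prod>i\<in>S s. cis (2 * pi * a s (idx i)))"
    proof -
      have "set [1..<Suc l] = {1..l}" by auto
      then show ?thesis
        using det_restrict_foldr[of "[1..<Suc l]" V "holonomy Q a" "\<lambda>s i. cis (2 * pi * a s (idx i))" pr S]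
          V hol pr pp by blast
    qed
    moreover have "mat 1 ** pr + (mat 1 - pr) = mat 1" by (simp add: algebra_simps)
    ultimately have "1 = (\<Prod>s\<leftarrow>[1..<Suc l]. \<Prod>i\<in>S s. cis (2 * pi * a s (idx i)))"
      unfolding f1 by (simp del: upt_Suc)
    also have "\<dots> = cis (\<Sum>s\<leftarrow>[1..<Suc l]. \<Sum>i\<in>S s. 2 * pi * a s (idx i))"
      by (simp only: prod_cis prod_list_cis)
    also have "(\<Sum>s\<leftarrow>[1..<Suc l]. \<Sum>i\<in>S s. 2 * pi * a s (idx i)) = (\<Sum>s=1..l. \<Sum>i\<in>S s. 2 * pi * a s (idx i))"
      by (simp only: interv_sum_list_conv_sum_set_nat set_upt atLeastLessThanSuc_atLeastAtMost)
    also have "\<dots> = 2 * pi * partial_index l p a" by (simp only: pind sum_distrib_left)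
    finally show "cis (2 * pi * partial_index l p a) = 1" by (rule HOL.sym)
  qed
  then obtain K :: int where K: "partial_index l p a = of_int K" ..
  have "0 < a s0 (idx i0)" using nonneg[OF s0(1), of i0] s0(2) by simp
  also have "a s0 (idx i0) \<le> (\<Sum>i\<in>S s0. a s0 (idx i))"
    using nonneg[OF s0(1)] \<open>i0 \<in> S s0\<close> by (intro member_le_sum) auto
  also have "\<dots> \<le> partial_index l p a"
    unfolding pind using s0(1) nonneg by (intro member_le_sum[of s0 _ "\<lambda>s. \<Sum>i\<in>S s. a s (idx i)"] sum_nonneg) auto
  finally have "0 < K" using K by simp
  have "compatible l \<rho> k K p"
    unfolding compatible_def using pI red em K \<rho>(2) by auto
  \<comment> \<open>The stratum of \<open>a\<close> itself serves as the witness for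
    \<open>m'\<close> and \<open>z'\<close>.\<close>
  then have "wall_fun l p K \<in> inner_wall_funs TYPE('n) I l"
    unfolding inner_wall_funs_def using \<open>0 < K\<close> stratum urep interior \<rho>(2) by blast
  moreover have "wall_fun l p K a = 0" by (simp add: wall_fun_def K)
  ultimately show ?thesis unfolding inner_walls_def using aP by blast
qed

section \<open>Chains of maximal trace\<close>

text \<open>Twice the Hermitian \<open>B\<close> in the decomposition \<open>G = A + \<i> B\<close>
  with \<open>A\<close> and \<open>B\<close> Hermitian.\<close>

definition defect :: "complex^'n^'n \<Rightarrow> complex^'n^'n" where
  "defect G = (\<chi> i j. - \<i> * (G $ i $ j - cnj (G $ j $ i)))"

lemma defect_nth [simp]: "defect G $ i $ j = - \<i> * (G $ i $ j - cnj (G $ j $ i))"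
  by (simp add: defect_def)

lemma conj_transpose_defect: "conj_transpose (defect G) = defect G"
  by (simp add: vec_eq_iff algebra_simps)

section \<open>First variation of the trace of a chain\<close>

lemma matrix_diff_mult_distrib:
  fixes A B :: "complex^'n^'m"
  shows "(A - B) ** C = A ** C - B ** C"
  by (simp add: vec_eq_iff matrix_matrix_mult_def algebra_simps sum_subtractf)

lemma matrix_mult_diff_distrib:
  fixes B C :: "complex^'n^'m"
  shows "A ** (B - C) = A ** B - A ** C"
  by (simp add: vec_eq_iff matrix_matrix_mult_def algebra_simps sum_subtractf)

lemma dg_const_commute: "dg (\<lambda>_. c) ** A = A ** (dg (\<lambda>_. c) :: complex^'n^'n)"
  by (simp add: vec_eq_iff)

lemma defect_eq: "defect G = dg (\<lambda>_. - \<i>) ** (G - conj_transpose G)"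
  by (simp add: vec_eq_iff)

lemma defect_conj:
  "conj_transpose C ** defect G ** C = defect (conj_transpose C ** G ** C)"
proof -
  have "conj_transpose C ** defect G ** C = dg (\<lambda>_. - \<i>) ** (conj_transpose C ** (G - conj_transpose G) ** C)"
    unfolding defect_eq matrix_mul_assoc by (simp only: dg_const_commute)
  also have "conj_transpose C ** (G - conj_transpose G) ** C =
      conj_transpose C ** G ** C - conj_transpose (conj_transpose C ** G ** C)"
    by (simp add: matrix_diff_mult_distrib matrix_mult_diff_distrib conj_transpose_mult matrix_mul_assoc)
  finally show ?thesis unfolding defect_eq .
qed

text \<open>Every partial chain from position \<open>t\<close> on acquires the same left factor, a
  conjugate of \<open>R\<close>. This reduces the variation of one \<open>Q t\<close> to the trace
  of a fixed matrix times a rotation.\<close>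

lemma chain_update:
  fixes Q :: "nat \<Rightarrow> complex^'n^'n"
  assumes Q: "\<And>s. s \<in> {1..l} \<Longrightarrow> real_orth (Q s)" and t: "t \<in> {1..l}" and s: "t \<le> s" "s \<le> l"
  shows "chain (Q(t := Q t ** R)) a s = chain Q a t ** R ** conj_transpose (chain Q a t) ** chain Q a s"
proof -
  have below: "r < t \<Longrightarrow> chain (Q(t := Q t ** R)) a r = chain Q a r" for r
    by (induction r) auto
  obtain u where u: "t = Suc u" using t by (cases t) auto
  have un: "unitary_matrix (chain Q a t)" using unitary_chain[OF Q, where t = t and a = a] t by auto
  show ?thesis using s
  proof (induction s rule: dec_induct)
    case base
    have *: "chain (Q(t := Q t ** R)) a t = chain Q a t ** R"
      using below[of u] by (simp add: u matrix_mul_assoc)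
    show ?case unfolding * using un by (simp flip: matrix_mul_assoc)
  next
    case (step s)
    then show ?case by (simp add: matrix_mul_assoc)
  qed
qed

lemma Re_trace_mult_givens:
  fixes M :: "complex^'n^'n"
  assumes "p \<noteq> q"
  shows "Re (trace (M ** givens p q \<theta>)) = Re (trace M) +
    Re (M $ p $ p + M $ q $ q) * (cos \<theta> - 1) + Re (M $ p $ q - M $ q $ p) * sin \<theta>"
proof -
  have "(M ** givens p q \<theta>) $ i $ i = M $ i $ i" if "i \<in> UNIV - {p, q}" for i
    using that assms by (simp add: mult_givens_nth)
  then have "sum (\<lambda>i. (M ** givens p q \<theta>) $ i $ i) (UNIV - {p, q}) = sum (\<lambda>i. M $ i $ i) (UNIV - {p, q})"
    by (intro sum.cong HOL.refl) blast
  then show ?thesis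
    unfolding trace_def sum_two[OF assms] using assms
    by (simp add: mult_givens_nth algebra_simps)
qed

text \<open>
  Rotating the \<open>t\<close>-th factor of a chain \<open>G\<close> of maximal trace shows that the real part of
  \<open>C\<^sup>* G C\<close> is symmetric, where \<open>C\<close> is the partial chain of length \<open>t\<close>. For \<open>t = 0\<close> the claim is that
  for \<open>t = l\<close>, where \<open>C = G\<close>.
\<close>

lemma realmat_defect_of_maximal_trace:
  fixes Q :: "nat \<Rightarrow> complex^'n^'n"
  assumes Q: "\<And>s. real_orth (Q s)" and l: "l \<ge> 1" and t: "t \<le> l"
    and max: "\<And>Q' :: nat \<Rightarrow> complex^'n^'n. (\<And>s. real_orth (Q' s)) \<Longrightarrow> Re (trace (chain Q' a l)) \<le> Re (trace (chain Q a l))"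
  shows "realmat (conj_transpose (chain Q a t) ** defect (chain Q a l) ** chain Q a t)"
proof -
  define G where "G = chain Q a l"
  have uG: "unitary_matrix G" unfolding G_def using unitary_chain[where l = l] Q by blast
  have *: "realmat (defect (conj_transpose (chain Q a t) ** G ** chain Q a t))" if t: "t \<in> {1..l}" for t
  proof -
    define C where "C = chain Q a t"
    define M where "M = conj_transpose C ** G ** C"
    have uC: "unitary_matrix C" unfolding C_def using unitary_chain[where l = l] Q t by auto
    have "Re (M $ p $ q) = Re (M $ q $ p)" if "p \<noteq> q" for p q
    proof -
      have "Re (M $ p $ p + M $ q $ q) * cos \<theta> + Re (M $ p $ q - M $ q $ p) * sin \<theta> \<le> Re (M $ p $ p + M $ q $ q)" for \<theta>
      proof -
        define R :: "complex^'n^'n" where "R = givens p q \<theta>"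
        have "real_orth R" unfolding R_def by (rule real_orth_givens[OF that])
        then have ro: "real_orth ((Q(t := Q t ** R)) s)" for s
          using Q by (auto intro: real_orth_mult)
        have "Re (trace (chain (Q(t := Q t ** R)) a l)) \<le> Re (trace G)"
          unfolding G_def by (rule max) (rule ro)
        moreover have "chain (Q(t := Q t ** R)) a l = C ** R ** conj_transpose C ** G"
          unfolding C_def G_def using Q t by (intro chain_update) auto
        moreover have "trace (C ** R ** conj_transpose C ** G) = trace (M ** R)"
        proof -
          have "trace ((C ** R) ** (conj_transpose C ** G)) = trace ((conj_transpose C ** G) ** (C ** R))"
            by (rule trace_mul_sym)
          then show ?thesis by (simp only: M_def matrix_mul_assoc)
        qed
        moreover have "trace M = trace G"
        proof -
          have "trace M = trace (C ** (conj_transpose C ** G))"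
            unfolding M_def by (rule trace_mul_sym)
          then show ?thesis using uC by simp
        qed
        ultimately have "Re (M $ p $ p + M $ q $ q) * (cos \<theta> - 1) + Re (M $ p $ q - M $ q $ p) * sin \<theta> \<le> 0"
          using Re_trace_mult_givens[OF that, of M \<theta>] unfolding R_def by simp
        then show ?thesis by (simp add: algebra_simps)
      qed
      then have "Re (M $ p $ q - M $ q $ p) = 0" by (rule sinusoid_max_at_0)
      then show ?thesis by simp
    qed
    \<comment> \<open>Up to sign, the imaginary part of an entry of \<open>defect M\<close> is the
      difference of two mirrored real parts of \<open>M\<close>.\<close>
    then have "Re (M $ p $ q) = Re (M $ q $ p)" for p q by (cases "p = q") auto
    then show ?thesis unfolding M_def[symmetric] C_def[symmetric] by (simp add: realmat_def)
  qed
  have "realmat (defect (conj_transpose (chain Q a t) ** G ** chain Q a t))"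
  proof (cases "t = 0")
    case True
    have "realmat (defect (conj_transpose G ** G ** G))" using *[of l] l by (simp add: G_def)
    then show ?thesis using uG True by simp
  qed (use * t in auto)
  then show ?thesis by (simp only: defect_conj G_def)
qed

text \<open>Squaring removes the signs of the real orthogonal factors and doubles the halved angles,
  which then add up to an integer multiple of \<open>2 * pi\<close>.\<close>

lemma det_chain_sq:
  fixes Q :: "nat \<Rightarrow> complex^'n^'n"
  assumes Q: "\<And>s. real_orth (Q s)" and ind: "index CARD('n) l a = of_int I"
  shows "det (chain Q a l) * det (chain Q a l) = 1"
proof -
  have "det (chain Q a t) * det (chain Q a t) = cis (- 2 * pi * (\<Sum>s=1..t. \<Sum>j=1..CARD('n). a s j))" for t
  proof (induction t)
    case (Suc t)
    have "det (phase (a (Suc t)) :: complex^'n^'n) = cis (- pi * (\<Sum>j=1..CARD('n). a (Suc t) j))"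
      unfolding phase_def det_dg prod_cis sum_distrib_left sum_idx[symmetric] ..
    then have "det (chain Q a (Suc t)) * det (chain Q a (Suc t)) = (det (chain Q a t) * det (chain Q a t)) *
        (cis (- pi * (\<Sum>j=1..CARD('n). a (Suc t) j)) * cis (- pi * (\<Sum>j=1..CARD('n). a (Suc t) j))) *
        (det (Q (Suc t)) * det (Q (Suc t)))"
      by (simp add: det_mul)
    then show ?case unfolding Suc.IH det_real_orth[OF Q] by (simp add: cis_mult algebra_simps)
  qed simp
  from this[of l] have "det (chain Q a l) * det (chain Q a l) = cis (- 2 * pi * of_int I)"
    using ind by (simp add: index_def)
  also have "\<dots> = 1"
    using cos_int_2pin[of I] sin_int_2pin[of I] by (simp add: complex_eq_iff)
  finally show ?thesis .
qed

text \<open>No diagonal entry has real part above 1, so all of these real parts equal 1. Unit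
  columns then leave nothing for the other entries or for the imaginary parts.\<close>

lemma unitary_Re_trace_ge:
  fixes G :: "complex^'n^'n"
  assumes u: "unitary_matrix G" and tr: "Re (trace G) \<ge> of_nat CARD('n)"
  shows "G = mat 1"
proof -
  have le: "Re (G $ i $ i) \<le> 1" for i
    using unitary_entry_bound[OF u, of i i] complex_Re_le_cmod[of "G $ i $ i"] by linarith
  have "(\<Sum>i\<in>UNIV. 1 - Re (G $ i $ i)) = of_nat CARD('n) - Re (trace G)"
    by (simp add: sum_subtractf trace_def)
  then have "(\<Sum>i\<in>UNIV. 1 - Re (G $ i $ i)) \<le> 0" using tr by simp
  moreover have "(\<Sum>i\<in>UNIV. 1 - Re (G $ i $ i)) \<ge> 0" using le by (intro sum_nonneg) simp
  ultimately have "(\<Sum>i\<in>UNIV. 1 - Re (G $ i $ i)) = 0" by simp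
  then have "\<forall>i\<in>UNIV. 1 - Re (G $ i $ i) = 0" using le by (subst (asm) sum_nonneg_eq_0_iff) auto
  then have one: "Re (G $ i $ i) = 1" for i by simp
  have zero: "G $ i $ j = 0" if "i \<noteq> j" for i j
  proof -
    have "(conj_transpose G ** G) $ j $ j = 1" using u by (simp add: mat_def)
    then have "(\<Sum>k\<in>UNIV. G $ k $ j * cnj (G $ k $ j)) = 1"
      by (simp add: matrix_matrix_mult_def mult.commute)
    then have "(\<Sum>k\<in>UNIV. complex_of_real ((cmod (G $ k $ j))\<^sup>2)) = 1"
      by (simp only: complex_norm_square)
    then have "(\<Sum>k\<in>UNIV. (cmod (G $ k $ j))\<^sup>2) = 1"
      by (metis of_real_sum of_real_eq_1_iff)
    moreover have "(\<Sum>k\<in>{i, j}. (cmod (G $ k $ j))\<^sup>2) \<le> (\<Sum>k\<in>UNIV. (cmod (G $ k $ j))\<^sup>2)"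
      by (rule sum_mono2) auto
    moreover have "1 \<le> (cmod (G $ j $ j))\<^sup>2"
    proof -
      have "1 \<le> cmod (G $ j $ j)" using complex_Re_le_cmod[of "G $ j $ j"] one[of j] by simp
      then show ?thesis by (rule one_le_power)
    qed
    moreover have "(\<Sum>k\<in>{i, j}. (cmod (G $ k $ j))\<^sup>2) = (cmod (G $ i $ j))\<^sup>2 + (cmod (G $ j $ j))\<^sup>2"
      using that by simp
    ultimately have "(cmod (G $ i $ j))\<^sup>2 \<le> 0" by linarith
    then show ?thesis by simp
  qed
  have "G $ i $ i = 1" for i
  proof -
    have "(cmod (G $ i $ i))\<^sup>2 \<le> 1"
      using unitary_entry_bound[OF u, of i i] by (simp add: power_le_one)
    then have "(Im (G $ i $ i))\<^sup>2 \<le> 0" by (simp add: cmod_power2 one)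
    then show ?thesis by (simp add: complex_eq_iff one)
  qed
  then show ?thesis using zero by (auto simp: vec_eq_iff mat_def)
qed

section \<open>Compactness of the parameter space and existence of a maximum\<close>

lemma compact_real_orth_families:
  "compact {Q :: nat \<Rightarrow> complex^'n^'n. \<forall>s. real_orth (Q s)}"
proof -
  have "compactin (product_topology (\<lambda>_. euclidean) UNIV) (PiE UNIV (\<lambda>_ :: nat. {Q :: complex^'n^'n. real_orth Q}))"
    by (subst compactin_PiE) (simp add: compact_real_orth)
  then show ?thesis by (simp add: euclidean_product_topology PiE_UNIV_domain Pi_def)
qed

lemma trace_maximum_exists:
  fixes a :: "nat \<Rightarrow> nat \<Rightarrow> real"
  obtains Q :: "nat \<Rightarrow> complex^'n^'n" where "\<And>s. real_orth (Q s)"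
    "\<And>Q' :: nat \<Rightarrow> complex^'n^'n. (\<And>s. real_orth (Q' s)) \<Longrightarrow> Re (trace (chain Q' a l)) \<le> Re (trace (chain Q a l))"
proof -
  have "continuous_on UNIV (\<lambda>Q. chain Q a t)" for t
    by (induction t) (auto intro!: continuous_intros)
  then have "continuous_on UNIV (\<lambda>Q :: nat \<Rightarrow> complex^'n^'n. Re (trace (chain Q a l)))"
    by (intro continuous_intros)
  then have cont: "continuous_on {Q. \<forall>s. real_orth (Q s)} (\<lambda>Q :: nat \<Rightarrow> complex^'n^'n. Re (trace (chain Q a l)))"
    by (rule continuous_on_subset) simp
  have "(\<lambda>_. mat 1) \<in> {Q :: nat \<Rightarrow> complex^'n^'n. \<forall>s. real_orth (Q s)}" by simp
  then have "{Q :: nat \<Rightarrow> complex^'n^'n. \<forall>s. real_orth (Q s)} \<noteq> {}"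
    by (subst ex_in_conv[symmetric], intro exI[of _ "\<lambda>_. mat 1"])
  from continuous_attains_sup[OF compact_real_orth_families this cont] obtain Q :: "nat \<Rightarrow> complex^'n^'n" where "Q \<in> {Q. \<forall>s. real_orth (Q s)}"
      "\<forall>Q' \<in> {Q :: nat \<Rightarrow> complex^'n^'n. \<forall>s. real_orth (Q s)}. Re (trace (chain Q' a l)) \<le> Re (trace (chain Q a l))"
    ..
  then show ?thesis using that by blast
qed

section \<open>The Lagrangian locus is open and closed off the walls\<close>

lemma tendsto_matrix_mult [tendsto_intros]:
  fixes f :: "'a \<Rightarrow> complex^'n^'m" and g :: "'a \<Rightarrow> complex^'k^'n"
  assumes "(f \<longlongrightarrow> A) F" "(g \<longlongrightarrow> B) F"
  shows "((\<lambda>x. f x ** g x) \<longlongrightarrow> A ** B) F"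
  unfolding matrix_matrix_mult_def
  by (intro tendsto_vec_lambda tendsto_sum tendsto_mult tendsto_vec_nth assms)

lemma tendsto_conj_transpose [tendsto_intros]:
  fixes f :: "'a \<Rightarrow> complex^'n^'m"
  assumes "(f \<longlongrightarrow> A) F"
  shows "((\<lambda>x. conj_transpose (f x)) \<longlongrightarrow> conj_transpose A) F"
proof -
  have "((\<lambda>x. conj_transpose (f x) $ i $ j) \<longlongrightarrow> conj_transpose A $ i $ j) F" for i j
    unfolding conj_transpose_nth by (intro tendsto_cnj tendsto_vec_nth assms)
  then show ?thesis by (intro vec_tendstoI)
qed

lemma tendsto_trace [tendsto_intros]:
  fixes f :: "'a \<Rightarrow> complex^'n^'n"
  assumes "(f \<longlongrightarrow> A) F"
  shows "((\<lambda>x. trace (f x)) \<longlongrightarrow> trace A) F"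
  unfolding trace_def by (intro tendsto_sum tendsto_vec_nth assms)

lemma tendsto_det [tendsto_intros]:
  fixes f :: "'a \<Rightarrow> complex^'n^'n"
  assumes "(f \<longlongrightarrow> A) F"
  shows "((\<lambda>x. det (f x)) \<longlongrightarrow> det A) F"
  unfolding det_def by (intro tendsto_sum tendsto_mult tendsto_prod tendsto_const tendsto_vec_nth assms)

lemma tendsto_dg [tendsto_intros]:
  assumes "\<And>i. ((\<lambda>x. f x i) \<longlongrightarrow> d i) F"
  shows "((\<lambda>x. dg (f x) :: complex^'n^'n) \<longlongrightarrow> dg d) F"
proof -
  have "((\<lambda>x. dg (f x) $ i $ j) \<longlongrightarrow> dg d $ i $ j) F" for i j
    using assms[of i] by (cases "i = j") simp_all
  then show ?thesis by (intro vec_tendstoI)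
qed

lemma tendsto_apply:
  fixes f :: "'a \<Rightarrow> 'b \<Rightarrow> 'c::topological_space"
  assumes "(f \<longlongrightarrow> L) F"
  shows "((\<lambda>x. f x s) \<longlongrightarrow> L s) F"
  using continuous_on_tendsto_compose[OF continuous_on_product_coordinates assms] by simp

lemma tendsto_chain:
  fixes Q :: "nat \<Rightarrow> nat \<Rightarrow> complex^'n^'n"
  assumes "\<And>s. (\<lambda>k. Q k s) \<longlonglongrightarrow> R s" "\<And>s j. (\<lambda>k. a k s j) \<longlonglongrightarrow> b s j"
  shows "(\<lambda>k. chain (Q k) (a k) t) \<longlonglongrightarrow> chain R b t"
proof (induction t)
  case (Suc t)
  have "(\<lambda>k. cis (- pi * a k (Suc t) (idx i))) \<longlonglongrightarrow> cis (- pi * b (Suc t) (idx i))" for i :: 'n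
    unfolding cis_conv_exp by (intro tendsto_intros assms)
  then show ?case unfolding chain.simps phase_def by (intro tendsto_intros Suc assms)
qed simp

lemma real_orth_families_subsequence:
  fixes Q :: "nat \<Rightarrow> nat \<Rightarrow> complex^'n^'n"
  assumes "\<And>k s. real_orth (Q k s)"
  obtains r R where "strict_mono r" "\<And>s. real_orth (R s)" "\<And>s. (\<lambda>k. Q (r k) s) \<longlonglongrightarrow> R s"
proof -
  have "\<forall>k. Q k \<in> {Q. \<forall>s. real_orth (Q s)}" using assms by simp
  then obtain R r where R: "R \<in> {Q. \<forall>s. real_orth (Q s)}" "strict_mono (r :: nat \<Rightarrow> nat)" "(Q \<circ> r) \<longlonglongrightarrow> R"
    using compact_imp_seq_compact[OF compact_real_orth_families] unfolding seq_compact_def by blast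
  have "(\<lambda>k. Q (r k) s) \<longlonglongrightarrow> R s" for s
    using tendsto_apply[OF R(3), of s] by simp
  then show ?thesis using that R(1,2) by blast
qed

lemma matrix_mult_scaleR:
  fixes B :: "complex^'n^'m"
  shows "A ** (x *\<^sub>R B) = x *\<^sub>R (A ** B)"
  by (simp add: vec_eq_iff matrix_matrix_mult_def scaleR_sum_right)

lemma scaleR_matrix_mult:
  fixes A :: "complex^'n^'m"
  shows "(x *\<^sub>R A) ** B = x *\<^sub>R (A ** B)"
  by (simp add: vec_eq_iff matrix_matrix_mult_def scaleR_sum_right)

lemma chain_cong:
  assumes "\<And>s. s \<in> {1..t} \<Longrightarrow> Q s = Q' s"
  shows "chain Q a t = chain Q' a t"
  using assms by (induction t) auto

lemma lagrangian_locus_closed_chain: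
  assumes "l \<ge> 1" "a \<in> lagrangian_locus TYPE('n::finite) I l m z"
  shows "\<exists>Q :: nat \<Rightarrow> complex^'n^'n. (\<forall>s. real_orth (Q s)) \<and> chain Q a l = mat 1"
proof -
  obtain Q :: "nat \<Rightarrow> complex^'n^'n" where Q: "\<forall>s\<in>{1..l}. real_orth (Q s)" "chain Q a l = mat 1"
    using assms by (auto simp: lagrangian_locus_iff)
  \<comment> \<open>Padding with the identity puts the family into the compact set of all real
    orthogonal sequences.\<close>
  define Q' where "Q' s = (if s \<in> {1..l} then Q s else mat 1)" for s
  have "chain Q' a l = mat 1"
    using Q(2) chain_cong[of l Q' Q a] by (simp add: Q'_def)
  moreover have "real_orth (Q' s)" for s using Q(1) by (simp add: Q'_def)
  ultimately show ?thesis by (intro exI[of _ Q'] conjI allI)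
qed

text \<open>The families that close the chains have a convergent subsequence, and the closing
  equation passes to the limit.\<close>

lemma lagrangian_locus_limit:
  assumes l: "l \<ge> 1" and a: "\<And>k. a k \<in> lagrangian_locus TYPE('n::finite) I l m z"
    and lim: "a \<longlonglongrightarrow> b" and b: "b \<in> P I l CARD('n) m z"
  shows "b \<in> lagrangian_locus TYPE('n) I l m z"
proof -
  have "\<forall>k. \<exists>Q :: nat \<Rightarrow> complex^'n^'n. (\<forall>s. real_orth (Q s)) \<and> chain Q (a k) l = mat 1"
    using lagrangian_locus_closed_chain[OF l a] by (rule allI)
  from choice[OF this] obtain Q :: "nat \<Rightarrow> nat \<Rightarrow> complex^'n^'n" where
    Q: "\<forall>k. (\<forall>s. real_orth (Q k s)) \<and> chain (Q k) (a k) l = mat 1" ..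
  obtain r R where R: "strict_mono r" "\<And>s. real_orth (R s)" "\<And>s. (\<lambda>k. Q (r k) s) \<longlonglongrightarrow> R s"
    using real_orth_families_subsequence[of Q] Q by auto
  have "(\<lambda>k. a (r k) s j) \<longlonglongrightarrow> b s j" for s j
    using LIMSEQ_subseq_LIMSEQ[OF tendsto_apply[OF tendsto_apply[OF lim]] R(1)] by (simp add: o_def)
  then have "(\<lambda>k. chain (Q (r k)) (a (r k)) l) \<longlonglongrightarrow> chain R b l"
    by (intro tendsto_chain R(3))
  then have "(\<lambda>k. mat 1) \<longlonglongrightarrow> chain R b l" using Q by simp
  then have "mat 1 = chain R b l" by (rule LIMSEQ_unique[OF tendsto_const])
  then show ?thesis
    unfolding lagrangian_locus_iff[OF l] using R(2) b by (intro conjI exI[of _ R]) auto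
qed

text \<open>
  If \<open>G - G\<^sup>*\<close> is a scalar, so is \<open>(G + G\<^sup>*)\<^sup>2 = (G - G\<^sup>*)\<^sup>2 + 4\<close>. For \<open>G\<close> close to the identity the only
  square root of the latter that is close to 2 is itself a scalar.
\<close>

lemma eventually_eq_1_of_scalar_defect:
  fixes G :: "nat \<Rightarrow> complex^'n^'n"
  assumes u: "\<And>k. unitary_matrix (G k)" and lim: "G \<longlonglongrightarrow> mat 1"
    and det: "\<And>k. det (G k) * det (G k) = 1"
  shows "\<forall>\<^sub>F k in sequentially. (\<exists>c. defect (G k) = dg (\<lambda>_. c)) \<longrightarrow> G k = mat 1"
proof -
  \<comment> \<open>Any diagonal position will do for reading off the scalar.\<close>
  define i0 where "i0 = (undefined :: 'n)"
  define c where "c k = defect (G k) $ i0 $ i0" for k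
  define r where "r k = csqrt (4 - c k * c k)" for k
  define w where "w k = (r k + \<i> * c k) / 2" for k
  define X where "X k = G k + conj_transpose (G k)" for k
  have "c \<longlonglongrightarrow> - \<i> * (mat 1 $ i0 $ i0 - cnj ((mat 1 :: complex^'n^'n) $ i0 $ i0))"
    unfolding c_def defect_nth by (intro tendsto_intros lim)
  then have c: "c \<longlonglongrightarrow> 0" by (simp add: mat_def)
  have "r \<longlonglongrightarrow> csqrt (4 - 0 * 0)"
    unfolding r_def
    by (intro isCont_tendsto_compose[OF continuous_at_csqrt] tendsto_intros c) (auto simp: complex_nonpos_Reals_iff)
  moreover have "csqrt 4 = 2"
    by (rule csqrt_unique) auto
  ultimately have r: "r \<longlonglongrightarrow> 2" by simp
  have "w \<longlonglongrightarrow> (2 + \<i> * 0) / 2" unfolding w_def by (intro tendsto_intros r c) simp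
  then have w: "w \<longlonglongrightarrow> 1" by simp
  \<comment> \<open>Once \<open>G k\<close> is the scalar \<open>w k\<close>, the condition on the
    squared determinant makes \<open>w k\<close> a root of unity. The roots other than 1 form a
    finite set, which \<open>w k\<close> eventually avoids as it tends to 1.\<close>
  define Z where "Z = {z :: complex. z ^ (2 * CARD('n)) = 1} - {1}"
  have "finite Z" unfolding Z_def by (intro finite_Diff finite_roots_unity) simp
  then have "open (- Z)" by (simp add: finite_imp_closed open_Compl)
  then have evw: "\<forall>\<^sub>F k in sequentially. w k \<in> - Z"
    by (rule topological_tendstoD[OF w]) (simp add: Z_def)
  have "(\<lambda>k. det (X k + dg (\<lambda>_. r k))) \<longlonglongrightarrow> det (mat 1 + conj_transpose (mat 1) + dg (\<lambda>_. 2) :: complex^'n^'n)"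
    unfolding X_def by (intro tendsto_intros lim r)
  moreover have "mat 1 + conj_transpose (mat 1) + dg (\<lambda>_. 2) = (dg (\<lambda>_. 4) :: complex^'n^'n)"
    by (simp add: vec_eq_iff mat_def)
  ultimately have "(\<lambda>k. det (X k + dg (\<lambda>_. r k))) \<longlonglongrightarrow> 4 ^ CARD('n)" by simp
  then have evd: "\<forall>\<^sub>F k in sequentially. det (X k + dg (\<lambda>_. r k)) \<noteq> 0"
    by (rule tendsto_imp_eventually_ne) simp
  show ?thesis using evw evd
  proof eventually_elim
    case (elim k)
    show ?case
    proof
      assume "\<exists>c. defect (G k) = dg (\<lambda>_. c)"
      then obtain d where d: "defect (G k) = dg (\<lambda>_. d)" ..
      then have dc: "d = c k" by (simp add: c_def del: defect_nth)
      have D: "G k - conj_transpose (G k) = dg (\<lambda>_. \<i> * c k)"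
      proof -
        have "G k - conj_transpose (G k) = dg (\<lambda>_. \<i>) ** defect (G k)"
          by (simp add: defect_eq) (simp add: vec_eq_iff)
        then show ?thesis by (simp add: d dc)
      qed
      have "X k ** X k = (G k - conj_transpose (G k)) ** (G k - conj_transpose (G k)) + dg (\<lambda>_. 4)"
      proof -
        have "dg (\<lambda>_. 4) = mat 1 + mat 1 + mat 1 + (mat 1 :: complex^'n^'n)"
          by (simp add: vec_eq_iff mat_def)
        then show ?thesis
          unfolding X_def using u[of k]
          by (simp add: matrix_add_ldistrib matrix_add_mult_distrib matrix_diff_mult_distrib matrix_mult_diff_distrib)
      qed
      also have "\<dots> = dg (\<lambda>_. 4 - c k * c k)"
        unfolding D by (simp add: vec_eq_iff algebra_simps)
      also have "\<dots> = dg (\<lambda>_. r k) ** dg (\<lambda>_. r k)"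
        by (simp add: r_def flip: power2_eq_square)
      \<comment> \<open>A difference of two squares factors because one of the matrices is scalar.
        The second factor tends to the scalar 4, so it is eventually invertible and the first factor
        vanishes.\<close>
      finally have "(X k - dg (\<lambda>_. r k)) ** (X k + dg (\<lambda>_. r k)) = 0"
        by (simp add: matrix_add_ldistrib matrix_diff_mult_distrib dg_const_commute[of _ "X k"])
      then have *: "(X k - dg (\<lambda>_. r k)) ** ((X k + dg (\<lambda>_. r k)) ** B) = 0 ** B" for B :: "complex^'n^'n"
        by (simp only: matrix_mul_assoc)
      obtain B where "(X k + dg (\<lambda>_. r k)) ** B = mat 1"
        using elim(2) invertible_det_nz[of "X k + dg (\<lambda>_. r k)"] unfolding invertible_def by blast
      with *[of B] have "(X k - dg (\<lambda>_. r k)) ** mat 1 = 0 ** B" by (simp only:)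
      moreover have "0 ** B = 0" by (simp add: vec_eq_iff matrix_matrix_mult_def)
      ultimately have "X k = dg (\<lambda>_. r k)" by simp
      then have "G k + conj_transpose (G k) = dg (\<lambda>_. r k)" by (simp only: X_def)
      then have GG: "G k $ i $ j + cnj (G k $ j $ i) = (if i = j then r k else 0)"
        "G k $ i $ j - cnj (G k $ j $ i) = (if i = j then \<i> * c k else 0)" for i j
        using D by (simp_all add: vec_eq_iff)
      have "G k $ i $ j = (if i = j then w k else 0)" for i j
      proof -
        have "G k $ i $ j = ((G k $ i $ j + cnj (G k $ j $ i)) + (G k $ i $ j - cnj (G k $ j $ i))) / 2"
          by simp
        also have "\<dots> = (if i = j then w k else 0)" unfolding GG by (simp add: w_def)
        finally show ?thesis .
      qed
      then have Gw: "G k = dg (\<lambda>_. w k)" by (simp add: vec_eq_iff)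
      have "w k ^ CARD('n) * w k ^ CARD('n) = 1" using det[of k] by (simp add: Gw)
      then have "w k ^ (2 * CARD('n)) = 1" by (simp add: mult_2 power_add)
      then have "w k = 1" using elim(1) by (simp add: Z_def)
      then show "G k = mat 1" by (simp add: Gw dg_1)
    qed
  qed
qed

text \<open>This is openness in sequential form. If the whole sequence avoided the locus, the
  traceless defects of chains of maximal trace would be eventually nonzero, and a limit of their
  normalisations would be a nonscalar symmetry of a closed chain for \<open>b\<close>.\<close>

lemma lagrangian_near:
  fixes a :: "nat \<Rightarrow> nat \<Rightarrow> nat \<Rightarrow> real"
  assumes l: "l \<ge> 1" and stratum: "is_stratum CARD('n::finite) l m z" and I: "I \<noteq> 0"
    and b: "b \<in> lagrangian_locus TYPE('n) I l m z"
    and interior: "b \<in> top_of_set (P I l CARD('n) m z) interior_of unitary_locus TYPE('n) I l m z"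
    and wall: "b \<notin> inner_walls TYPE('n) I l m z"
    and lim: "a \<longlonglongrightarrow> b" and a: "\<And>k. a k \<in> P I l CARD('n) m z"
  shows "\<exists>k. a k \<in> lagrangian_locus TYPE('n) I l m z"
proof (rule ccontr)
  assume no: "\<not> ?thesis"
  have bP: "b \<in> P I l CARD('n) m z" using b by (simp add: lagrangian_locus_def)
  have "\<forall>k. \<exists>Q :: nat \<Rightarrow> complex^'n^'n. (\<forall>s. real_orth (Q s)) \<and>
      (\<forall>Q' :: nat \<Rightarrow> complex^'n^'n. (\<forall>s. real_orth (Q' s)) \<longrightarrow> Re (trace (chain Q' (a k) l)) \<le> Re (trace (chain Q (a k) l)))"
  proof
    fix k
    obtain Q :: "nat \<Rightarrow> complex^'n^'n" where Q: "\<And>s. real_orth (Q s)"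
      "\<And>Q' :: nat \<Rightarrow> complex^'n^'n. (\<And>s. real_orth (Q' s)) \<Longrightarrow> Re (trace (chain Q' (a k) l)) \<le> Re (trace (chain Q (a k) l))"
      using trace_maximum_exists[of "a k" l] by blast
    show "\<exists>Q :: nat \<Rightarrow> complex^'n^'n. (\<forall>s. real_orth (Q s)) \<and>
      (\<forall>Q' :: nat \<Rightarrow> complex^'n^'n. (\<forall>s. real_orth (Q' s)) \<longrightarrow> Re (trace (chain Q' (a k) l)) \<le> Re (trace (chain Q (a k) l)))"
      using Q by (intro exI[of _ Q] conjI allI impI) auto
  qed
  from choice[OF this] obtain Qm :: "nat \<Rightarrow> nat \<Rightarrow> complex^'n^'n" where
    Qm: "\<forall>k. (\<forall>s. real_orth (Qm k s)) \<and>
      (\<forall>Q' :: nat \<Rightarrow> complex^'n^'n. (\<forall>s. real_orth (Q' s)) \<longrightarrow> Re (trace (chain Q' (a k) l)) \<le> Re (trace (chain (Qm k) (a k) l)))" ..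
  obtain r R where R: "strict_mono r" "\<And>s. real_orth (R s)" "\<And>s. (\<lambda>k. Qm (r k) s) \<longlonglongrightarrow> R s"
    using real_orth_families_subsequence[of Qm] Qm by auto
  define q where "q k = Qm (r k)" for k
  define c where "c k = a (r k)" for k
  have q: "real_orth (q k s)" for k s using Qm by (simp add: q_def)
  have max: "Re (trace (chain Q' (c k) l)) \<le> Re (trace (chain (q k) (c k) l))"
    if "\<And>s. real_orth (Q' s)" for k and Q' :: "nat \<Rightarrow> complex^'n^'n"
    using Qm that by (simp add: q_def c_def)
  have qR: "(\<lambda>k. q k s) \<longlonglongrightarrow> R s" for s using R(3) by (simp add: q_def)
  have cb: "(\<lambda>k. c k s j) \<longlonglongrightarrow> b s j" for s j
    using LIMSEQ_subseq_LIMSEQ[OF tendsto_apply[OF tendsto_apply[OF lim]] R(1)] by (simp add: o_def c_def)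
  have cP: "c k \<in> P I l CARD('n) m z" and cL: "c k \<notin> lagrangian_locus TYPE('n) I l m z" for k
    using a no by (auto simp: c_def)
  define G where "G k = chain (q k) (c k) l" for k
  have uG: "unitary_matrix (G k)" for k
    unfolding G_def using unitary_chain[where l = l and t = l] q by blast
  \<comment> \<open>Each maximal chain is compared with the one built from the factors
    \<open>Q0\<close> that close at \<open>b\<close>. In the limit the trace is at least that of the
    identity.\<close>
  have G1: "chain R b l = mat 1"
  proof -
    obtain Q0 :: "nat \<Rightarrow> complex^'n^'n" where Q0: "\<forall>s. real_orth (Q0 s)" "chain Q0 b l = mat 1"
      using lagrangian_locus_closed_chain[OF l b] by blast
    have "(\<lambda>k. Re (trace (chain Q0 (c k) l))) \<longlonglongrightarrow> Re (trace (chain Q0 b l))"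
      by (intro tendsto_intros tendsto_chain cb)
    moreover have "(\<lambda>k. Re (trace (G k))) \<longlonglongrightarrow> Re (trace (chain R b l))"
      unfolding G_def by (intro tendsto_intros tendsto_chain cb qR)
    moreover have "Re (trace (chain Q0 (c k) l)) \<le> Re (trace (G k))" for k
      unfolding G_def by (rule max) (use Q0(1) in blast)
    ultimately have "Re (trace (chain Q0 b l)) \<le> Re (trace (chain R b l))"
      by (intro LIMSEQ_le) auto
    then have "Re (trace (mat 1 :: complex^'n^'n)) \<le> Re (trace (chain R b l))" by (simp only: Q0(2))
    then have "of_nat CARD('n) \<le> Re (trace (chain R b l))" by (simp add: trace_def mat_def)
    moreover have "unitary_matrix (chain R b l)"
      using unitary_chain[where l = l and t = l] R(2) by blast
    ultimately show ?thesis by (intro unitary_Re_trace_ge)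
  qed
  have "G \<longlonglongrightarrow> chain R b l" unfolding G_def by (intro tendsto_chain cb qR)
  then have Glim: "G \<longlonglongrightarrow> mat 1" by (simp only: G1)
  \<comment> \<open>The trace part is a real scalar, so removing it keeps \<open>H k\<close>
    Hermitian and real along the chain. Being traceless, a scalar limit would have to
    vanish.\<close>
  define \<tau> where "\<tau> k = trace (defect (G k)) / of_nat CARD('n)" for k
  define H where "H k = defect (G k) - dg (\<lambda>_. \<tau> k)" for k
  have tr: "trace (defect (G k)) = of_real (Re (trace (defect (G k))))" for k
    by (simp add: complex_eq_iff trace_def)
  have \<tau>: "\<tau> k = of_real (Re (\<tau> k))" for k
    unfolding \<tau>_def by (subst (1 2) tr) (simp add: complex_eq_iff)
  have trH: "trace (H k) = 0" for k
    by (simp add: H_def \<tau>_def trace_def sum_subtractf)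
  have hermH: "conj_transpose (H k) = H k" for k
  proof -
    have "conj_transpose (H k) = conj_transpose (defect (G k)) - conj_transpose (dg (\<lambda>_. \<tau> k))"
      by (simp add: H_def vec_eq_iff)
    also have "conj_transpose (dg (\<lambda>_. \<tau> k)) = (dg (\<lambda>_. \<tau> k) :: complex^'n^'n)"
      by (subst (1 2) \<tau>) (simp add: vec_eq_iff)
    finally show ?thesis by (simp only: conj_transpose_defect H_def)
  qed
  have realH: "realmat (conj_transpose (chain (q k) (c k) t) ** H k ** chain (q k) (c k) t)" if t: "t \<le> l" for k t
  proof -
    define C where "C = chain (q k) (c k) t"
    have uC: "unitary_matrix C" unfolding C_def using unitary_chain[where l = l and t = t] q t by blast
    have "realmat (conj_transpose C ** defect (G k) ** C)"
      unfolding C_def G_def using q l t max by (rule realmat_defect_of_maximal_trace)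
    moreover have "conj_transpose C ** H k ** C = conj_transpose C ** defect (G k) ** C - dg (\<lambda>_. \<tau> k)"
    proof -
      have "conj_transpose C ** H k ** C = conj_transpose C ** defect (G k) ** C - (conj_transpose C ** dg (\<lambda>_. \<tau> k)) ** C"
        by (simp only: H_def matrix_diff_mult_distrib matrix_mult_diff_distrib)
      also have "(conj_transpose C ** dg (\<lambda>_. \<tau> k)) ** C = dg (\<lambda>_. \<tau> k)"
        unfolding dg_const_commute[symmetric] using uC by (simp flip: matrix_mul_assoc)
      finally show ?thesis .
    qed
    moreover have "Im (\<tau> k) = 0" by (subst \<tau>) simp
    ultimately show ?thesis unfolding C_def[symmetric] by (simp add: realmat_def)
  qed
  have "\<forall>\<^sub>F k in sequentially. (\<exists>c. defect (G k) = dg (\<lambda>_. c)) \<longrightarrow> G k = mat 1"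
  proof (rule eventually_eq_1_of_scalar_defect[OF uG Glim])
    fix k show "det (G k) * det (G k) = 1"
      unfolding G_def using q cP[of k] by (intro det_chain_sq) (auto simp: P_def)
  qed
  then have H0: "\<forall>\<^sub>F k in sequentially. H k \<noteq> 0"
  proof eventually_elim
    case (elim k)
    show ?case
    proof
      assume "H k = 0"
      then have "defect (G k) = dg (\<lambda>_. \<tau> k)" by (simp add: H_def)
      then have "chain (q k) (c k) l = mat 1" using elim unfolding G_def by blast
      then have "c k \<in> lagrangian_locus TYPE('n) I l m z"
        unfolding lagrangian_locus_iff[OF l] using q cP by (intro conjI exI[of _ "q k"]) auto
      then show False using cL by blast
    qed
  qed
  \<comment> \<open>If \<open>H k = 0\<close> then \<open>N k = 0\<close>, so all \<open>N k\<close>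
    lie in the unit ball, while norm 1 holds eventually and survives in the limit.\<close>
  define N where "N k = (1 / norm (H k)) *\<^sub>R H k" for k
  have "\<forall>k. N k \<in> cball 0 1" by (simp add: N_def)
  then obtain N0 p where p: "strict_mono (p :: nat \<Rightarrow> nat)" and N0: "(N \<circ> p) \<longlonglongrightarrow> N0"
    using compact_imp_seq_compact[OF compact_cball] unfolding seq_compact_def by blast
  have N0': "(\<lambda>k. N (p k)) \<longlonglongrightarrow> N0" using N0 by (simp add: o_def)
  have "\<forall>\<^sub>F k in sequentially. H (p k) \<noteq> 0" using H0 p by (rule eventually_subseq[rotated])
  then have "\<forall>\<^sub>F k in sequentially. norm (N (p k)) = 1" by eventually_elim (simp add: N_def)
  then have "(\<lambda>k. norm (N (p k))) \<longlonglongrightarrow> 1" by (rule tendsto_eventually)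
  then have norm1: "norm N0 = 1" using LIMSEQ_unique tendsto_norm[OF N0'] by blast
  have "trace (N k) = 0" for k
  proof -
    have "trace (N k) = (1 / norm (H k)) *\<^sub>R trace (H k)" by (simp add: N_def trace_def scaleR_sum_right)
    then show ?thesis by (simp add: trH)
  qed
  then have "(\<lambda>k. 0) \<longlonglongrightarrow> trace N0" using tendsto_trace[OF N0'] by simp
  then have tr0: "trace N0 = 0" using LIMSEQ_unique tendsto_const by blast
  have "conj_transpose (N k) = N k" for k
  proof -
    have "conj_transpose (N k) = (1 / norm (H k)) *\<^sub>R conj_transpose (H k)" by (simp add: N_def vec_eq_iff)
    then show ?thesis by (simp only: hermH N_def)
  qed
  then have "(\<lambda>k. N (p k)) \<longlonglongrightarrow> conj_transpose N0" using tendsto_conj_transpose[OF N0'] by simp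
  then have herm0: "conj_transpose N0 = N0" using LIMSEQ_unique N0' by blast
  have real0: "realmat (conj_transpose (chain R b t) ** N0 ** chain R b t)" if t: "t \<le> l" for t
    unfolding realmat_def
  proof (intro allI)
    fix i j
    have "Im ((conj_transpose (chain (q k) (c k) t) ** N k ** chain (q k) (c k) t) $ i $ j) = 0" for k
    proof -
      have "conj_transpose A ** (x *\<^sub>R B) ** A = x *\<^sub>R (conj_transpose A ** B ** A)" for A B :: "complex^'n^'n" and x :: real
        by (simp only: matrix_mult_scaleR scaleR_matrix_mult)
      then show ?thesis using realH[OF t, of k] by (simp add: N_def realmat_def)
    qed
    moreover have "(\<lambda>k. chain (q (p k)) (c (p k)) t) \<longlonglongrightarrow> chain R b t"
    proof (rule tendsto_chain)
      show "(\<lambda>k. q (p k) s) \<longlonglongrightarrow> R s" for s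
        using LIMSEQ_subseq_LIMSEQ[OF qR p] by (simp add: o_def)
      show "(\<lambda>k. c (p k) s j) \<longlonglongrightarrow> b s j" for s j
        using LIMSEQ_subseq_LIMSEQ[OF cb p] by (simp add: o_def)
    qed
    then have "(\<lambda>k. Im ((conj_transpose (chain (q (p k)) (c (p k)) t) ** N (p k) ** chain (q (p k)) (c (p k)) t) $ i $ j)) \<longlonglongrightarrow>
        Im ((conj_transpose (chain R b t) ** N0 ** chain R b t) $ i $ j)"
      by (intro tendsto_intros N0')
    ultimately have "(\<lambda>k. 0) \<longlonglongrightarrow> Im ((conj_transpose (chain R b t) ** N0 ** chain R b t) $ i $ j)"
      by (simp only:)
    then show "Im ((conj_transpose (chain R b t) ** N0 ** chain R b t) $ i $ j) = 0"
      using LIMSEQ_unique tendsto_const by blast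
  qed
  have "N0 \<noteq> dg (\<lambda>_. c)" for c
  proof
    assume e: "N0 = dg (\<lambda>_. c)"
    then have "of_nat CARD('n) * c = 0" using tr0 by (simp add: trace_def)
    then have "c = 0" by simp
    then have "N0 = 0" using e by (simp add: vec_eq_iff)
    then show False using norm1 by simp
  qed
  then have "b \<in> inner_walls TYPE('n) I l m z"
    using inner_wall_of_symmetry[OF l stratum I bP interior R(2) G1 herm0 real0] by blast
  then show False using wall by blast
qed

text \<open>Off the outer walls all the finitely many inequalities are strict, and strict
  inequalities between continuous functions persist nearby. The interior point is what the
  definition of inner walls asks for.\<close>

lemma interior_of_unitary_locus:
  assumes \<Phi>: "outer_wall_funs TYPE('n::finite) I l \<Phi>"
    and a: "a \<in> unitary_locus TYPE('n) I l m z" "a \<notin> outer_walls I l CARD('n) m z \<Phi>"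
  shows "a \<in> top_of_set (P I l CARD('n) m z) interior_of unitary_locus TYPE('n) I l m z"
proof -
  let ?P = "P I l CARD('n) m z"
  define T where "T = {b \<in> ?P. \<forall>\<phi>\<in>\<Phi>. \<phi> b < 0}"
  have iff: "(\<exists>\<rho> :: word set \<Rightarrow> complex^'n^'n. unitary_rep l \<rho> \<and> b = spectra l \<rho>) \<longleftrightarrow> (\<forall>\<phi>\<in>\<Phi>. \<phi> b \<le> 0)"
    if "b \<in> ?P" for b
  proof -
    have w: "b \<in> weights CARD('n) l" and i: "index CARD('n) l b = of_int I"
      using that by (auto simp: P_def)
    have "\<forall>b\<in>weights CARD('n) l. index CARD('n) l b = of_int I \<longrightarrow>
        ((\<exists>\<rho> :: word set \<Rightarrow> complex^'n^'n. unitary_rep l \<rho> \<and> b = spectra l \<rho>) \<longleftrightarrow> (\<forall>\<phi>\<in>\<Phi>. \<phi> b \<le> 0))"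
      using \<Phi> unfolding outer_wall_funs_def by (elim conjE)
    from bspec[OF this w] show ?thesis using i by (rule mp)
  qed
  have "T \<subseteq> unitary_locus TYPE('n) I l m z"
  proof
    fix b assume b: "b \<in> T"
    then have "b \<in> ?P" "\<forall>\<phi>\<in>\<Phi>. \<phi> b \<le> 0" by (auto simp: T_def less_imp_le)
    then show "b \<in> unitary_locus TYPE('n) I l m z" using iff[of b] by (simp add: unitary_locus_def)
  qed
  moreover have "openin (top_of_set ?P) T"
  proof -
    have "open {b. \<phi> b < 0}" if "\<phi> \<in> \<Phi>" for \<phi>
    proof -
      have "\<forall>\<phi>\<in>\<Phi>. \<exists>k p K. 1 \<le> k \<and> k < CARD('n) \<and> p \<in> index_sets CARD('n) l k \<and> \<phi> = wall_fun l p K"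
        using \<Phi> unfolding outer_wall_funs_def by (elim conjE)
      from bspec[OF this that] obtain p K where "\<phi> = wall_fun l p K" by (elim exE conjE)
      moreover have "continuous_on UNIV (\<lambda>b :: nat \<Rightarrow> nat \<Rightarrow> real. b s j)" for s j
        by (rule continuous_on_product_then_coordinatewise[OF continuous_on_product_coordinates])
      ultimately have "continuous_on UNIV \<phi>"
        unfolding wall_fun_def partial_index_def by (auto intro!: continuous_intros)
      then show ?thesis by (intro open_Collect_less continuous_intros)
    qed
    moreover have "finite \<Phi>" using \<Phi> by (simp add: outer_wall_funs_def)
    ultimately have "open (\<Inter>\<phi>\<in>\<Phi>. {b. \<phi> b < 0})" by (intro open_INT) auto
    moreover have "T = ?P \<inter> (\<Inter>\<phi>\<in>\<Phi>. {b. \<phi> b < 0})" by (auto simp: T_def)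
    ultimately show ?thesis by (auto intro: openin_open_Int)
  qed
  ultimately have "T \<subseteq> top_of_set ?P interior_of unitary_locus TYPE('n) I l m z"
    by (rule interior_of_maximal)
  moreover have "a \<in> T"
  proof -
    have aP: "a \<in> ?P" using a(1) by (simp add: unitary_locus_def)
    have "\<forall>\<phi>\<in>\<Phi>. \<phi> a \<le> 0" using iff[OF aP] a(1) by (simp add: unitary_locus_def)
    moreover have "\<forall>\<phi>\<in>\<Phi>. \<phi> a \<noteq> 0" using a(2) aP by (auto simp: outer_walls_def)
    ultimately show ?thesis using aP by (auto simp: T_def less_le)
  qed
  ultimately show ?thesis by blast
qed

section \<open>Connectedness of chambers\<close>

lemma closedin_if_sequentially_closed:
  fixes S :: "'a::first_countable_topology set"
  assumes "T \<subseteq> S" "\<And>x l. (\<And>n. x n \<in> T) \<Longrightarrow> x \<longlonglongrightarrow> l \<Longrightarrow> l \<in> S \<Longrightarrow> l \<in> T"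
  shows "closedin (top_of_set S) T"
proof -
  have "S \<inter> closure T = T"
  proof
    show "S \<inter> closure T \<subseteq> T"
    proof
      fix y assume "y \<in> S \<inter> closure T"
      then have "y \<in> closure T" "y \<in> S" by blast+
      then obtain x where "\<forall>n. x n \<in> T" "x \<longlonglongrightarrow> y" unfolding closure_sequential by blast
      then show "y \<in> T" using assms(2) \<open>y \<in> S\<close> by blast
    qed
  qed (use assms(1) closure_subset in blast)
  then show ?thesis using closedin_closed_Int[OF closed_closure, of S T] by (simp only:)
qed

theorem corollary4p1:
  fixes l :: nat and I :: int and m :: "nat \<Rightarrow> nat list" and z :: "nat set"
    and \<Phi> :: "((nat \<Rightarrow> nat \<Rightarrow> real) \<Rightarrow> real) set" and \<Delta> :: "(nat \<Rightarrow> nat \<Rightarrow> real) set"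
  assumes "l \<ge> 3"
    and "is_stratum CARD('n::finite) l m z"
    and "outer_wall_funs TYPE('n) I l \<Phi>"
    and "\<Delta> \<in> chambers TYPE('n) I l m z \<Phi>"
  shows "\<Delta> \<inter> lagrangian_locus TYPE('n) I l m z \<noteq> {} \<longleftrightarrow> \<Delta> \<subseteq> lagrangian_locus TYPE('n) I l m z"
proof -
  let ?L = "lagrangian_locus TYPE('n) I l m z"
  have l: "l \<ge> 1" using assms(1) by simp
  have conn: "connected \<Delta>" and ne: "\<Delta> \<noteq> {}"
    and sub: "\<Delta> \<subseteq> unitary_locus TYPE('n) I l m z - (outer_walls I l CARD('n) m z \<Phi> \<union> inner_walls TYPE('n) I l m z)"
    using assms(4) unfolding chambers_def
    by (rule in_components_connected, rule in_components_nonempty, rule in_components_subset)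
  have P: "a \<in> P I l CARD('n) m z" if "a \<in> \<Delta>" for a
    using that sub by (auto simp: unitary_locus_def)
  show ?thesis
  proof
    assume "\<Delta> \<subseteq> ?L"
    then show "\<Delta> \<inter> ?L \<noteq> {}" using ne by blast
  next
    assume int: "\<Delta> \<inter> ?L \<noteq> {}"
    show "\<Delta> \<subseteq> ?L"
    \<comment> \<open>For index 0 all weights vanish and the chamber is a single point. This case is
      separate because the constant of an inner wall has to be positive.\<close>
    proof (cases "I = 0")
      case True
      have zero: "a s j = 0" if "a \<in> P I l CARD('n) m z" for a s j
      proof (cases "s \<in> {1..l} \<and> j \<in> {1..CARD('n)}")
        case True
        have nn: "0 \<le> a s j" if "s \<in> {1..l}" "j \<in> {1..CARD('n)}" for s j
          using \<open>a \<in> P I l CARD('n) m z\<close> that unfolding P_def weights_def by blast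
        have "(\<Sum>s=1..l. \<Sum>j=1..CARD('n). a s j) = 0"
          using \<open>a \<in> P I l CARD('n) m z\<close> \<open>I = 0\<close> by (simp add: P_def index_def)
        then have "(\<Sum>j=1..CARD('n). a s j) = 0"
          using nn True by (subst (asm) sum_nonneg_eq_0_iff) (auto intro: sum_nonneg)
        then show ?thesis using nn True by (subst (asm) sum_nonneg_eq_0_iff) auto
      next
        case False
        then show ?thesis using that unfolding P_def weights_def by blast
      qed
      have "a = b" if "a \<in> \<Delta>" "b \<in> \<Delta>" for a b
        by (intro ext) (simp only: zero[OF P[OF that(1)]] zero[OF P[OF that(2)]])
      then show ?thesis using int by blast
    next
      case False
      have "closedin (top_of_set \<Delta>) (\<Delta> \<inter> ?L)"
      proof (rule closedin_if_sequentially_closed)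
        fix x a assume x: "\<And>k. x k \<in> \<Delta> \<inter> ?L" "x \<longlonglongrightarrow> a" "a \<in> \<Delta>"
        then have "a \<in> ?L" using P by (intro lagrangian_locus_limit[OF l _ x(2)]) auto
        then show "a \<in> \<Delta> \<inter> ?L" using x(3) by blast
      qed simp
      \<comment> \<open>Openness of the locus in the chamber is proved as closedness of its
        complement, again by sequences.\<close>
      moreover have "closedin (top_of_set \<Delta>) (\<Delta> - \<Delta> \<inter> ?L)"
      proof (rule closedin_if_sequentially_closed)
        fix x a assume x: "\<And>k. x k \<in> \<Delta> - \<Delta> \<inter> ?L" "x \<longlonglongrightarrow> a" "a \<in> \<Delta>"
        have "a \<notin> ?L"
        proof
          assume "a \<in> ?L"
          moreover have "a \<in> top_of_set (P I l CARD('n) m z) interior_of unitary_locus TYPE('n) I l m z"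
            using x(3) sub by (intro interior_of_unitary_locus[OF assms(3)]) auto
          moreover have "a \<notin> inner_walls TYPE('n) I l m z" using x(3) sub by blast
          ultimately have "\<exists>k. x k \<in> ?L"
            using x(1) P by (intro lagrangian_near[OF l assms(2) False _ _ _ x(2)]) auto
          then show False using x(1) by blast
        qed
        then show "a \<in> \<Delta> - \<Delta> \<inter> ?L" using x(3) by blast
      qed blast
      then have "openin (top_of_set \<Delta>) (\<Delta> \<inter> ?L)" by (simp add: openin_closedin)
      ultimately have "\<Delta> \<inter> ?L = {} \<or> \<Delta> \<inter> ?L = \<Delta>"
        using conn unfolding connected_clopen by blast
      then show ?thesis using int by blast
    qed
  qed
qed

end
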